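(* Let $\chi$ be a Dirichlet character modulo a positive integer $j$, and let $r$ be a positive integer or $r=\infty$. The function $J_r(s,\chi)$, defined for $\mathrm{Re}(s)>1$ by $J_r(s,\chi)=\sum_{n=1}^{\infty}\chi(n)a_r(n)n^{-s}$, has a meromorphic continuation to the half plane $\mathrm{Re}(s)>0$.
   Context: For an isomorphism class $G$ of finite Abelian groups, a group-partition of $G$ is a sequence $(G_1,G_2,G_3,\dots)$ of isomorphism classes of finite Abelian groups (all but finitely many trivial) such that $G=G_1\oplus G_2\oplus G_3\oplus\cdots$ and $G_1\supseteq G_2\supseteq G_3\supseteq\cdots$, where $G_i\supseteq G_{i+1}$ means that $G_{i+1}$ is isomorphic to a subgroup of $G_i$. For a positive integer $r$, $\pi_r(G)$ is the number of group-partitions of $G$ with at most $r$ factors (i.e. at most $r$ nontrivial $G_i$), and $\pi_\infty(G)$ is the number of all group-partitions of $G$. For $n\ge 1$ and $r\in\{1,2,3,\dots\}\cup\{\infty\}$, put $a_r(n):=\sum_{|G|=n}\pi_r(G)$, where $G$ runs over the isomorphism classes of Abelian groups of order $n$. The series defining $J_r(s,\chi)$ converges absolutely for $\mathrm{Re}(s)>1$. *)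

theory Defs
  imports
    "HOL-Library.Extended_Nat"
    "HOL-Algebra.Product_Groups"
    "HOL-Complex_Analysis.Meromorphic"
begin

(* Every finite group is isomorphic to one whose carrier is a set of natural numbers, so the
   isomorphism classes of finite Abelian groups are represented by the equivalence classes of
   such groups on type nat.  The argument of iso_class may live on any type: the result is the
   class, on type nat, of all finite Abelian groups isomorphic to it. *)

definition finite_abelian :: "nat monoid set" where
  "finite_abelian = {G. comm_group G \<and> finite (carrier G)}"

definition iso_class :: "'a monoid \<Rightarrow> nat monoid set" where
  "iso_class G = {H \<in> finite_abelian. H \<cong> G}"

definition abelian_classes :: "nat monoid set set" where
  "abelian_classes = iso_class ` finite_abelian"

definition abelian_classes_of_order :: "nat \<Rightarrow> nat monoid set set" where
  "abelian_classes_of_order n = iso_class ` {G \<in> finite_abelian. Coset.order G = n}"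

definition nontrivial_class :: "nat monoid set \<Rightarrow> bool" where
  "nontrivial_class C \<longleftrightarrow> (\<exists>G\<in>C. \<not> trivial_group G)"

definition class_contains :: "nat monoid set \<Rightarrow> nat monoid set \<Rightarrow> bool" where
  "class_contains C D \<longleftrightarrow>
     (\<exists>G\<in>C. \<exists>H\<in>D. \<exists>K. subgroup K G \<and> H \<cong> G\<lparr>carrier := K\<rparr>)"

(* The sequences are indexed from 0: P i is the factor usually written with index i + 1. *)

definition is_direct_sum :: "nat monoid set \<Rightarrow> (nat \<Rightarrow> nat monoid set) \<Rightarrow> bool" where
  "is_direct_sum C P \<longleftrightarrow> (\<exists>G. (\<forall>i. G i \<in> P i) \<and> C = iso_class (sum_group UNIV G))"

definition group_partition :: "nat monoid set \<Rightarrow> (nat \<Rightarrow> nat monoid set) \<Rightarrow> bool" where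
  "group_partition C P \<longleftrightarrow>
     (\<forall>i. P i \<in> abelian_classes) \<and> finite {i. nontrivial_class (P i)} \<and>
     is_direct_sum C P \<and> (\<forall>i. class_contains (P i) (P (Suc i)))"

(* For r = \<infinity> the bound on the number of nontrivial factors is vacuous. *)

definition num_group_partitions :: "enat \<Rightarrow> nat monoid set \<Rightarrow> nat" where
  "num_group_partitions r C =
     card {P. group_partition C P \<and> enat (card {i. nontrivial_class (P i)}) \<le> r}"

definition group_partition_sum :: "enat \<Rightarrow> nat \<Rightarrow> nat" where
  "group_partition_sum r n = (\<Sum>C\<in>abelian_classes_of_order n. num_group_partitions r C)"

definition dirichlet_character :: "nat \<Rightarrow> (int \<Rightarrow> complex) \<Rightarrow> bool" where
  "dirichlet_character j chi \<longleftrightarrow>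
     (\<forall>a b. chi (a * b) = chi a * chi b) \<and>
     (\<forall>a. chi (a + int j) = chi a) \<and>
     (\<forall>a. chi a \<noteq> 0 \<longleftrightarrow> coprime a (int j))"

definition J_term :: "enat \<Rightarrow> (int \<Rightarrow> complex) \<Rightarrow> complex \<Rightarrow> nat \<Rightarrow> complex" where
  "J_term r chi s n = chi (int n) * of_nat (group_partition_sum r n) * of_nat n powr (- s)"

(* Meaningful for Re s > 1 only; suminf yields an unspecified value where the series diverges. *)

definition J :: "enat \<Rightarrow> (int \<Rightarrow> complex) \<Rightarrow> complex \<Rightarrow> complex" where
  "J r chi s = (\<Sum>n. J_term r chi s (Suc n))"

end

theory Submission
  imports Defs "HOL-Algebra.Multiplicative_Group"
begin

text \<open>
  Invariant factors turn a finite Abelian group into a chain of divisors, and one group embeds in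
  another iff the invariant factors divide each other termwise. Hence a group-partition of a group
  of order n is a two-dimensional array of positive integers with product n that decreases in the
  divisibility order along rows and columns, that is, a plane partition with (max, min, +) replaced
  by (lcm, gcd, times). The toggle proof of MacMahon's formula works verbatim in this lattice and
  shows that such arrays with at most r rows are equinumerous with arbitrary arrays k of positive
  integers for which the product of all k(i,j)^(i+j+1) is n. No Euler product is needed:
  complete multiplicativity of chi(n) n^(-s) gives
  J(s) = L(s, chi) L(2s, chi^2)^min(2,r) L(3s, chi^3)^min(3,r) ... for Re s > 1.
  Each factor continues meromorphically to Re s > 0, and near any point of this half plane all but
  finitely many factors are given by their Dirichlet series and form a convergent product.
\<close>

section \<open>Multiplicative reverse plane partitions\<close>

text \<open>Toggling rests on two facts: reflecting an entry x between its bounds l and u, x going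
  to l u / x, stays between them, and gcd times lcm is the product. Both hold for divisibility, so
  all primes are treated at once. One invariant controls the bijection: at a cell where the diagonal
  leaves the shape, the product of the array along that diagonal equals the product of its image
  over the rectangle to the north-west. Multiplied over the boundary of a rectangle, this counts
  each cell of the image as often as its hook is long. Hence the exponents i+j+1, and min(k, r) is
  the number of cells of hook length k in r rows. The factor L(ks, chi^k) may have a pole at s =
  1/k, and these points accumulate at 0, so the number of factors to be continued depends on the
  point. The continuation is therefore defined globally as the pointwise limit of the partial
  products, and meromorphy is a local check. On the group side, the hard direction is that an
  embedding forces termwise divisibility; for each prime power it follows from counting an
  elementary abelian section that monomorphisms preserve.\<close>

definition young :: "(nat \<times> nat) set \<Rightarrow> bool" where
  "young D \<longleftrightarrow> finite D \<and> (\<forall>i j. (i, j) \<in> D \<longrightarrow> 1 \<le> i \<and> 1 \<le> j) \<and>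
     (\<forall>i j i' j'. (i, j) \<in> D \<longrightarrow> 1 \<le> i' \<longrightarrow> i' \<le> i \<longrightarrow> 1 \<le> j' \<longrightarrow> j' \<le> j \<longrightarrow> (i', j') \<in> D)"

lemma young_ge1: "young D \<Longrightarrow> (i, j) \<in> D \<Longrightarrow> 1 \<le> i \<and> 1 \<le> j"
  unfolding young_def by blast

lemma young_down:
  "young D \<Longrightarrow> (i, j) \<in> D \<Longrightarrow> 1 \<le> i' \<Longrightarrow> i' \<le> i \<Longrightarrow> 1 \<le> j' \<Longrightarrow> j' \<le> j \<Longrightarrow> (i', j') \<in> D"
  unfolding young_def by blast

text \<open>Reverse plane partitions of shape D with positive integers under divisibility as entries; cells
  are indexed from 1, and a cell outside D (in particular one with index 0) carries the entry 1.\<close>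

definition rpp :: "(nat \<times> nat) set \<Rightarrow> (nat \<times> nat \<Rightarrow> nat) set" where
  "rpp D = {f. (\<forall>c. f c > 0) \<and> (\<forall>c. c \<notin> D \<longrightarrow> f c = 1) \<and>
     (\<forall>i j. (Suc i, j) \<in> D \<longrightarrow> f (i, j) dvd f (Suc i, j)) \<and>
     (\<forall>i j. (i, Suc j) \<in> D \<longrightarrow> f (i, j) dvd f (i, Suc j))}"

definition fillings :: "'c set \<Rightarrow> ('c \<Rightarrow> nat) set" where
  "fillings D = {f. (\<forall>c. f c > 0) \<and> (\<forall>c. c \<notin> D \<longrightarrow> f c = 1)}"

fun diag_prod :: "(nat \<times> nat \<Rightarrow> nat) \<Rightarrow> nat \<Rightarrow> nat \<Rightarrow> nat" where
  "diag_prod f (Suc i) (Suc j) = f (Suc i, Suc j) * diag_prod f i j"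
| "diag_prod f i j = 1"

lemma diag_prod_0 [simp]: "diag_prod f i 0 = 1"
  by (cases i) auto

definition rect_prod :: "(nat \<times> nat \<Rightarrow> nat) \<Rightarrow> nat \<Rightarrow> nat \<Rightarrow> nat" where
  "rect_prod f i j = prod f ({1..i} \<times> {1..j})"

lemma rect_prod_0 [simp]: "rect_prod f 0 j = 1" "rect_prod f i 0 = 1"
  by (auto simp: rect_prod_def)

lemma rect_prod_Suc1: "rect_prod f (Suc i) j = rect_prod f i j * (\<Prod>j'\<in>{1..j}. f (Suc i, j'))"
proof -
  have "{1..Suc i} \<times> {1..j} = {1..i} \<times> {1..j} \<union> {Suc i} \<times> {1..j}" by auto
  moreover have "prod f ({1..i} \<times> {1..j} \<union> {Suc i} \<times> {1..j}) = prod f ({1..i} \<times> {1..j}) * prod f ({Suc i} \<times> {1..j})"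
    by (rule prod.union_disjoint) auto
  moreover have "prod f ({Suc i} \<times> {1..j}) = (\<Prod>j'\<in>{1..j}. f (Suc i, j'))"
    by (rule prod.reindex_bij_witness[of _ "\<lambda>j. (Suc i, j)" snd]) auto
  ultimately show ?thesis by (simp add: rect_prod_def)
qed

text \<open>Inclusion-exclusion without division. Diagonal products obey the same recurrence at a
  toggled corner, see \<open>diag_prod_corner\<close>; this match is the core of the
  bijection.\<close>

lemma rect_prod_rec:
  "rect_prod f (Suc i) (Suc j) * rect_prod f i j = f (Suc i, Suc j) * rect_prod f i (Suc j) * rect_prod f (Suc i) j"
  by (simp add: rect_prod_Suc1)

lemma rppD:
  assumes "f \<in> rpp E"
  shows "f c > 0" "c \<notin> E \<Longrightarrow> f c = 1"
    "(Suc i, j) \<in> E \<Longrightarrow> f (i, j) dvd f (Suc i, j)" "(i, Suc j) \<in> E \<Longrightarrow> f (i, j) dvd f (i, Suc j)"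
  using assms unfolding rpp_def by blast+

lemma rpp_border:
  assumes "f \<in> rpp E" "young E"
  shows "f (0, j) = 1" "f (i, 0) = 1"
proof -
  have "(0, j) \<notin> E" "(i, 0) \<notin> E" using young_ge1[OF assms(2), of 0 j] young_ge1[OF assms(2), of i 0] by auto
  then show "f (0, j) = 1" "f (i, 0) = 1" using rppD(2)[OF assms(1)] by blast+
qed

lemma rect_prod_cong:
  assumes "\<And>i' j'. i' \<le> i \<Longrightarrow> j' \<le> j \<Longrightarrow> f (i', j') = g (i', j')"
  shows "rect_prod f i j = rect_prod g i j"
  unfolding rect_prod_def using assms by (intro prod.cong) auto

text \<open>With \<open>x = l * u\<close> and \<open>g = l * u * v\<close>, the reflection exchanges
  u and v. It is the multiplicative form of x going to l + g - x.\<close>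

lemma dvd_reflect:
  fixes l g x :: nat
  assumes "x > 0" "l dvd x" "x dvd g" "g > 0"
  shows "l dvd l * g div x" "l * g div x dvd g" "l * g div (l * g div x) = x" "l * g div x > 0"
    "l * g div x * x = l * g"
proof -
  obtain u where u: "x = l * u" using assms(2) by blast
  obtain v where v: "g = x * v" using assms(3) by blast
  have pos: "l > 0" "u > 0" "v > 0" using assms u v by auto
  have e: "l * g div x = l * v" using u v pos by simp
  show "l dvd l * g div x" "l * g div x dvd g" "l * g div x > 0" using e u v pos by auto
  show "l * g div (l * g div x) = x" using e u v pos by simp
  show "l * g div x * x = l * g" using e u v pos by simp
qed

section \<open>Toggling the diagonal of a corner cell\<close>

locale corner =
  fixes D :: "(nat \<times> nat) set" and a b :: nat
  assumes young_small: "young D" and young_big: "young (insert (a, b) D)"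
    and corner: "\<And>i j. (i, j) \<in> D \<Longrightarrow> a \<le> i \<Longrightarrow> b \<le> j \<Longrightarrow> False"
begin

text \<open>The cells of the corner's diagonal strictly north-west of it; sums replace the
  difference \<open>j - i = b - a\<close>, which would be truncated on naturals.\<close>

definition on_diag :: "nat \<Rightarrow> nat \<Rightarrow> bool" where
  "on_diag i j \<longleftrightarrow> 1 \<le> i \<and> 1 \<le> j \<and> i < a \<and> j + a = i + b"

text \<open>For \<open>i = 1\<close> or \<open>j = 1\<close> this reads an entry with index 0, which
  is 1 in an array, so the border needs no special case.\<close>

definition low :: "(nat \<times> nat \<Rightarrow> nat) \<Rightarrow> nat \<Rightarrow> nat \<Rightarrow> nat" where
  "low f i j = lcm (f (i - 1, j)) (f (i, j - 1))"

definition upp :: "(nat \<times> nat \<Rightarrow> nat) \<Rightarrow> nat \<Rightarrow> nat \<Rightarrow> nat" where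
  "upp f i j = gcd (f (Suc i, j)) (f (i, Suc j))"

text \<open>Piecewise-linear toggling of the diagonal through the corner cell, with lcm and gcd in place of
  maximum and minimum. It trades the entry of the corner for a free parameter.\<close>

definition toggle :: "nat \<Rightarrow> (nat \<times> nat \<Rightarrow> nat) \<Rightarrow> (nat \<times> nat \<Rightarrow> nat)" where
  "toggle v f = (\<lambda>(i, j). if on_diag i j then low f i j * upp f i j div f (i, j)
     else if (i, j) = (a, b) then v else f (i, j))"

lemma ab: "a \<ge> 1" "b \<ge> 1"
  using young_ge1[OF young_big, of a b] by auto

lemma diag_in: "on_diag i j \<Longrightarrow> (i, j) \<in> D \<and> (Suc i, j) \<in> D \<and> (i, Suc j) \<in> D"
proof -
  assume d: "on_diag i j"
  have *: "1 \<le> i' \<Longrightarrow> i' \<le> a \<Longrightarrow> 1 \<le> j' \<Longrightarrow> j' \<le> b \<Longrightarrow> (i', j') \<in> insert (a, b) D" for i' j'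
    using young_big unfolding young_def by blast
  show ?thesis using d *[of i j] *[of "Suc i" j] *[of i "Suc j"] ab by (auto simp: on_diag_def)
qed

lemma in_line: "(i, j) \<in> D \<Longrightarrow> j + a = i + b \<Longrightarrow> on_diag i j"
  using corner[of i j] young_ge1[OF young_small, of i j]
  unfolding on_diag_def by (cases "i < a") auto

lemma not_ab: "(a, b) \<notin> D" using corner by blast

lemma low_pos: "f \<in> rpp E \<Longrightarrow> low f i j > 0"
  unfolding low_def by (intro lcm_pos_nat) (rule rppD, assumption)+

lemma low_dvd:
  assumes "f \<in> rpp E" "(i, j) \<in> E" "1 \<le> i" "1 \<le> j"
  shows "low f i j dvd f (i, j)"
  using rppD(3)[OF assms(1), of "i - 1" j] rppD(4)[OF assms(1), of i "j - 1"] assms(2-)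
  by (simp add: low_def)

lemma upp_dvd:
  assumes "f \<in> rpp E" "(Suc i, j) \<in> E" "(i, Suc j) \<in> E"
  shows "f (i, j) dvd upp f i j"
  using rppD(3,4)[OF assms(1)] assms(2-) by (simp add: upp_def)

lemma toggle_reflect:
  assumes "f \<in> rpp E" "D \<subseteq> E" "on_diag i j"
  shows "low f i j dvd toggle v f (i, j)" "toggle v f (i, j) dvd upp f i j"
    "low f i j * upp f i j div toggle v f (i, j) = f (i, j)" "toggle v f (i, j) > 0"
    "toggle v f (i, j) * f (i, j) = low f i j * upp f i j"
proof -
  have in_E: "(i, j) \<in> E" "(Suc i, j) \<in> E" "(i, Suc j) \<in> E" and ij: "1 \<le> i" "1 \<le> j"
    using diag_in[OF assms(3)] assms(2,3) by (auto simp: on_diag_def)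
  have pos: "f (i, j) > 0" "upp f i j > 0" using rppD(1)[OF assms(1)] by (simp_all add: upp_def)
  note * = dvd_reflect[OF pos(1) low_dvd[OF assms(1) in_E(1) ij] upp_dvd[OF assms(1) in_E(2,3)] pos(2)]
  show "low f i j dvd toggle v f (i, j)" "toggle v f (i, j) dvd upp f i j"
    "low f i j * upp f i j div toggle v f (i, j) = f (i, j)" "toggle v f (i, j) > 0"
    "toggle v f (i, j) * f (i, j) = low f i j * upp f i j"
    using * assms(3) by (auto simp: toggle_def)
qed

lemma toggle_off: "\<not> on_diag i j \<Longrightarrow> (i, j) \<noteq> (a, b) \<Longrightarrow> toggle v f (i, j) = f (i, j)"
  by (auto simp: toggle_def)

lemma toggle_ab: "toggle v f (a, b) = v"
  by (auto simp: toggle_def on_diag_def)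

text \<open>Neighbours of a cell lie on adjacent diagonals, which toggling does not touch. The
  bounds thus survive toggling, and toggling twice restores the diagonal.\<close>

lemma low_toggle: "on_diag i j \<or> (i, j) = (a, b) \<Longrightarrow> low (toggle v f) i j = low f i j"
proof -
  assume d: "on_diag i j \<or> (i, j) = (a, b)"
  have "\<not> on_diag (i - 1) j" "(i - 1, j) \<noteq> (a, b)" "\<not> on_diag i (j - 1)" "(i, j - 1) \<noteq> (a, b)"
    using d ab by (auto simp: on_diag_def)
  then show ?thesis by (simp add: low_def toggle_off)
qed

lemma upp_toggle: "on_diag i j \<Longrightarrow> upp (toggle v f) i j = upp f i j"
proof -
  assume d: "on_diag i j"
  have "\<not> on_diag (Suc i) j" "(Suc i, j) \<noteq> (a, b)" "\<not> on_diag i (Suc j)" "(i, Suc j) \<noteq> (a, b)"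
    using d ab by (auto simp: on_diag_def)
  then show ?thesis by (simp add: upp_def toggle_off)
qed

text \<open>An edge joins two different diagonals, so at most one end is toggled, and
  \<open>low\<close> or \<open>upp\<close> already takes the other end into account. The set
  \<open>E\<close> is left open to serve both the removal and the insertion of the corner.\<close>

lemma toggle_dvd:
  assumes f: "f \<in> rpp E" and E: "D \<subseteq> E"
    and edge: "(i' = Suc i \<and> j' = j) \<or> (i' = i \<and> j' = Suc j)"
    and inD: "(i', j') \<in> D"
  shows "toggle v f (i, j) dvd toggle v f (i', j')"
proof -
  have "(i', j') \<in> E" using E inD by auto
  then have inE: "f (i, j) dvd f (i', j')" using rppD(3,4)[OF f] edge by auto
  show ?thesis
  proof (cases "on_diag i j")
    case True
    then have "\<not> on_diag i' j'" using edge by (auto simp: on_diag_def)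
    moreover have "(i', j') \<noteq> (a, b)" using inD not_ab by auto
    ultimately have "toggle v f (i', j') = f (i', j')" by (rule toggle_off)
    moreover have "upp f i j dvd f (i', j')" using edge by (auto simp: upp_def)
    ultimately show ?thesis using toggle_reflect(2)[OF f E True] dvd_trans by metis
  next
    case False
    have "(i, j) \<noteq> (a, b)" using edge inD corner[of i' j'] by auto
    then have src: "toggle v f (i, j) = f (i, j)" using False by (intro toggle_off)
    show ?thesis
    proof (cases "on_diag i' j'")
      case True
      have "f (i, j) dvd low f i' j'" using edge by (auto simp: low_def)
      then show ?thesis using src toggle_reflect(1)[OF f E True] dvd_trans by metis
    next
      case False
      moreover have "(i', j') \<noteq> (a, b)" using inD not_ab by auto
      ultimately show ?thesis using src inE by (simp add: toggle_off)
    qed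
  qed
qed

lemma toggle_outside: "c \<notin> D \<Longrightarrow> c \<noteq> (a, b) \<Longrightarrow> toggle v f c = f c"
  using diag_in by (cases c) (auto intro!: toggle_off)

lemma toggle_pos:
  assumes "f \<in> rpp E" "D \<subseteq> E" "v > 0"
  shows "toggle v f c > 0"
proof (cases c)
  case (Pair i j)
  then show ?thesis
    using toggle_reflect(4)[OF assms(1,2), of i j v] toggle_off[of i j v f] toggle_ab[of v f]
      rppD(1)[OF assms(1)] assms(3)
    by (cases "on_diag i j"; cases "(i, j) = (a, b)") auto
qed

lemma toggle_down:
  assumes f: "f \<in> rpp (insert (a, b) D)"
  shows "toggle 1 f \<in> rpp D"
  unfolding rpp_def
proof (intro CollectI conjI allI impI)
  fix c show "toggle 1 f c > 0" by (rule toggle_pos[OF f]) auto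
next
  fix c assume "c \<notin> D"
  then show "toggle 1 f c = 1"
    using rppD(2)[OF f, of c] toggle_outside[of c] toggle_ab by (cases "c = (a, b)") auto
next
  fix i j assume "(Suc i, j) \<in> D"
  then show "toggle 1 f (i, j) dvd toggle 1 f (Suc i, j)" by (intro toggle_dvd[OF f]) auto
next
  fix i j assume "(i, Suc j) \<in> D"
  then show "toggle 1 f (i, j) dvd toggle 1 f (i, Suc j)" by (intro toggle_dvd[OF f]) auto
qed

text \<open>Only the edges into the corner are new: their sources are off the diagonal, hence
  unchanged, and divide \<open>low f a b\<close>.\<close>

lemma toggle_up:
  assumes f: "f \<in> rpp D" and k: "k > 0"
  shows "toggle (k * low f a b) f \<in> rpp (insert (a, b) D)"
proof -
  let ?v = "k * low f a b"
  have v: "?v > 0" using low_pos[OF f] k by simp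
  have nb: "toggle ?v f (i, b) = f (i, b)" if "Suc i = a" for i
    using that by (intro toggle_off) (auto simp: on_diag_def)
  have nb': "toggle ?v f (a, j) = f (a, j)" if "Suc j = b" for j
    using that by (intro toggle_off) (auto simp: on_diag_def)
  show ?thesis
    unfolding rpp_def
  proof (intro CollectI conjI allI impI)
    fix c show "toggle ?v f c > 0" by (rule toggle_pos[OF f order.refl v])
  next
    fix c assume "c \<notin> insert (a, b) D"
    then show "toggle ?v f c = 1" using rppD(2)[OF f, of c] toggle_outside[of c] by auto
  next
    fix i j assume *: "(Suc i, j) \<in> insert (a, b) D"
    show "toggle ?v f (i, j) dvd toggle ?v f (Suc i, j)"
    proof (cases "(Suc i, j) = (a, b)")
      case True
      then show ?thesis using nb[of i] toggle_ab[of ?v f] by (auto simp: low_def)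
    next
      case False
      then show ?thesis using * by (intro toggle_dvd[OF f]) auto
    qed
  next
    fix i j assume *: "(i, Suc j) \<in> insert (a, b) D"
    show "toggle ?v f (i, j) dvd toggle ?v f (i, Suc j)"
    proof (cases "(i, Suc j) = (a, b)")
      case True
      then show ?thesis using nb'[of j] toggle_ab[of ?v f] by (auto simp: low_def)
    next
      case False
      then show ?thesis using * by (intro toggle_dvd[OF f]) auto
    qed
  qed
qed

lemma toggle_toggle:
  assumes f: "f \<in> rpp E" and E: "D \<subseteq> E"
  shows "toggle w (toggle v f) = f((a, b) := w)"
proof
  fix c :: "nat \<times> nat"
  obtain i j where c: "c = (i, j)" by (cases c)
  show "toggle w (toggle v f) c = (f((a, b) := w)) c"
  proof (cases "on_diag i j")
    case True
    have "toggle w (toggle v f) (i, j) = low f i j * upp f i j div toggle v f (i, j)"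
      using True low_toggle upp_toggle by (simp add: toggle_def)
    also have "\<dots> = f (i, j)" by (rule toggle_reflect(3)[OF f E True])
    finally show ?thesis using c True by (auto simp: on_diag_def)
  next
    case False
    then show ?thesis using c toggle_ab toggle_off by (cases "(i, j) = (a, b)") auto
  qed
qed

text \<open>The corner entry is an arbitrary positive multiple of \<open>low f a b\<close>, a bound
  that toggling leaves unchanged; so the quotient records the entry completely and can be any
  positive number.\<close>

lemma bij_toggle:
  "bij_betw (\<lambda>f. (toggle 1 f, f (a, b) div low f a b)) (rpp (insert (a, b) D)) (rpp D \<times> {0<..})"
proof (rule bij_betwI[where g = "\<lambda>(f, k). toggle (k * low f a b) f"])
  have low: "low f a b dvd f (a, b)" "f (a, b) > 0" if "f \<in> rpp (insert (a, b) D)" for f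
    by (rule low_dvd[OF that insertI1 ab], rule rppD(1)[OF that])
  show "(\<lambda>f. (toggle 1 f, f (a, b) div low f a b)) \<in> rpp (insert (a, b) D) \<rightarrow> rpp D \<times> {0<..}"
  proof (intro funcsetI SigmaI toggle_down)
    fix f assume f: "f \<in> rpp (insert (a, b) D)"
    show "f (a, b) div low f a b \<in> {0<..}"
      using dvd_imp_le[OF low[OF f]] low_pos[OF f, of a b] by (simp add: div_greater_zero_iff)
  qed
  show "(\<lambda>(f, k). toggle (k * low f a b) f) \<in> rpp D \<times> {0<..} \<rightarrow> rpp (insert (a, b) D)"
    using toggle_up by auto
  show "(case (toggle 1 f, f (a, b) div low f a b) of (f, k) \<Rightarrow> toggle (k * low f a b) f) = f"
    if f: "f \<in> rpp (insert (a, b) D)" for f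
    using low[OF f] toggle_toggle[OF f] by (simp add: low_toggle subset_insertI)
  show "(toggle 1 (case y of (f, k) \<Rightarrow> toggle (k * low f a b) f),
      (case y of (f, k) \<Rightarrow> toggle (k * low f a b) f) (a, b) div low (case y of (f, k) \<Rightarrow> toggle (k * low f a b) f) a b) = y"
    if y: "y \<in> rpp D \<times> {0<..}" for y
  proof -
    obtain f k where [simp]: "y = (f, k)" by (cases y)
    have f: "f \<in> rpp D" and k: "k > 0" using y by auto
    have "low f a b > 0" by (rule low_pos[OF f])
    moreover have "f((a, b) := 1) = f" using rppD(2)[OF f not_ab] by (simp add: fun_upd_idem)
    ultimately show ?thesis
      using toggle_toggle[OF f order.refl] by (simp add: low_toggle toggle_ab)
  qed
qed

lemma diag_prod_off:
  "j + a \<noteq> i + b \<Longrightarrow> diag_prod (toggle v f) i j = diag_prod f i j"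
proof (induction f i j rule: diag_prod.induct)
  case (1 f i j)
  then show ?case by (auto simp: toggle_off on_diag_def)
qed auto

text \<open>Toggled times old value is \<open>low\<close> times \<open>upp\<close>, and these bounds
  telescope along the diagonal. Writing the identity crosswise avoids division.\<close>

lemma diag_prod_toggle:
  assumes f: "f \<in> rpp (insert (a, b) D)"
  shows "(Suc i, Suc j) \<in> insert (a, b) D \<Longrightarrow> j + a = i + b \<Longrightarrow>
    diag_prod f (Suc i) (Suc j) * diag_prod (toggle v f) i j * low f (Suc i) (Suc j) =
    f (Suc i, Suc j) * diag_prod f i (Suc j) * diag_prod f (Suc i) j"
proof (induction i arbitrary: j)
  case 0
  have "f (0, Suc j) = 1" "f (Suc 0, 0) = 1"
    using rpp_border[OF f young_big] by auto
  then show ?case by (cases j) (auto simp: low_def)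
next
  case (Suc i)
  show ?case
  proof (cases j)
    case 0
    have "f (Suc (Suc i), 0) = 1" "f (Suc i, 0) = 1" "f (0, Suc 0) = 1"
      using rpp_border[OF f young_big] by auto
    then show ?thesis using 0 by (auto simp: low_def)
  next
    case (Suc j')
    have d: "on_diag (Suc i) (Suc j')"
      using Suc.prems Suc in_line[of "Suc (Suc i)" "Suc j"] ab
      by (auto simp: on_diag_def)
    let ?lo = "low f (Suc i) (Suc j')" and ?up = "upp f (Suc i) (Suc j')"
    let ?x = "f (Suc i, Suc j')"
    have IH: "diag_prod f (Suc i) (Suc j') * diag_prod (toggle v f) i j' * ?lo =
      ?x * diag_prod f i (Suc j') * diag_prod f (Suc i) j'"
      using Suc.prems Suc diag_in[OF d] by (intro Suc.IH) auto
    have T: "toggle v f (Suc i, Suc j') * ?x = ?lo * ?up"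
      by (rule toggle_reflect(5)[OF f _ d]) auto
    \<comment> \<open>\<open>upp\<close> at one cell of the diagonal and \<open>low\<close> at the
      next are the gcd and the lcm of the same two cells.\<close>
    have gl: "?up * low f (Suc (Suc i)) (Suc (Suc j')) = f (Suc (Suc i), Suc j') * f (Suc i, Suc (Suc j'))"
      by (simp add: low_def upp_def gcd.commute lcm.commute prod_gcd_lcm_nat[symmetric])
    have pos: "?x > 0" "?lo > 0" by (rule rppD[OF f], rule low_pos[OF f])
    let ?L = "diag_prod f (Suc (Suc i)) (Suc j) * diag_prod (toggle v f) (Suc i) j * low f (Suc (Suc i)) (Suc j)"
    let ?R = "f (Suc (Suc i), Suc j) * diag_prod f (Suc i) (Suc j) * diag_prod f (Suc (Suc i)) j"
    have "?L * (?x * ?lo) = f (Suc (Suc i), Suc j) * (diag_prod f (Suc i) (Suc j') * diag_prod (toggle v f) i j' * ?lo)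
        * (toggle v f (Suc i, Suc j') * ?x) * low f (Suc (Suc i)) (Suc j)"
      using Suc by (simp add: mult_ac)
    also have "\<dots> = f (Suc (Suc i), Suc j) * (?x * diag_prod f i (Suc j') * diag_prod f (Suc i) j')
        * (?lo * ?up) * low f (Suc (Suc i)) (Suc j)"
      by (simp only: IH T)
    also have "\<dots> = f (Suc (Suc i), Suc j) * (?x * diag_prod f i (Suc j') * diag_prod f (Suc i) j')
        * ?lo * (?up * low f (Suc (Suc i)) (Suc j))"
      by (simp only: mult.assoc)
    also have "\<dots> = ?R * (?x * ?lo)"
      using Suc gl by (simp add: mult_ac)
    finally show ?thesis using pos by simp
  qed
qed

lemma diag_prod_corner:
  assumes f: "f \<in> rpp (insert (a, b) D)"
  shows "diag_prod f a b * diag_prod (toggle 1 f) (a - 1) (b - 1) =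
    (f (a, b) div low f a b) * diag_prod f (a - 1) b * diag_prod f a (b - 1)"
proof -
  obtain i j where ij: "a = Suc i" "b = Suc j" using ab by (cases a; cases b) auto
  have "low f a b dvd f (a, b)" using low_dvd[OF f insertI1 ab] .
  then have k: "f (a, b) = (f (a, b) div low f a b) * low f a b" by simp
  have pos: "low f a b > 0" by (rule low_pos[OF f])
  have "diag_prod f a b * diag_prod (toggle 1 f) i j * low f a b = f (a, b) * diag_prod f i b * diag_prod f a j"
    using diag_prod_toggle[OF f, of i j 1] ij by simp
  also have "\<dots> = (f (a, b) div low f a b * diag_prod f i b * diag_prod f a j) * low f a b"
    by (subst k) (simp add: mult_ac)
  finally show ?thesis using pos ij by simp
qed

end

text \<open>The shape loses one corner at a time; the entry of the image at that corner is the
  parameter freed by toggling. The identity is claimed only where the diagonal leaves the shape,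
  since earlier products along the diagonal are changed by later toggles.\<close>

lemma rpp_fillings_bij:
  assumes "young D"
  shows "\<exists>\<Phi>. bij_betw \<Phi> (rpp D) (fillings D) \<and>
    (\<forall>f\<in>rpp D. \<forall>i j. (i, j) \<in> D \<longrightarrow> (Suc i, Suc j) \<notin> D \<longrightarrow> diag_prod f i j = rect_prod (\<Phi> f) i j)"
  using assms
proof (induction "card D" arbitrary: D)
  case 0
  then have [simp]: "D = {}" unfolding young_def by simp
  have "rpp {} = fillings {}" by (auto simp: rpp_def fillings_def)
  then have "bij_betw id (rpp D) (fillings D)" by simp
  then show ?case by (intro exI[of _ id] conjI) (assumption, simp)
next
  case (Suc n D')
  have fin: "finite D'" using Suc.prems unfolding young_def by blast
  have ne: "D' \<noteq> {}" using Suc.hyps(2) by auto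
  \<comment> \<open>A cell with the largest index sum has no other cell weakly south-east of it, so
    it is a corner.\<close>
  obtain c where c: "c \<in> D'" and cmax: "\<And>d. d \<in> D' \<Longrightarrow> fst d + snd d \<le> fst c + snd c"
  proof -
    define s where "s = (\<lambda>d::nat \<times> nat. fst d + snd d)"
    have "Max (s ` D') \<in> s ` D'" using fin ne by (intro Max_in) auto
    then obtain c where c: "Max (s ` D') = s c" "c \<in> D'" by (rule imageE)
    have "s d \<le> s c" if "d \<in> D'" for d
      using Max_ge[of "s ` D'" "s d"] fin that unfolding c(1) by blast
    then show thesis using that[of c] c(2) unfolding s_def by blast
  qed
  obtain a b where ceq: "c = (a, b)" by (cases c)
  define D where "D = D' - {c}"
  have D': "D' = insert (a, b) D" using c ceq D_def by auto
  have corner: False if "(i, j) \<in> D" "a \<le> i" "b \<le> j" for i j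
    using cmax[of "(i, j)"] that ceq D_def by auto
  have down: "(i', j') \<in> D" if "(i, j) \<in> D" "1 \<le> i'" "i' \<le> i" "1 \<le> j'" "j' \<le> j" for i j i' j'
  proof -
    have "(i, j) \<in> D'" using that(1) D_def by blast
    then have "(i', j') \<in> D'" using young_down[OF Suc.prems] that by blast
    moreover have "(i', j') \<noteq> (a, b)" using corner[OF that(1)] that by blast
    ultimately show ?thesis by (simp add: D_def ceq)
  qed
  have ge1: "1 \<le> i \<and> 1 \<le> j" if "(i, j) \<in> D" for i j
    using young_ge1[OF Suc.prems, of i j] that D_def by blast
  have "finite D" using fin by (simp add: D_def)
  then have yD: "young D" using down ge1 unfolding young_def by blast
  interpret corner D a b
    using yD Suc.prems corner by unfold_locales (auto simp: D')
  have "n = card D" using Suc.hyps(2) c fin by (simp add: D_def)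
  from Suc.hyps(1)[OF this yD] obtain \<Phi> where
    bij: "bij_betw \<Phi> (rpp D) (fillings D)" and
    \<Phi>: "\<And>f i j. f \<in> rpp D \<Longrightarrow> (i, j) \<in> D \<Longrightarrow> (Suc i, Suc j) \<notin> D \<Longrightarrow> diag_prod f i j = rect_prod (\<Phi> f) i j"
    by blast
  let ?k = "\<lambda>f. f (a, b) div low f a b"
  define \<Psi> where "\<Psi> f = (\<Phi> (toggle 1 f))((a, b) := ?k f)" for f
  have b1: "bij_betw (\<lambda>f. (toggle 1 f, ?k f)) (rpp D') (rpp D \<times> {0<..})"
    using bij_toggle D' by simp
  have b2: "bij_betw (map_prod \<Phi> id) (rpp D \<times> {0<..}) (fillings D \<times> {0::nat<..})"
    by (rule bij_betw_map_prod[OF bij bij_betw_id])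
  have b3: "bij_betw (\<lambda>(g, k). g((a, b) := k)) (fillings D \<times> {0::nat<..}) (fillings D')"
    by (rule bij_betwI[where g = "\<lambda>g. (g((a, b) := 1), g (a, b))"])
       (use not_ab in \<open>auto simp: fillings_def D' fun_eq_iff\<close>)
  have "bij_betw \<Psi> (rpp D') (fillings D')"
    using bij_betw_trans[OF bij_betw_trans[OF b1 b2] b3] by (simp add: \<Psi>_def[abs_def] o_def)
  moreover have "diag_prod f i j = rect_prod (\<Psi> f) i j"
    if f: "f \<in> rpp D'" and ij: "(i, j) \<in> D'" "(Suc i, Suc j) \<notin> D'" for f i j
  proof -
    have f': "f \<in> rpp (insert (a, b) D)" using f D' by simp
    note tf = toggle_down[OF f']
    have rect: "rect_prod (\<Psi> f) i' j' = rect_prod (\<Phi> (toggle 1 f)) i' j'" if "\<not> (a \<le> i' \<and> b \<le> j')" for i' j'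
      using that by (intro rect_prod_cong) (auto simp: \<Psi>_def)
    show ?thesis
    proof (cases "(i, j) = (a, b)")
      case False
      then have D: "(i, j) \<in> D" "(Suc i, Suc j) \<notin> D" using ij D' by auto
      \<comment> \<open>On the corner's diagonal any other cell of the shape has its south-east
        neighbour in the shape, so it is no boundary cell.\<close>
      have "j + a \<noteq> i + b"
      proof
        assume eq: "j + a = i + b"
        have "on_diag i j" by (rule in_line[OF D(1) eq])
        then have "Suc i \<le> a" "Suc j \<le> b" using eq by (auto simp: on_diag_def)
        moreover have "(a, b) \<in> D'" using c ceq by simp
        ultimately have "(Suc i, Suc j) \<in> D'"
          using young_down[OF Suc.prems, of a b "Suc i" "Suc j"] by simp
        then show False using ij by simp
      qed
      then have "diag_prod f i j = diag_prod (toggle 1 f) i j" by (simp add: diag_prod_off)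
      also have "\<dots> = rect_prod (\<Phi> (toggle 1 f)) i j" by (rule \<Phi>[OF tf D])
      also have "\<dots> = rect_prod (\<Psi> f) i j" using corner[OF D(1)] by (intro rect[symmetric]) auto
      finally show ?thesis .
    next
      case True
      obtain i' j' where ij': "a = Suc i'" "b = Suc j'" using young_ge1[OF Suc.prems, of a b] c ceq by (cases a; cases b) simp_all
      \<comment> \<open>The northern and western neighbours of the corner are boundary cells of the
        smaller shape on untouched diagonals; if an index is 0, both products are empty.\<close>
      have P: "diag_prod f a' b' = rect_prod (\<Phi> (toggle 1 f)) a' b'"
        if "a' = i' \<and> b' = b \<or> a' = a \<and> b' = j'" for a' b'
      proof (cases "a' = 0 \<or> b' = 0")
        case True
        then show ?thesis by auto
      next
        case False
        have "(a', b') \<in> D'"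
          by (rule young_down[OF Suc.prems, of a b]) (use c ceq ij' that False in auto)
        moreover have "(a', b') \<noteq> (a, b)" "(Suc a', Suc b') \<notin> D" using that ij' corner[of "Suc a'" "Suc b'"] by auto
        ultimately have "(a', b') \<in> D" "(Suc a', Suc b') \<notin> D" unfolding D' by blast+
        moreover have "b' + a \<noteq> a' + b" using that ij' by auto
        ultimately show ?thesis using \<Phi>[OF tf, of a' b'] diag_prod_off[of b' a' 1 f] by simp
      qed
      \<comment> \<open>The cell diagonally before the corner has become a boundary cell because the
        corner was removed.\<close>
      have Q: "diag_prod (toggle 1 f) i' j' = rect_prod (\<Phi> (toggle 1 f)) i' j'"
      proof (cases "i' = 0 \<or> j' = 0")
        case True
        then show ?thesis by auto
      next
        case False
        have "(i', j') \<in> D'"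
          by (rule young_down[OF Suc.prems, of a b]) (use c ceq ij' False in auto)
        then show ?thesis using \<Phi>[OF tf, of i' j'] not_ab ij' D' by simp
      qed
      have "diag_prod f a b * rect_prod (\<Phi> (toggle 1 f)) i' j' =
          ?k f * rect_prod (\<Phi> (toggle 1 f)) i' b * rect_prod (\<Phi> (toggle 1 f)) a j'"
        using diag_prod_corner[OF f'] P Q ij' by simp
      also have "\<dots> = \<Psi> f (a, b) * rect_prod (\<Psi> f) i' b * rect_prod (\<Psi> f) a j'"
        using rect[of i' b] rect[of a j'] ij' by (simp add: \<Psi>_def)
      also have "\<dots> = rect_prod (\<Psi> f) a b * rect_prod (\<Psi> f) i' j'"
        using rect_prod_rec[of "\<Psi> f" i' j'] ij' by simp
      also have "rect_prod (\<Psi> f) i' j' = rect_prod (\<Phi> (toggle 1 f)) i' j'"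
        using ij' by (intro rect) auto
      finally have "diag_prod f a b * rect_prod (\<Phi> (toggle 1 f)) i' j' =
          rect_prod (\<Psi> f) a b * rect_prod (\<Phi> (toggle 1 f)) i' j'" .
      moreover have "rect_prod (\<Phi> (toggle 1 f)) i' j' > 0"
        using bij_betwE[OF bij] tf by (auto simp: rect_prod_def fillings_def intro!: prod_pos)
      ultimately show ?thesis using True by simp
    qed
  qed
  ultimately show ?case by (intro exI[of _ \<Psi>] conjI ballI allI impI)
qed

lemma card_filter_bij_betw:
  assumes "bij_betw f A B" "\<And>a. a \<in> A \<Longrightarrow> Q (f a) \<longleftrightarrow> P a"
  shows "card {a \<in> A. P a} = card {b \<in> B. Q b}"
proof -
  have "f ` {a \<in> A. P a} = {b \<in> B. Q b}"
    using bij_betw_imp_surj_on[OF assms(1)] assms(2) by blast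
  moreover have "inj_on f {a \<in> A. P a}"
    using bij_betw_imp_inj_on[OF assms(1)] by (rule inj_on_subset) blast
  ultimately show ?thesis using card_image by metis
qed

section \<open>Hook lengths in a rectangle\<close>

lemma prod_rect_diag_prod:
  "prod f ({1..m} \<times> {1..n}) = (\<Prod>i\<in>{1..m}. diag_prod f i n) * (\<Prod>j\<in>{1..<n}. diag_prod f m j)"
proof (induction m)
  case 0
  then show ?case by simp
next
  case (Suc m)
  \<comment> \<open>Each diagonal ending in the new row extends one that ended a row higher and one
    column to the left; the diagonals that end in the last column of the old rows stay as they
    are.\<close>
  have shift: "(\<Prod>j\<in>{1..n}. diag_prod f (Suc m) j) = (\<Prod>j\<in>{1..n}. f (Suc m, j)) * (\<Prod>j\<in>{1..<n}. diag_prod f m j)"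
  proof -
    have "(\<Prod>j\<in>{1..n}. diag_prod f (Suc m) j) = (\<Prod>j\<in>{1..n}. f (Suc m, j) * diag_prod f m (j - 1))"
    proof (rule prod.cong)
      show "diag_prod f (Suc m) j = f (Suc m, j) * diag_prod f m (j - 1)" if "j \<in> {1..n}" for j
        using that by (cases j) auto
    qed simp
    also have "\<dots> = (\<Prod>j\<in>{1..n}. f (Suc m, j)) * (\<Prod>j\<in>{1..n}. diag_prod f m (j - 1))"
      by (rule prod.distrib)
    also have "(\<Prod>j\<in>{1..n}. diag_prod f m (j - 1)) = (\<Prod>j\<in>{..<n}. diag_prod f m j)"
      by (rule prod.reindex_bij_witness[of _ Suc "\<lambda>j. j - 1"]) auto
    also have "\<dots> = (\<Prod>j\<in>{1..<n}. diag_prod f m j)"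
      by (rule prod.mono_neutral_right) (auto simp: Suc_le_eq)
    finally show ?thesis .
  qed
  have split: "(\<Prod>j\<in>{1..n}. diag_prod f (Suc m) j) = diag_prod f (Suc m) n * (\<Prod>j\<in>{1..<n}. diag_prod f (Suc m) j)"
  proof (cases n)
    case (Suc n')
    then have "{1..n} = insert n {1..<n}" by auto
    then show ?thesis by simp
  qed simp
  have "prod f ({1..Suc m} \<times> {1..n}) = prod f ({1..m} \<times> {1..n}) * (\<Prod>j\<in>{1..n}. f (Suc m, j))"
    using rect_prod_Suc1 by (simp add: rect_prod_def)
  also have "\<dots> = (\<Prod>i\<in>{1..m}. diag_prod f i n) * (\<Prod>j\<in>{1..n}. diag_prod f (Suc m) j)"
    unfolding Suc.IH shift by (simp add: mult_ac)
  also have "\<dots> = (\<Prod>i\<in>{1..Suc m}. diag_prod f i n) * (\<Prod>j\<in>{1..<Suc n - 1}. diag_prod f (Suc m) j)"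
    unfolding split by (simp add: mult_ac)
  finally show ?case by simp
qed

lemma prod_rect_prod:
  assumes "I \<subseteq> {1..m}"
  shows "(\<Prod>i\<in>I. rect_prod k i n) = (\<Prod>c\<in>{1..m} \<times> {1..n}. k c ^ card {i \<in> I. fst c \<le> i})"
proof -
  have fin: "finite I" using assms finite_subset by blast
  have "(\<Prod>i\<in>I. rect_prod k i n) = (\<Prod>i\<in>I. \<Prod>c\<in>{1..m} \<times> {1..n}. if fst c \<le> i then k c else 1)"
  proof (rule prod.cong[OF refl])
    fix i assume i: "i \<in> I"
    have "(\<Prod>c\<in>{1..m} \<times> {1..n}. if fst c \<le> i then k c else 1) = prod k ({c \<in> {1..m} \<times> {1..n}. fst c \<le> i})"
      by (rule prod.inter_filter[symmetric]) auto
    also have "{c \<in> {1..m} \<times> {1..n}. fst c \<le> i} = {1..i} \<times> {1..n}" using i assms by auto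
    finally show "rect_prod k i n = (\<Prod>c\<in>{1..m} \<times> {1..n}. if fst c \<le> i then k c else 1)"
      by (simp add: rect_prod_def)
  qed
  also have "\<dots> = (\<Prod>c\<in>{1..m} \<times> {1..n}. \<Prod>i\<in>I. if fst c \<le> i then k c else 1)"
    by (rule prod.swap)
  also have "\<dots> = (\<Prod>c\<in>{1..m} \<times> {1..n}. k c ^ card {i \<in> I. fst c \<le> i})"
    using fin by (intro prod.cong refl) (simp add: prod.inter_filter[symmetric])
  finally show ?thesis .
qed

lemma prod_rect_prod':
  assumes "B \<subseteq> {1..n}"
  shows "(\<Prod>j\<in>B. rect_prod k m j) = (\<Prod>c\<in>{1..m} \<times> {1..n}. k c ^ card {j \<in> B. snd c \<le> j})"
proof -
  have fin: "finite B" using assms finite_subset by blast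
  have "(\<Prod>j\<in>B. rect_prod k m j) = (\<Prod>j\<in>B. \<Prod>c\<in>{1..m} \<times> {1..n}. if snd c \<le> j then k c else 1)"
  proof (rule prod.cong[OF refl])
    fix j assume j: "j \<in> B"
    have "(\<Prod>c\<in>{1..m} \<times> {1..n}. if snd c \<le> j then k c else 1) = prod k ({c \<in> {1..m} \<times> {1..n}. snd c \<le> j})"
      by (rule prod.inter_filter[symmetric]) auto
    also have "{c \<in> {1..m} \<times> {1..n}. snd c \<le> j} = {1..m} \<times> {1..j}" using j assms by auto
    finally show "rect_prod k m j = (\<Prod>c\<in>{1..m} \<times> {1..n}. if snd c \<le> j then k c else 1)"
      by (simp add: rect_prod_def)
  qed
  also have "\<dots> = (\<Prod>c\<in>{1..m} \<times> {1..n}. \<Prod>j\<in>B. if snd c \<le> j then k c else 1)"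
    by (rule prod.swap)
  also have "\<dots> = (\<Prod>c\<in>{1..m} \<times> {1..n}. k c ^ card {j \<in> B. snd c \<le> j})"
    using fin by (intro prod.cong refl) (simp add: prod.inter_filter[symmetric])
  finally show ?thesis .
qed

text \<open>Weakly south-east of \<open>c = (i, j)\<close> lie \<open>m - i + 1\<close> cells of the
  last column and, apart from the shared corner, \<open>n - j\<close> cells of the last row.
  Together they number the hook length of c.\<close>

lemma prod_boundary_rect_prod:
  "(\<Prod>i\<in>{1..m}. rect_prod k i n) * (\<Prod>j\<in>{1..<n}. rect_prod k m j) =
   (\<Prod>c\<in>{1..m} \<times> {1..n}. k c ^ (m - fst c + (n - snd c) + 1))"
proof -
  have "card {i \<in> {1..m}. fst c \<le> i} + card {j \<in> {1..<n}. snd c \<le> j} = m - fst c + (n - snd c) + 1"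
    if "c \<in> {1..m} \<times> {1..n}" for c
  proof -
    have "{i \<in> {1..m}. fst c \<le> i} = {fst c..m}" "{j \<in> {1..<n}. snd c \<le> j} = {snd c..<n}"
      using that by auto
    then show ?thesis using that by (cases c) auto
  qed
  then have "(\<Prod>c\<in>{1..m} \<times> {1..n}. k c ^ card {i \<in> {1..m}. fst c \<le> i} * k c ^ card {j \<in> {1..<n}. snd c \<le> j}) =
     (\<Prod>c\<in>{1..m} \<times> {1..n}. k c ^ (m - fst c + (n - snd c) + 1))"
    by (intro prod.cong refl) (simp only: power_add[symmetric])
  then show ?thesis
    by (subst prod_rect_prod[of _ m], simp, subst prod_rect_prod'[of _ n], force) (simp add: prod.distrib)
qed

lemma young_rect: "young ({1..m} \<times> {1..n})"
  by (auto simp: young_def)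

lemma card_rpp_rect:
  "card {f \<in> rpp ({1..m} \<times> {1..n}). prod f ({1..m} \<times> {1..n}) = N} =
   card {k \<in> fillings ({1..m} \<times> {1..n}). (\<Prod>c\<in>{1..m} \<times> {1..n}. k c ^ (m - fst c + (n - snd c) + 1)) = N}"
proof -
  let ?D = "{1..m} \<times> {1..n}"
  obtain \<Phi> where bij: "bij_betw \<Phi> (rpp ?D) (fillings ?D)"
    and \<Phi>: "\<And>f i j. f \<in> rpp ?D \<Longrightarrow> (i, j) \<in> ?D \<Longrightarrow> (Suc i, Suc j) \<notin> ?D \<Longrightarrow> diag_prod f i j = rect_prod (\<Phi> f) i j"
    using rpp_fillings_bij[OF young_rect] by blast
  have key: "prod f ?D = (\<Prod>c\<in>?D. \<Phi> f c ^ (m - fst c + (n - snd c) + 1))" if f: "f \<in> rpp ?D" for f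
  proof -
    have "(\<Prod>i\<in>{1..m}. diag_prod f i n) = (\<Prod>i\<in>{1..m}. rect_prod (\<Phi> f) i n)"
      using \<Phi>[OF f, of _ n] by (cases "n = 0") (auto intro!: prod.cong)
    moreover have "(\<Prod>j\<in>{1..<n}. diag_prod f m j) = (\<Prod>j\<in>{1..<n}. rect_prod (\<Phi> f) m j)"
      using \<Phi>[OF f, of m] by (cases "m = 0") (auto intro!: prod.cong)
    ultimately show ?thesis by (simp only: prod_rect_diag_prod prod_boundary_rect_prod)
  qed
  show ?thesis by (rule card_filter_bij_betw[OF bij]) (simp only: key)
qed

section \<open>Rotation to arrays that decrease from the cell (0, 0)\<close>

definition divisor_arrays :: "nat \<Rightarrow> nat \<Rightarrow> (nat \<times> nat \<Rightarrow> nat) set" where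
  "divisor_arrays m n = {E. (\<forall>c. E c > 0) \<and> (\<forall>c. c \<notin> {..<m} \<times> {..<n} \<longrightarrow> E c = 1) \<and>
     (\<forall>i j. E (Suc i, j) dvd E (i, j)) \<and> (\<forall>i j. E (i, Suc j) dvd E (i, j))}"

text \<open>Rotation by 180 degrees. \<open>D\<close> is the shape of the result, so that one
  formula serves both directions between indices from 0 and indices from 1.\<close>

definition reflect :: "(nat \<times> nat) set \<Rightarrow> nat \<Rightarrow> nat \<Rightarrow> (nat \<times> nat \<Rightarrow> nat) \<Rightarrow> (nat \<times> nat \<Rightarrow> nat)" where
  "reflect D m n f = (\<lambda>c. if c \<in> D then f (m - fst c, n - snd c) else 1)"

lemma prod_reflect:
  fixes m n :: nat
  shows "(\<Prod>c\<in>{1..m} \<times> {1..n}. g c (f (m - fst c, n - snd c))) = (\<Prod>c\<in>{..<m} \<times> {..<n}. g (m - fst c, n - snd c) (f c))"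
  by (rule prod.reindex_bij_witness[of _ "\<lambda>c. (m - fst c, n - snd c)" "\<lambda>c. (m - fst c, n - snd c)"])
     (auto simp: mem_Times_iff prod_eq_iff)

lemma bij_reflect_fillings:
  "bij_betw (reflect ({1..m} \<times> {1..n}) m n) (fillings ({..<m} \<times> {..<n})) (fillings ({1..m} \<times> {1..n}))"
  by (rule bij_betwI[where g = "reflect ({..<m} \<times> {..<n}) m n"])
     (auto simp: reflect_def fillings_def fun_eq_iff)

lemma bij_reflect_arrays:
  "bij_betw (reflect ({1..m} \<times> {1..n}) m n) (divisor_arrays m n) (rpp ({1..m} \<times> {1..n}))"
proof (rule bij_betwI[where g = "reflect ({..<m} \<times> {..<n}) m n"])
  show "reflect ({1..m} \<times> {1..n}) m n \<in> divisor_arrays m n \<rightarrow> rpp ({1..m} \<times> {1..n})"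
  proof
    fix E assume E: "E \<in> divisor_arrays m n"
    have pos: "E c > 0" for c using E unfolding divisor_arrays_def by blast
    have d: "E (Suc i, j) dvd E (i, j)" "E (i, Suc j) dvd E (i, j)" for i j using E by (simp_all add: divisor_arrays_def)
    show "reflect ({1..m} \<times> {1..n}) m n E \<in> rpp ({1..m} \<times> {1..n})"
      unfolding rpp_def
    proof (intro CollectI conjI allI impI)
      show "reflect ({1..m} \<times> {1..n}) m n E c > 0" for c using pos by (simp add: reflect_def)
      show "reflect ({1..m} \<times> {1..n}) m n E c = 1" if "c \<notin> {1..m} \<times> {1..n}" for c using that by (simp add: reflect_def)
      fix i j
      show "reflect ({1..m} \<times> {1..n}) m n E (i, j) dvd reflect ({1..m} \<times> {1..n}) m n E (Suc i, j)"
        if "(Suc i, j) \<in> {1..m} \<times> {1..n}"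
        using d(1)[of "m - Suc i" "n - j"] that by (cases i) (simp_all add: reflect_def Suc_diff_Suc)
      show "reflect ({1..m} \<times> {1..n}) m n E (i, j) dvd reflect ({1..m} \<times> {1..n}) m n E (i, Suc j)"
        if "(i, Suc j) \<in> {1..m} \<times> {1..n}"
        using d(2)[of "m - i" "n - Suc j"] that by (cases j) (simp_all add: reflect_def Suc_diff_Suc)
    qed
  qed
  show "reflect ({..<m} \<times> {..<n}) m n \<in> rpp ({1..m} \<times> {1..n}) \<rightarrow> divisor_arrays m n"
  proof
    fix f assume f: "f \<in> rpp ({1..m} \<times> {1..n})"
    note r = rppD[OF f]
    show "reflect ({..<m} \<times> {..<n}) m n f \<in> divisor_arrays m n"
      unfolding divisor_arrays_def
    proof (intro CollectI conjI allI impI)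
      show "reflect ({..<m} \<times> {..<n}) m n f c > 0" for c using r(1) by (simp add: reflect_def)
      show "reflect ({..<m} \<times> {..<n}) m n f c = 1" if "c \<notin> {..<m} \<times> {..<n}" for c using that by (simp add: reflect_def)
      fix i j
      show "reflect ({..<m} \<times> {..<n}) m n f (Suc i, j) dvd reflect ({..<m} \<times> {..<n}) m n f (i, j)"
        using r(3)[of "m - Suc i" "n - j"] by (auto simp: reflect_def Suc_diff_Suc)
      show "reflect ({..<m} \<times> {..<n}) m n f (i, Suc j) dvd reflect ({..<m} \<times> {..<n}) m n f (i, j)"
        using r(4)[of "m - i" "n - Suc j"] by (auto simp: reflect_def Suc_diff_Suc)
    qed
  qed
  show "reflect ({..<m} \<times> {..<n}) m n (reflect ({1..m} \<times> {1..n}) m n E) = E" if "E \<in> divisor_arrays m n" for E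
    using that by (auto simp: reflect_def divisor_arrays_def fun_eq_iff)
  show "reflect ({1..m} \<times> {1..n}) m n (reflect ({..<m} \<times> {..<n}) m n f) = f" if "f \<in> rpp ({1..m} \<times> {1..n})" for f
  proof
    fix c show "reflect ({1..m} \<times> {1..n}) m n (reflect ({..<m} \<times> {..<n}) m n f) c = f c"
      using rppD(2)[OF that, of c] by (cases c) (auto simp: reflect_def)
  qed
qed

text \<open>The hook length \<open>m - i + (n - j) + 1\<close> of a cell indexed from 1 becomes
  \<open>i + j + 1\<close> after rotation; it no longer depends on the size of the rectangle, which
  later allows infinite arrays.\<close>

theorem card_divisor_arrays:
  "card {E \<in> divisor_arrays m n. prod E ({..<m} \<times> {..<n}) = N} =
   card {k \<in> fillings ({..<m} \<times> {..<n}). (\<Prod>c\<in>{..<m} \<times> {..<n}. k c ^ (fst c + snd c + 1)) = N}"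
proof -
  let ?r = "reflect ({1..m} \<times> {1..n}) m n"
  have p1: "prod (?r E) ({1..m} \<times> {1..n}) = prod E ({..<m} \<times> {..<n})" for E
    using prod_reflect[of "\<lambda>_ x. x" E m n] by (simp add: reflect_def cong: prod.cong)
  have p2: "(\<Prod>c\<in>{1..m} \<times> {1..n}. ?r k c ^ (m - fst c + (n - snd c) + 1)) =
      (\<Prod>c\<in>{..<m} \<times> {..<n}. k c ^ (fst c + snd c + 1))" for k
  proof -
    have "(\<Prod>c\<in>{1..m} \<times> {1..n}. ?r k c ^ (m - fst c + (n - snd c) + 1)) =
        (\<Prod>c\<in>{1..m} \<times> {1..n}. k (m - fst c, n - snd c) ^ (m - fst c + (n - snd c) + 1))"
      by (rule prod.cong) (auto simp: reflect_def)
    also have "\<dots> = (\<Prod>c\<in>{..<m} \<times> {..<n}. k c ^ (m - (m - fst c) + (n - (n - snd c)) + 1))"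
      using prod_reflect[of "\<lambda>c x. x ^ (m - fst c + (n - snd c) + 1)" k m n] by simp
    also have "\<dots> = (\<Prod>c\<in>{..<m} \<times> {..<n}. k c ^ (fst c + snd c + 1))"
      by (rule prod.cong) auto
    finally show ?thesis .
  qed
  have "card {E \<in> divisor_arrays m n. prod E ({..<m} \<times> {..<n}) = N} =
      card {f \<in> rpp ({1..m} \<times> {1..n}). prod f ({1..m} \<times> {1..n}) = N}"
    by (rule card_filter_bij_betw[OF bij_reflect_arrays]) (simp only: p1)
  also have "\<dots> = card {k \<in> fillings ({1..m} \<times> {1..n}). (\<Prod>c\<in>{1..m} \<times> {1..n}. k c ^ (m - fst c + (n - snd c) + 1)) = N}"
    by (rule card_rpp_rect)
  also have "\<dots> = card {k \<in> fillings ({..<m} \<times> {..<n}). (\<Prod>c\<in>{..<m} \<times> {..<n}. k c ^ (fst c + snd c + 1)) = N}"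
    by (rule card_filter_bij_betw[OF bij_reflect_fillings, symmetric]) (simp only: p2)
  finally show ?thesis .
qed

section \<open>Meromorphic continuation of the product of L-functions\<close>

lemma norm_powr_pos: "x > 0 \<Longrightarrow> norm (of_real x powr z) = x powr Re z"
  for x :: real and z :: complex
  by (simp add: norm_powr_real_powr)

text \<open>(z - 1) times the difference between x^(-z) and its mean over the interval from x to x + h. The
  factor removes the pole at 1, and the subtracted means telescope.\<close>

definition hurwitz_term :: "real \<Rightarrow> real \<Rightarrow> complex \<Rightarrow> complex" where
  "hurwitz_term h x z = (z - 1) * of_real x powr (- z)
     - (of_real x powr (1 - z) - of_real (x + h) powr (1 - z)) / of_real h"

text \<open>Up to the factor \<open>1 / h\<close> the term is the remainder of the linear Taylor
  polynomial of t^(1-z) on the interval. The gain of one power of x over x^(-z) moves convergence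
  from Re z > 1 to Re z > 0.\<close>

lemma norm_hurwitz_term_le:
  assumes "x > 0" "h > 0" "Re z > 0"
  shows "norm (hurwitz_term h x z) \<le> h * norm z * norm (z - 1) * x powr (- Re z - 1)"
proof -
  \<comment> \<open>The function t^(1-z) with its first two derivatives.\<close>
  define f :: "nat \<Rightarrow> complex \<Rightarrow> complex" where
    "f = (\<lambda>n t. if n = 0 then t powr (1 - z) else if n = 1 then (1 - z) * t powr (- z)
       else (1 - z) * (- z * t powr (- z - 1)))"
  let ?S = "closed_segment (of_real x) (of_real (x + h)) :: complex set"
  let ?B = "norm z * norm (z - 1) * x powr (- Re z - 1)"
  have S: "\<exists>u. t = of_real u \<and> x \<le> u" if "t \<in> ?S" for t
  proof -
    have "\<exists>u\<ge>0. u \<le> 1 \<and> t = (1 - u) *\<^sub>R of_real x + u *\<^sub>R of_real (x + h)"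
      using that by (simp only: in_segment(1))
    then obtain u where u: "0 \<le> u" "t = (1 - u) *\<^sub>R of_real x + u *\<^sub>R of_real (x + h)"
      by (elim exE conjE)
    then have "t = of_real (x + u * h)" by (simp add: scaleR_conv_of_real algebra_simps)
    then show ?thesis using u assms by (intro exI[of _ "x + u * h"]) auto
  qed
  have "norm (f 0 (of_real (x + h)) - (\<Sum>i\<le>1. f i (of_real x) * (of_real (x + h) - of_real x) ^ i / fact i))
      \<le> ?B * norm (of_real (x + h) - of_real x :: complex) ^ Suc 1 / fact 1"
  proof (rule complex_Taylor)
    fix i t assume t: "t \<in> ?S" and i: "i \<le> (1::nat)"
    then obtain u where u: "t = of_real u" "u \<ge> x" using S by blast
    have nz: "t \<notin> \<real>\<^sub>\<le>\<^sub>0" using u assms by (auto simp: complex_nonpos_Reals_iff)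
    show "(f i has_field_derivative f (Suc i) t) (at t within ?S)"
    proof (cases "i = 0")
      case True
      have "((\<lambda>t. t powr (1 - z)) has_field_derivative (1 - z) * t powr (1 - z - 1)) (at t within ?S)"
        using nz by (rule has_field_derivative_powr[THEN has_field_derivative_at_within])
      then show ?thesis using True by (simp add: f_def)
    next
      case False
      have "((\<lambda>t. t powr (- z)) has_field_derivative (- z) * t powr (- z - 1)) (at t within ?S)"
        using nz by (rule has_field_derivative_powr[THEN has_field_derivative_at_within])
      from DERIV_cmult[OF this, of "1 - z"] show ?thesis using False i by (simp add: f_def)
    qed
  next
    fix t assume t: "t \<in> ?S"
    then obtain u where u: "t = of_real u" "u \<ge> x" using S by blast
    have "norm (f (Suc 1) t) = norm (1 - z) * norm z * u powr (- Re z - 1)"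
      using u assms by (simp add: f_def norm_mult norm_powr_pos)
    also have "\<dots> \<le> norm (1 - z) * norm z * x powr (- Re z - 1)"
      using u assms by (intro mult_left_mono powr_mono2') auto
    finally show "norm (f (Suc 1) t) \<le> ?B" by (simp add: norm_minus_commute mult_ac)
  qed auto
  then have "norm (of_real (x + h) powr (1 - z) - of_real x powr (1 - z) - (1 - z) * of_real x powr (- z) * of_real h)
      \<le> ?B * h ^ 2"
    using assms by (simp add: f_def power2_eq_square diff_diff_eq)
  moreover have "hurwitz_term h x z =
      (of_real (x + h) powr (1 - z) - of_real x powr (1 - z) - (1 - z) * of_real x powr (- z) * of_real h) / of_real h"
    using assms by (simp add: hurwitz_term_def field_simps)
  ultimately have "norm (hurwitz_term h x z) \<le> ?B * h ^ 2 / h"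
    using assms by (simp add: norm_divide divide_right_mono)
  then show ?thesis using assms by (simp add: power2_eq_square mult_ac)
qed

lemma holomorphic_hurwitz_term: "x > 0 \<Longrightarrow> h > 0 \<Longrightarrow> (\<lambda>z. hurwitz_term h x z) holomorphic_on A"
  unfolding hurwitz_term_def by (intro holomorphic_intros) auto

definition hurwitz_sum :: "real \<Rightarrow> real \<Rightarrow> complex \<Rightarrow> complex" where
  "hurwitz_sum h a z = (\<Sum>q. hurwitz_term h (a + h * real q) z)"

lemma uniform_limit_hurwitz:
  assumes "a \<ge> 1" "h \<ge> 1" "\<epsilon> > 0"
    and "\<And>z. z \<in> A \<Longrightarrow> Re z \<ge> \<epsilon> \<and> norm z \<le> B"
  shows "uniform_limit A (\<lambda>n z. \<Sum>q<n. hurwitz_term h (a + h * real q) z) (hurwitz_sum h a) sequentially"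
  unfolding hurwitz_sum_def
proof (rule Weierstrass_m_test)
  \<comment> \<open>Here \<open>B + 1\<close> bounds \<open>norm (z - 1)\<close>, and
    \<open>a + h * real q\<close> is at least \<open>q + 1\<close> because a and h are at least
    1.\<close>
  let ?M = "\<lambda>q. h * B * (B + 1) * real (Suc q) powr (- \<epsilon> - 1)"
  fix q z assume z: "z \<in> A"
  let ?x = "a + h * real q"
  have "1 * real q \<le> h * real q" by (rule mult_right_mono) (use assms in auto)
  then have x: "?x \<ge> real (Suc q)" using assms by simp
  then have x1: "?x \<ge> 1" by linarith
  have zr: "Re z \<ge> \<epsilon>" "norm z \<le> B" using assms(4)[OF z] by auto
  have "norm (hurwitz_term h ?x z) \<le> h * norm z * norm (z - 1) * ?x powr (- Re z - 1)"
    using x1 zr assms by (intro norm_hurwitz_term_le) auto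
  also have "\<dots> \<le> h * B * (B + 1) * real (Suc q) powr (- \<epsilon> - 1)"
  proof (intro mult_mono)
    show "norm (z - 1) \<le> B + 1" using norm_triangle_ineq4[of z 1] zr by simp
    have "?x powr (- Re z - 1) \<le> ?x powr (- \<epsilon> - 1)" using x1 zr by (intro powr_mono) auto
    also have "\<dots> \<le> real (Suc q) powr (- \<epsilon> - 1)" using x assms by (intro powr_mono2') auto
    finally show "?x powr (- Re z - 1) \<le> real (Suc q) powr (- \<epsilon> - 1)" .
    have "0 \<le> B" using norm_ge_zero[of z] zr by linarith
    then show "0 \<le> h * B" "0 \<le> h * B * (B + 1)" using assms by auto
  qed (use zr assms in auto)
  finally show "norm (hurwitz_term h ?x z) \<le> ?M q" .
next
  have "summable (\<lambda>q. real q powr (- \<epsilon> - 1))" using assms by (subst summable_real_powr_iff) auto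
  then have "summable (\<lambda>q. real (Suc q) powr (- \<epsilon> - 1))" by (subst summable_Suc_iff)
  then show "summable (\<lambda>q. h * B * (B + 1) * real (Suc q) powr (- \<epsilon> - 1))" by (rule summable_mult)
qed

lemma holomorphic_hurwitz_sum:
  assumes "a \<ge> 1" "h \<ge> 1"
  shows "hurwitz_sum h a holomorphic_on {z. Re z > 0}"
proof (rule holomorphic_uniform_sequence)
  show "open {z. Re z > 0}" by (rule open_halfspace_Re_gt)
  show "(\<lambda>z. \<Sum>q<n. hurwitz_term h (a + h * real q) z) holomorphic_on {z. Re z > 0}" for n
    using assms by (intro holomorphic_on_sum holomorphic_hurwitz_term) (auto intro: add_pos_nonneg)
  fix z :: complex assume "z \<in> {z. Re z > 0}"
  then have z: "Re z > 0" by simp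
  have *: "Re w \<ge> Re z / 2 \<and> norm w \<le> norm z + Re z / 2" if "w \<in> cball z (Re z / 2)" for w
  proof -
    have d: "norm (z - w) \<le> Re z / 2" using that by (simp add: dist_norm)
    have "Re z - Re w \<le> norm (z - w)" using complex_Re_le_cmod[of "z - w"] by simp
    moreover have "norm w \<le> norm z + norm (z - w)" using norm_triangle_ineq2[of w z] by (simp add: norm_minus_commute)
    ultimately show ?thesis using d by simp
  qed
  show "\<exists>d. 0 < d \<and> cball z d \<subseteq> {z. Re z > 0} \<and>
      uniform_limit (cball z d) (\<lambda>n z. \<Sum>q<n. hurwitz_term h (a + h * real q) z) (hurwitz_sum h a) sequentially"
    using z * assms
    by (intro exI[of _ "Re z / 2"] conjI uniform_limit_hurwitz[of a h "Re z / 2" _ "norm z + Re z / 2"])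
       (force+)
qed

lemma powr_tendsto_0:
  assumes "a \<ge> 1" "h \<ge> 1" "Re z > 1"
  shows "(\<lambda>q. of_real (a + h * real q) powr (1 - z)) \<longlonglongrightarrow> (0::complex)"
proof (rule tendsto_norm_zero_cancel)
  have "filterlim (\<lambda>q. a + h * real q) at_top sequentially"
    using assms
    by (intro filterlim_tendsto_add_at_top[OF tendsto_const] filterlim_tendsto_pos_mult_at_top[OF tendsto_const]
        filterlim_real_sequentially) auto
  then have "(\<lambda>q. (a + h * real q) powr (1 - Re z)) \<longlonglongrightarrow> 0"
    using assms by (intro tendsto_neg_powr) auto
  moreover have "norm (of_real (a + h * real q) powr (1 - z)) = (a + h * real q) powr (1 - Re z)" for q
    using assms by (subst norm_powr_pos) (auto intro: add_pos_nonneg)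
  ultimately show "(\<lambda>q. norm (of_real (a + h * real q) powr (1 - z) :: complex)) \<longlonglongrightarrow> 0"
    by simp
qed

text \<open>The subtracted means telescope to \<open>a powr (1 - z) / h\<close>, because the far end
  tends to 0 for Re z > 1. The right-hand side makes sense on all of Re z > 0 apart from z =
  1.\<close>

lemma hurwitz_sums:
  assumes "a \<ge> 1" "h \<ge> 1" "Re z > 1"
  shows "(\<lambda>q. of_real (a + h * real q) powr (- z)) sums
           ((hurwitz_sum h a z + of_real a powr (1 - z) / of_real h) / (z - 1))"
proof -
  let ?p = "\<lambda>q. of_real (a + h * real q) powr (1 - z) :: complex"
  have "uniform_limit {z} (\<lambda>n z. \<Sum>q<n. hurwitz_term h (a + h * real q) z) (hurwitz_sum h a) sequentially"
    using assms by (intro uniform_limit_hurwitz[of a h 1 _ "norm z"]) auto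
  then have 1: "(\<lambda>q. hurwitz_term h (a + h * real q) z) sums hurwitz_sum h a z"
    unfolding sums_def by (rule tendsto_uniform_limitI) simp
  have "(\<lambda>q. ?p q - ?p (Suc q)) sums (?p 0 - 0)"
    by (rule telescope_sums'[OF powr_tendsto_0[OF assms]])
  then have 2: "(\<lambda>q. (?p q - ?p (Suc q)) / of_real h) sums (of_real a powr (1 - z) / of_real h)"
    using sums_divide by fastforce
  have "(z - 1) * of_real (a + h * real q) powr (- z) =
      hurwitz_term h (a + h * real q) z + (?p q - ?p (Suc q)) / of_real h" for q
    by (simp add: hurwitz_term_def algebra_simps)
  then have "(\<lambda>q. (z - 1) * of_real (a + h * real q) powr (- z)) sums
      (hurwitz_sum h a z + of_real a powr (1 - z) / of_real h)"
    using sums_add[OF 1 2] by simp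
  moreover have "z - 1 \<noteq> 0" using assms by auto
  ultimately show ?thesis using sums_divide[of _ _ "z - 1"] by fastforce
qed

lemma summable_on_powr: "t > 1 \<Longrightarrow> (\<lambda>n. real n powr (- t)) summable_on {1..}"
  by (rule summable_on_subset_banach[of _ UNIV], rule norm_summable_imp_summable_on)
     (simp_all add: summable_real_powr_iff)

text \<open>For n at least 2, \<open>n powr (t - u)\<close> is at most
  \<open>2 powr (t - u)\<close>. The geometric decay in u is what makes the infinite product
  converge.\<close>

lemma infsum_powr_tail_le:
  assumes "t > 1" "u \<ge> t"
  shows "infsum (\<lambda>n. real n powr (- u)) {2..} \<le> 2 powr (t - u) * infsum (\<lambda>n. real n powr (- t)) {1..}"
proof -
  have "infsum (\<lambda>n. real n powr (- u)) {2..} \<le> infsum (\<lambda>n. 2 powr (t - u) * real n powr (- t)) {1..}"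
  proof (rule infsum_mono_neutral)
    show "(\<lambda>n. real n powr (- u)) summable_on {2..}"
      by (rule summable_on_subset_banach[OF summable_on_powr]) (use assms in auto)
    show "(\<lambda>n. 2 powr (t - u) * real n powr (- t)) summable_on {1..}"
      by (rule summable_on_cmult_right[OF summable_on_powr[OF assms(1)]])
    fix n :: nat assume n: "n \<in> {2..} \<inter> {1..}"
    have "real n powr (- u) = real n powr (t - u) * real n powr (- t)" by (simp add: powr_add[symmetric])
    also have "\<dots> \<le> 2 powr (t - u) * real n powr (- t)"
      using n assms by (intro mult_right_mono powr_mono2') auto
    finally show "real n powr (- u) \<le> 2 powr (t - u) * real n powr (- t)" .
  qed auto
  also have "\<dots> = 2 powr (t - u) * infsum (\<lambda>n. real n powr (- t)) {1..}"
    by (rule infsum_cmult_right')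
  finally show ?thesis .
qed

section \<open>The factors L(ks, chi^k)\<close>

locale character =
  fixes chi :: "int \<Rightarrow> complex" and j :: nat
  assumes character: "dirichlet_character j chi" and modulus_pos: "j > 0"
begin

lemma chi_mult: "chi (a * b) = chi a * chi b"
  using character by (simp add: dirichlet_character_def)

lemma chi_1: "chi 1 = 1"
proof -
  have "chi 1 \<noteq> 0" using character by (simp add: dirichlet_character_def)
  moreover have "chi 1 = chi 1 * chi 1" using chi_mult[of 1 1] by simp
  ultimately show ?thesis by simp
qed

lemma chi_power: "chi (a ^ n) = chi a ^ n"
  by (induction n) (simp_all add: chi_1 chi_mult)

lemma chi_period: "chi (a + int j * int q) = chi a"
proof (induction q)
  case (Suc q)
  have "chi (a + int j * int (Suc q)) = chi ((a + int j * int q) + int j)" by (simp add: algebra_simps)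
  also have "\<dots> = chi (a + int j * int q)" using character unfolding dirichlet_character_def by blast
  finally show ?case using Suc by simp
qed simp

text \<open>A character takes finitely many values, and these are closed under powers.\<close>

lemma norm_chi_le: "norm (chi (int a)) \<le> 1"
proof (rule ccontr)
  assume "\<not> norm (chi (int a)) \<le> 1"
  then have gt: "norm (chi (int a)) > 1" by simp
  define B where "B = Max ((\<lambda>n. norm (chi (int n))) ` {..<j})"
  have "norm (chi (int n)) \<le> B" for n
  proof -
    have "chi (int n) = chi (int (n mod j) + int j * int (n div j))"
      by (metis mod_mult_div_eq of_nat_add of_nat_mult)
    also have "\<dots> = chi (int (n mod j))" by (rule chi_period)
    finally show ?thesis using modulus_pos unfolding B_def by (intro Max_ge) auto
  qed
  from this[of "a ^ _"] have "norm (chi (int a)) ^ n \<le> B" for n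
    by (simp add: chi_power norm_power)
  moreover obtain n where "B < norm (chi (int a)) ^ n" using real_arch_pow[OF gt] by blast
  ultimately show False by (metis not_le)
qed

text \<open>Its k-th powers sum to L(ks, chi^k). Working with powers of one completely
  multiplicative function avoids treating chi^k as a character of its own.\<close>

definition dcoeff :: "complex \<Rightarrow> nat \<Rightarrow> complex" where
  "dcoeff s n = chi (int n) * of_nat n powr (- s)"

lemma dcoeff_1: "dcoeff s 1 = 1"
  by (simp add: dcoeff_def chi_1)

lemma dcoeff_mult: "dcoeff s (m * n) = dcoeff s m * dcoeff s n"
  by (simp add: dcoeff_def chi_mult powr_times_real)

lemma dcoeff_power: "n > 0 \<Longrightarrow> dcoeff s n ^ k = chi (int n) ^ k * of_nat n powr (- (of_nat k * s))"
  by (simp add: dcoeff_def power_mult_distrib powr_def exp_of_nat_mult[symmetric] mult_ac)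

lemma norm_dcoeff_power_le: "n > 0 \<Longrightarrow> norm (dcoeff s n ^ k) \<le> real n powr (- (real k * Re s))"
proof -
  assume n: "n > 0"
  have "norm (dcoeff s n ^ k) = norm (chi (int n)) ^ k * real n powr (- (real k * Re s))"
    using n norm_powr_pos[of "real n" "- (of_nat k * s)"] by (simp add: dcoeff_power norm_mult norm_power)
  also have "\<dots> \<le> 1 * real n powr (- (real k * Re s))"
    using norm_chi_le by (intro mult_right_mono power_le_one) auto
  finally show ?thesis by simp
qed

lemma abs_summable_dcoeff_power:
  assumes "real k * Re s > 1"
  shows "(\<lambda>n. norm (dcoeff s n ^ k)) summable_on {1..}"
  by (rule summable_on_comparison_test[OF summable_on_powr[OF assms]])
     (use norm_dcoeff_power_le in auto)

text \<open>L(ks, chi^k) split into residue classes modulo j, each a sum over a progression with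
  step j. At the only possible pole in Re s > 0, \<open>of_nat k * s = 1\<close>, division by zero
  gives the harmless value 0.\<close>

definition L_cont :: "nat \<Rightarrow> complex \<Rightarrow> complex" where
  "L_cont k s = (\<Sum>a\<in>{1..j}. chi (int a) ^ k *
     ((hurwitz_sum (real j) (real a) (of_nat k * s) + of_nat a powr (1 - of_nat k * s) / of_nat j) / (of_nat k * s - 1)))"

lemma infsum_dcoeff_power:
  assumes k: "real k * Re s > 1"
  shows "infsum (\<lambda>n. dcoeff s n ^ k) {1..} = L_cont k s"
proof -
  let ?z = "of_nat k * s"
  have z: "Re ?z > 1" using k by simp
  \<comment> \<open>Residues run through 1, ..., j rather than 0, ..., j - 1: every progression then
    starts at a number at least 1, as the estimates for \<open>hurwitz_sum\<close> require.\<close>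
  have bij: "bij_betw (\<lambda>(a, q). a + j * q) ({1..j} \<times> UNIV) {1..}"
  proof (rule bij_betwI[where g = "\<lambda>n. (Suc ((n - 1) mod j), (n - 1) div j)"])
    fix x assume "x \<in> {1..j} \<times> (UNIV :: nat set)"
    then obtain a q where x: "x = (Suc a, q)" "a < j" by (cases x; cases "fst x") auto
    then show "(Suc (((case x of (a, q) \<Rightarrow> a + j * q) - 1) mod j), ((case x of (a, q) \<Rightarrow> a + j * q) - 1) div j) = x"
      by simp
  next
    fix n :: nat assume "n \<in> {1..}"
    then show "(case (Suc ((n - 1) mod j), (n - 1) div j) of (a, q) \<Rightarrow> a + j * q) = n"
      using mod_mult_div_eq[of "n - 1" j] by simp
  qed (use modulus_pos in \<open>auto simp: Suc_le_eq\<close>)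
  have sm: "(\<lambda>n. dcoeff s n ^ k) summable_on {1..}"
    by (rule abs_summable_summable[OF abs_summable_dcoeff_power[OF k]])
  have "infsum (\<lambda>n. dcoeff s n ^ k) {1..} = infsum (\<lambda>(a, q). dcoeff s (a + j * q) ^ k) ({1..j} \<times> UNIV)"
    using infsum_reindex_bij_betw[OF bij, of "\<lambda>n. dcoeff s n ^ k"] by (simp add: case_prod_unfold)
  also have "\<dots> = infsum (\<lambda>a. infsum (\<lambda>q. dcoeff s (a + j * q) ^ k) UNIV) {1..j}"
    using sm summable_on_reindex_bij_betw[OF bij, of "\<lambda>n. dcoeff s n ^ k"]
    by (subst infsum_Sigma'_banach) (simp_all add: case_prod_unfold)
  also have "\<dots> = (\<Sum>a\<in>{1..j}. infsum (\<lambda>q. dcoeff s (a + j * q) ^ k) UNIV)"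
    by simp
  also have "\<dots> = L_cont k s"
    unfolding L_cont_def
  proof (rule sum.cong[OF refl])
    fix a assume a: "a \<in> {1..j}"
    let ?H = "(hurwitz_sum (real j) (real a) ?z + of_nat a powr (1 - ?z) / of_nat j) / (?z - 1)"
    have eq: "dcoeff s (a + j * q) ^ k = chi (int a) ^ k * of_real (real a + real j * real q) powr (- ?z)" for q
      using a by (subst dcoeff_power) (auto simp: chi_period)
    have "(\<lambda>q. of_real (real a + real j * real q) powr (- ?z)) sums ?H"
      using hurwitz_sums[of "real a" "real j" ?z] a z by simp
    then have s: "(\<lambda>q. dcoeff s (a + j * q) ^ k) sums (chi (int a) ^ k * ?H)"
      unfolding eq by (rule sums_mult)
    have "(\<lambda>n. norm (dcoeff s n ^ k)) summable_on (\<lambda>q. a + j * q) ` UNIV"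
      using a by (intro summable_on_subset_banach[OF abs_summable_dcoeff_power[OF k]]) auto
    then have "(\<lambda>q. norm (dcoeff s (a + j * q) ^ k)) summable_on UNIV"
      using modulus_pos by (subst (asm) summable_on_reindex) (auto simp: inj_on_def o_def)
    then have "summable (\<lambda>q. norm (dcoeff s (a + j * q) ^ k))"
      by (rule summable_on_imp_summable)
    from infsumI[OF norm_summable_imp_has_sum[OF this s]]
    show "infsum (\<lambda>q. dcoeff s (a + j * q) ^ k) UNIV = chi (int a) ^ k * ?H" .
  qed
  finally show ?thesis .
qed

lemma holomorphic_hurwitz_part:
  assumes "a \<in> {1..j}" "k > 0"
  shows "(\<lambda>s. hurwitz_sum (real j) (real a) (of_nat k * s) + of_nat a powr (1 - of_nat k * s) / of_nat j)
     holomorphic_on {s. Re s > 0}"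
proof -
  have "(hurwitz_sum (real j) (real a) \<circ> (\<lambda>s. of_nat k * s)) holomorphic_on {s. Re s > 0}"
    using assms modulus_pos
    by (intro holomorphic_on_compose_gen[OF _ holomorphic_hurwitz_sum] holomorphic_intros) auto
  then show ?thesis using assms modulus_pos by (auto intro!: holomorphic_intros simp: o_def)
qed

lemma meromorphic_L_cont:
  assumes "k > 0"
  shows "L_cont k meromorphic_on {s. Re s > 0}"
proof -
  have "(\<lambda>s. hurwitz_sum (real j) (real a) (of_nat k * s) + of_nat a powr (1 - of_nat k * s) / of_nat j)
     meromorphic_on {s. Re s > 0}" if "a \<in> {1..j}" for a
    using holomorphic_hurwitz_part[OF that assms]
    by (intro analytic_on_imp_meromorphic_on) (simp add: analytic_on_open open_halfspace_Re_gt)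
  then have "(\<lambda>s. L_cont k s) meromorphic_on {s. Re s > 0}"
    unfolding L_cont_def
    by (intro meromorphic_on_sum meromorphic_on_mult meromorphic_on_divide meromorphic_on_diff
        meromorphic_on_const meromorphic_on_id)
  then show ?thesis by simp
qed

lemma holomorphic_L_cont:
  assumes "k > 0"
  shows "L_cont k holomorphic_on {s. real k * Re s > 1}"
proof -
  have sub: "{s. real k * Re s > 1} \<subseteq> {s. Re s > 0}"
    using assms by (auto simp: zero_less_mult_iff dest: less_trans[OF zero_less_one])
  have nz: "of_nat k * s - 1 \<noteq> 0" if "s \<in> {s. real k * Re s > 1}" for s
  proof
    assume "of_nat k * s - 1 = 0"
    then have "Re (of_nat k * s) = 1" by simp
    then show False using that by simp
  qed
  have "(\<lambda>s. L_cont k s) holomorphic_on {s. real k * Re s > 1}"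
    unfolding L_cont_def
    by (intro holomorphic_on_sum holomorphic_on_mult holomorphic_on_divide
        holomorphic_on_subset[OF holomorphic_hurwitz_part sub] holomorphic_intros nz) (use assms in auto)
  then show ?thesis by simp
qed

text \<open>The term n = 1 equals 1; the remaining ones are dominated by the tail of a zeta
  series.\<close>

lemma norm_infsum_dcoeff_power_le:
  assumes "t > 1" "real k * Re s \<ge> t"
  shows "norm (infsum (\<lambda>n. dcoeff s n ^ k) {1..} - 1) \<le> 2 powr (t - real k * Re s) * infsum (\<lambda>n. real n powr (- t)) {1..}"
proof -
  have u: "real k * Re s > 1" using assms by simp
  have ab: "(\<lambda>n. norm (dcoeff s n ^ k)) summable_on {2..}"
    by (rule summable_on_subset_banach[OF abs_summable_dcoeff_power[OF u]]) auto
  have split: "{1::nat..} = insert 1 {2..}" by auto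
  have "infsum (\<lambda>n. dcoeff s n ^ k) {1..} = 1 + infsum (\<lambda>n. dcoeff s n ^ k) {2..}"
    unfolding split using abs_summable_summable[OF ab] by (subst infsum_insert) (auto simp: dcoeff_1[simplified])
  then have "norm (infsum (\<lambda>n. dcoeff s n ^ k) {1..} - 1) = norm (infsum (\<lambda>n. dcoeff s n ^ k) {2..})" by simp
  also have "\<dots> \<le> infsum (\<lambda>n. norm (dcoeff s n ^ k)) {2..}"
    by (rule norm_infsum_bound[OF ab])
  also have "\<dots> \<le> infsum (\<lambda>n. real n powr (- (real k * Re s))) {2..}"
    by (rule infsum_mono[OF ab summable_on_subset_banach[OF summable_on_powr[OF u]]])
       (use norm_dcoeff_power_le in auto)
  also have "\<dots> \<le> 2 powr (t - real k * Re s) * infsum (\<lambda>n. real n powr (- t)) {1..}"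
    by (rule infsum_powr_tail_le[OF assms])
  finally show ?thesis .
qed

end

section \<open>Convergence of the infinite product\<close>

lemma norm_power_minus_1_le:
  fixes w :: complex
  assumes "norm (w - 1) \<le> \<delta>"
  shows "norm (w ^ c - 1) \<le> real c * \<delta> * exp (real c * \<delta>)"
proof -
  have \<delta>: "\<delta> \<ge> 0" using norm_ge_zero[of "w - 1"] assms by linarith
  have "norm ((\<Prod>i<c. 1 + (w - 1)) - 1) \<le> (\<Prod>i<c. 1 + norm (w - 1)) - 1"
    by (rule norm_prod_minus1_le_prod_minus1)
  then have "norm (w ^ c - 1) \<le> (1 + norm (w - 1)) ^ c - 1" by simp
  also have "\<dots> \<le> exp \<delta> ^ c - 1"
  proof (intro diff_right_mono power_mono)
    show "1 + norm (w - 1) \<le> exp \<delta>" using assms exp_ge_add_one_self[of \<delta>] by linarith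
  qed auto
  also have "\<dots> = exp (real c * \<delta>) - 1" by (simp add: exp_of_nat_mult)
  \<comment> \<open>This is e^y - 1 \<le> y e^y, that is, 1 - y \<le> e^(-y) multiplied by e^y. The
    dependence on c stays explicit because the exponents in the product grow with the index.\<close>
  also have "\<dots> \<le> real c * \<delta> * exp (real c * \<delta>)"
  proof -
    have "(1 - real c * \<delta>) * exp (real c * \<delta>) \<le> exp (- (real c * \<delta>)) * exp (real c * \<delta>)"
      using exp_ge_add_one_self[of "- (real c * \<delta>)"] by (intro mult_right_mono) auto
    then show ?thesis by (simp add: exp_minus algebra_simps)
  qed
  finally show ?thesis .
qed

context character
begin

definition L_prod :: "(nat \<Rightarrow> nat) \<Rightarrow> nat \<Rightarrow> complex \<Rightarrow> complex" where
  "L_prod c n s = (\<Prod>k<n. L_cont (Suc k) s ^ c k)"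

text \<open>The first K factors come from continuation; all others are given by their Dirichlet
  series on the whole disc and multiply to a holomorphic function. The limit concerns values, so it
  also holds at poles of the first factors, where \<open>L_cont\<close> has its default
  value.\<close>

lemma L_prod_tail:
  assumes c: "\<And>k. c k \<le> Suc k" and z: "Re z > 0"
  obtains K g where "g holomorphic_on ball z (Re z / 2)"
    "\<And>s. s \<in> ball z (Re z / 2) \<Longrightarrow> (\<lambda>n. L_prod c n s) \<longlonglongrightarrow> L_prod c K s * g s"
proof -
  define d where "d = Re z / 2"
  have d: "d > 0" using z by (simp add: d_def)
  \<comment> \<open>On the disc Re s \<ge> d, so \<open>K * d > 2\<close> moves all later arguments
    into Re \<ge> 2, and the tail bound applies with the fixed exponent t = 2.\<close>
  obtain K :: nat where "2 / d < real K" using reals_Archimedean2 by blast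
  then have K: "real K * d > 2" using d by (simp add: field_simps)
  have re: "Re s \<ge> d" if "s \<in> cball z d" for s
  proof -
    have "Re z - Re s \<le> norm (z - s)" using complex_Re_le_cmod[of "z - s"] by simp
    then show ?thesis using that by (simp add: d_def dist_norm)
  qed
  define Z where "Z = infsum (\<lambda>n. real n powr (- 2)) {1..}"
  have Z: "Z \<ge> 0" unfolding Z_def by (rule infsum_nonneg) auto
  define x where "x = (2::real) powr (- d)"
  have "x < 2 powr 0" unfolding x_def using d by (intro powr_less_mono) auto
  then have x: "0 < x" "x < 1" by (auto simp: x_def)
  define f where "f = (\<lambda>n s. L_cont (Suc (K + n)) s ^ c (K + n))"
  \<comment> \<open>The factor \<open>Suc K * Suc n\<close> dominates the exponent
    \<open>c (K + n)\<close>, and \<open>x ^ n * Z\<close> dominates the distance of the L-value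
    from 1.\<close>
  define u where "u n = real (Suc K) * Z * (real (Suc n) * x ^ n)" for n
  have big: "real (Suc (K + n)) * Re s \<ge> 2 + real (Suc n) * d" if "s \<in> cball z d" for n s
  proof -
    have "real (Suc (K + n)) * Re s \<ge> real (Suc (K + n)) * d" using re[OF that] by (intro mult_left_mono) auto
    then show ?thesis using K by (simp add: algebra_simps)
  qed
  have L1: "real (Suc (K + n)) * Re s > 1" if "s \<in> cball z d" for n s
  proof -
    have "real (Suc n) * d \<ge> 0" using d by auto
    then show ?thesis using big[OF that, of n] by linarith
  qed
  have bound: "real (c (K + n)) * norm (L_cont (Suc (K + n)) s - 1) \<le> u n" if s: "s \<in> cball z d" for n s
  proof -
    have "real (Suc n) * d \<ge> 0" using d by auto
    then have ge2: "real (Suc (K + n)) * Re s \<ge> 2" using big[OF s, of n] by linarith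
    have "norm (L_cont (Suc (K + n)) s - 1) \<le> 2 powr (2 - real (Suc (K + n)) * Re s) * Z"
      using norm_infsum_dcoeff_power_le[of 2 "Suc (K + n)" s] ge2 infsum_dcoeff_power[OF L1[OF s, of n]]
      unfolding Z_def by simp
    also have "\<dots> \<le> 2 powr (- real n * d) * Z"
      using big[OF s, of n] d Z by (intro mult_right_mono powr_mono) (auto simp: algebra_simps)
    also have "2 powr (- real n * d) = x ^ n"
      by (simp add: x_def powr_realpow[symmetric] powr_powr mult.commute)
    finally have 1: "norm (L_cont (Suc (K + n)) s - 1) \<le> x ^ n * Z" .
    have "real (c (K + n)) \<le> real (Suc (K + n))" using c by (simp only: of_nat_le_iff)
    also have "\<dots> \<le> real (Suc K) * real (Suc n)" by (simp add: algebra_simps)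
    finally have 2: "real (c (K + n)) \<le> real (Suc K) * real (Suc n)" .
    have "real (c (K + n)) * norm (L_cont (Suc (K + n)) s - 1) \<le> (real (Suc K) * real (Suc n)) * (x ^ n * Z)"
      by (rule mult_mono[OF 2 1]) (use Z x in auto)
    then show ?thesis by (simp add: u_def mult_ac)
  qed
  have summable_u: "summable u"
    unfolding u_def using x by (intro summable_mult sums_summable[OF geometric_deriv_sums]) auto
  \<comment> \<open>A bound for \<open>u\<close> turns the exponential factor of
    \<open>norm_power_minus_1_le\<close> into a constant.\<close>
  then have "Bseq u" by (intro convergent_imp_Bseq convergentI[OF summable_LIMSEQ_zero])
  then obtain D where D: "\<And>n. norm (u n) \<le> D" by (auto simp: Bseq_def)
  have f1: "norm (norm (f n s - 1)) \<le> u n * exp D" if "s \<in> cball z d" for n s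
  proof -
    have u0: "real (c (K + n)) * norm (L_cont (Suc (K + n)) s - 1) \<le> u n" by (rule bound[OF that])
    have "norm (f n s - 1) \<le> real (c (K + n)) * norm (L_cont (Suc (K + n)) s - 1) *
        exp (real (c (K + n)) * norm (L_cont (Suc (K + n)) s - 1))"
      unfolding f_def by (rule norm_power_minus_1_le) simp
    also have "\<dots> \<le> u n * exp D"
      using u0 D[of n] x Z by (intro mult_mono) (auto simp: u_def)
    finally show ?thesis by simp
  qed
  have hol: "f n holomorphic_on cball z d" for n
    unfolding f_def
    by (intro holomorphic_intros holomorphic_on_subset[OF holomorphic_L_cont]) (use L1 in auto)
  have "uniformly_convergent_on (cball z d) (\<lambda>n s. \<Prod>k<n. f k s)"
  proof (rule uniformly_convergent_on_prod')
    show "continuous_on (cball z d) (f n)" for n using hol by (rule holomorphic_on_imp_continuous_on)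
    show "uniformly_convergent_on (cball z d) (\<lambda>N s. \<Sum>n<N. norm (f n s - 1))"
      by (rule Weierstrass_m_test'[OF f1 summable_mult2[OF summable_u]])
  qed simp
  then obtain g where g: "uniform_limit (cball z d) (\<lambda>n s. \<Prod>k<n. f k s) g sequentially"
    unfolding uniformly_convergent_on_def by blast
  have "g holomorphic_on ball z d"
  proof (rule holomorphic_uniform_limit[OF _ g])
    show "\<forall>\<^sub>F n in sequentially. continuous_on (cball z d) (\<lambda>s. \<Prod>k<n. f k s) \<and> (\<lambda>s. \<Prod>k<n. f k s) holomorphic_on ball z d"
      by (intro always_eventually allI conjI holomorphic_on_imp_continuous_on holomorphic_on_prod
          holomorphic_on_subset[OF hol]) auto
  qed auto
  moreover have "(\<lambda>n. L_prod c n s) \<longlonglongrightarrow> L_prod c K s * g s" if s: "s \<in> ball z d" for s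
  proof (rule LIMSEQ_offset)
    have "L_prod c (n + K) s = L_prod c K s * (\<Prod>k<n. f k s)" for n
      by (induction n) (simp_all add: L_prod_def f_def mult_ac add.commute[of K])
    then show "(\<lambda>n. L_prod c (n + K) s) \<longlonglongrightarrow> L_prod c K s * g s"
      using tendsto_uniform_limitI[OF g, of s] s by (auto intro!: tendsto_mult_left)
  qed
  ultimately show thesis using that[of g K] unfolding d_def by blast
qed

lemma meromorphic_lim_L_prod:
  assumes "\<And>k. c k \<le> Suc k"
  shows "(\<lambda>s. lim (\<lambda>n. L_prod c n s)) meromorphic_on {s. Re s > 0}"
proof (subst meromorphic_on_meromorphic_at, intro ballI)
  fix z assume "z \<in> {s. Re s > 0}"
  then have z: "Re z > 0" by simp
  obtain K g where g: "g holomorphic_on ball z (Re z / 2)"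
    and lim: "\<And>s. s \<in> ball z (Re z / 2) \<Longrightarrow> (\<lambda>n. L_prod c n s) \<longlonglongrightarrow> L_prod c K s * g s"
    by (rule L_prod_tail[OF assms z]) blast
  have "(\<lambda>s. L_prod c K s * g s) meromorphic_on {z}"
    unfolding L_prod_def
  proof (intro meromorphic_on_mult meromorphic_on_prod meromorphic_on_power)
    show "L_cont (Suc k) meromorphic_on {z}" for k
      by (rule meromorphic_on_subset[OF meromorphic_L_cont]) (use z in auto)
    have "g analytic_on ball z (Re z / 2)" using g by (simp add: analytic_on_open)
    then show "g meromorphic_on {z}"
      by (intro analytic_on_imp_meromorphic_on) (use z in \<open>auto intro: analytic_on_subset\<close>)
  qed
  \<comment> \<open>K and the tail depend on z, but nothing has to be glued: the limit is defined
    globally, and meromorphy at z only concerns a neighbourhood of z.\<close>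
  moreover have "\<forall>\<^sub>F s in at z. lim (\<lambda>n. L_prod c n s) = L_prod c K s * g s"
    using z by (intro eventually_at_in_open'[THEN eventually_mono, of "ball z (Re z / 2)"] limI lim) auto
  ultimately show "(\<lambda>s. lim (\<lambda>n. L_prod c n s)) meromorphic_on {z}"
    by (subst meromorphic_on_cong[OF _ refl]) auto
qed

end

section \<open>Dirichlet coefficients of the product\<close>

text \<open>For finite \<open>A\<close> and positive weights this is the n-th Dirichlet coefficient
  of the product of zeta(\<open>w c\<close> s) over the cells c of \<open>A\<close>.\<close>

definition fill_count :: "('c \<Rightarrow> nat) \<Rightarrow> 'c set \<Rightarrow> nat \<Rightarrow> nat" where
  "fill_count w A n = card {k \<in> fillings A. (\<Prod>c\<in>A. k c ^ w c) = n}"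

text \<open>Only the default outside \<open>A\<close> changes, from 1 to \<open>undefined\<close>.
  The default 1 suits comparisons of different shapes, \<open>PiE\<close> the expansion of products
  of infinite sums.\<close>

lemma bij_restrict_fillings:
  "bij_betw (\<lambda>k. restrict k A) (fillings A) (PiE A (\<lambda>_. {1..}))"
  by (rule bij_betwI[where g = "\<lambda>k c. if c \<in> A then k c else 1"])
     (auto simp: fillings_def fun_eq_iff Suc_le_eq PiE_def extensional_def Pi_def)

lemma fill_count_PiE:
  "fill_count w A n = card {k \<in> PiE A (\<lambda>_. {1..}). (\<Prod>c\<in>A. k c ^ w c) = n}"
  unfolding fill_count_def by (rule card_filter_bij_betw[OF bij_restrict_fillings]) simp

lemma finite_weighted_PiE:
  fixes n :: nat
  assumes "finite A" "\<And>c. c \<in> A \<Longrightarrow> w c \<ge> 1" "n > 0"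
  shows "finite {k \<in> PiE A (\<lambda>_. {1..}). (\<Prod>c\<in>A. k c ^ w c) = n}"
proof (rule finite_subset)
  show "{k \<in> PiE A (\<lambda>_. {1..}). (\<Prod>c\<in>A. k c ^ w c) = n} \<subseteq> PiE A (\<lambda>_. {..n})"
  proof
    fix k assume "k \<in> {k \<in> PiE A (\<lambda>_. {1..}). (\<Prod>c\<in>A. k c ^ w c) = n}"
    then have k: "k \<in> PiE A (\<lambda>_. {1..})" "(\<Prod>c\<in>A. k c ^ w c) = n" by auto
    have "k c \<le> n" if c: "c \<in> A" for c
    proof -
      have "k c dvd k c ^ w c" using assms(2)[OF c] dvd_power_le[of "k c" "k c" 1 "w c"] by simp
      also have "\<dots> dvd n" unfolding k(2)[symmetric] using assms(1) c by (rule dvd_prodI)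
      finally show ?thesis using assms(3) dvd_imp_le by blast
    qed
    then show "k \<in> PiE A (\<lambda>_. {..n})" using k(1) by (auto simp: PiE_def)
  qed
  show "finite (PiE A (\<lambda>_. {..n}))" using assms(1) by (intro finite_PiE) auto
qed

lemma fill_count_mono:
  assumes "finite B" "A \<subseteq> B" "\<And>c. c \<in> B \<Longrightarrow> w c \<ge> 1" "n > 0"
  shows "fill_count w A n \<le> fill_count w B n"
proof -
  let ?F = "\<lambda>A. {k \<in> fillings A. (\<Prod>c\<in>A. k c ^ w c) = n}"
  have sub: "(\<lambda>k. restrict k B) ` ?F B \<subseteq> {k \<in> PiE B (\<lambda>_. {1..}). (\<Prod>c\<in>B. k c ^ w c) = n}"
  proof (rule image_subsetI)
    fix k assume "k \<in> ?F B"
    then show "restrict k B \<in> {k \<in> PiE B (\<lambda>_. {1..}). (\<Prod>c\<in>B. k c ^ w c) = n}"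
      using bij_betwE[OF bij_restrict_fillings, of B] by simp
  qed
  have inj: "inj_on (\<lambda>k. restrict k B) (?F B)"
    by (rule inj_on_subset[OF bij_betw_imp_inj_on[OF bij_restrict_fillings[of B]] Collect_subset])
  \<comment> \<open>Monotonicity needs finiteness, since \<open>card\<close> of an infinite set is
    0.\<close>
  have "finite (?F B)"
    by (rule inj_on_finite[OF inj sub finite_weighted_PiE[OF assms(1,3,4)]])
  moreover have "?F A \<subseteq> ?F B"
  proof
    fix k assume "k \<in> ?F A"
    then have k: "k \<in> fillings A" "(\<Prod>c\<in>A. k c ^ w c) = n" by auto
    have "(\<Prod>c\<in>B. k c ^ w c) = (\<Prod>c\<in>A. k c ^ w c)"
      using k(1) assms(1,2) by (intro prod.mono_neutral_right) (auto simp: fillings_def)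
    moreover have "k \<in> fillings B" using k(1) assms(2) unfolding fillings_def by blast
    ultimately show "k \<in> ?F B" using k(2) by simp
  qed
  ultimately show ?thesis unfolding fill_count_def by (rule card_mono)
qed

text \<open>Cells of weight at least n can only carry the entry 1, so they do not change the count.\<close>

lemma fill_count_cong:
  assumes "finite B" "A \<subseteq> B" "n > 0" "\<And>c. c \<in> B - A \<Longrightarrow> w c \<ge> n"
  shows "fill_count w B n = fill_count w A n"
proof -
  have "{k \<in> fillings B. (\<Prod>c\<in>B. k c ^ w c) = n} = {k \<in> fillings A. (\<Prod>c\<in>A. k c ^ w c) = n}"
  proof (intro Set.set_eqI)
    fix k :: "'a \<Rightarrow> nat"
    have eq: "(\<Prod>c\<in>B. k c ^ w c) = (\<Prod>c\<in>A. k c ^ w c)" if "k \<in> fillings A"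
      using that assms(1,2) by (intro prod.mono_neutral_right) (auto simp: fillings_def)
    have "k \<in> fillings A" if k: "k \<in> fillings B" "(\<Prod>c\<in>B. k c ^ w c) = n"
    proof -
      have "k c = 1" if c: "c \<in> B - A" for c
      proof (rule ccontr)
        assume "k c \<noteq> 1"
        moreover have "k c > 0" using k(1) unfolding fillings_def by blast
        ultimately have "k c \<ge> 2" by simp
        have "n < 2 ^ n" by (rule less_exp)
        also have "\<dots> \<le> k c ^ n" using \<open>k c \<ge> 2\<close> by (rule power_mono) simp
        also have "\<dots> \<le> k c ^ w c" using \<open>k c \<ge> 2\<close> assms(4)[OF c] by (intro power_increasing) auto
        also have "\<dots> \<le> n"
          using assms(1,3) c unfolding k(2)[symmetric] by (intro dvd_imp_le dvd_prodI) (auto simp: k(2))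
        finally show False by simp
      qed
      then show ?thesis using k(1) unfolding fillings_def by blast
    qed
    moreover have "k \<in> fillings B" if "k \<in> fillings A" using that assms(2) unfolding fillings_def by blast
    ultimately show "k \<in> {k \<in> fillings B. (\<Prod>c\<in>B. k c ^ w c) = n} \<longleftrightarrow>
        k \<in> {k \<in> fillings A. (\<Prod>c\<in>A. k c ^ w c) = n}" using eq by auto
  qed
  then show ?thesis by (simp add: fill_count_def)
qed

text \<open>Expanding the product of the series gives a sum over all k; by complete multiplicativity
  the summand is f of the weighted product of k, so absolute convergence allows collecting the k
  with the same product.\<close>

lemma has_sum_fill_count:
  fixes f :: "nat \<Rightarrow> 'b :: {real_normed_field, banach, second_countable_topology}"
  assumes fin: "finite A" and w: "\<And>c. c \<in> A \<Longrightarrow> w c \<ge> 1"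
    and f1: "f 1 = 1" and fm: "\<And>m n. f (m * n) = f m * f n"
    and sm: "\<And>c. c \<in> A \<Longrightarrow> (\<lambda>n. norm (f n ^ w c)) summable_on {1..}"
  shows "((\<lambda>n. of_nat (fill_count w A n) * f n) has_sum (\<Prod>c\<in>A. infsum (\<lambda>n. f n ^ w c) {1..})) {1..}"
proof -
  let ?P = "PiE A (\<lambda>_. {1::nat..})"
  let ?N = "\<lambda>k. \<Prod>c\<in>A. k c ^ w c"
  let ?F = "\<lambda>k. \<Prod>c\<in>A. f (k c) ^ w c"
  have fpow: "f (m ^ n) = f m ^ n" for m n by (induction n) (simp_all add: f1[simplified] fm)
  have FN: "f (?N k) = ?F k" for k
    using fin by (induction A rule: finite_induct) (simp_all add: f1[simplified] fm fpow)
  have "Infinite_Set_Sum.abs_summable_on ?F ?P"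
  proof (rule abs_summable_on_prod_PiE[OF fin])
    fix c assume "c \<in> A"
    show "Infinite_Set_Sum.abs_summable_on (\<lambda>n. f n ^ w c) {1..}"
      by (rule iffD1[OF abs_summable_equivalent sm[OF \<open>c \<in> A\<close>]])
  qed (rule countableI_type)
  from abs_summable_summable[OF iffD2[OF abs_summable_equivalent this]] have "?F summable_on ?P" .
  moreover have "infsum ?F ?P = (\<Prod>c\<in>A. infsum (\<lambda>n. f n ^ w c) {1..})"
    using infsum_prod_PiE_abs[OF fin, of "\<lambda>c n. f n ^ w c" "\<lambda>_. {1..}"] sm by simp
  ultimately have hs: "(?F has_sum (\<Prod>c\<in>A. infsum (\<lambda>n. f n ^ w c) {1..})) ?P"
    using has_sum_infsum[of ?F ?P] by simp
  have bij: "bij_betw (\<lambda>k. (?N k, k)) ?P (Sigma {1..} (\<lambda>n. {k \<in> ?P. ?N k = n}))"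
  proof (rule bij_betwI[where g = snd])
    show "(\<lambda>k. (?N k, k)) \<in> ?P \<rightarrow> Sigma {1..} (\<lambda>n. {k \<in> ?P. ?N k = n})"
    proof (rule funcsetI)
      fix k assume k: "k \<in> ?P"
      then have "?N k > 0" by (intro prod_pos) (auto simp: PiE_iff Suc_le_eq)
      then show "(?N k, k) \<in> Sigma {1..} (\<lambda>n. {k \<in> ?P. ?N k = n})" using k by (simp add: Suc_le_eq)
    qed
  qed auto
  have hs': "((\<lambda>(n, k). ?F k) has_sum (\<Prod>c\<in>A. infsum (\<lambda>n. f n ^ w c) {1..}))
      (Sigma {1..} (\<lambda>n. {k \<in> ?P. ?N k = n}))"
    using has_sum_reindex_bij_betw[OF bij, of "\<lambda>(n, k). ?F k"] hs by simp
  show ?thesis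
  proof (rule has_sum_SigmaD[OF hs'])
    fix n :: nat assume n: "n \<in> {1..}"
    let ?K = "{k \<in> ?P. ?N k = n}"
    have K: "finite ?K" using n by (intro finite_weighted_PiE[OF fin w]) auto
    have "(\<Sum>k\<in>?K. ?F k) = (\<Sum>k\<in>?K. f n)"
      by (rule sum.cong) (auto simp: FN[symmetric])
    also have "\<dots> = of_nat (fill_count w A n) * f n" by (simp add: fill_count_PiE)
    finally show "((\<lambda>k. case (n, k) of (n, k) \<Rightarrow> ?F k) has_sum of_nat (fill_count w A n) * f n) ?K"
      using has_sum_finite[OF K, of ?F] by simp
  qed
qed

section \<open>Cells sorted by hook weight\<close>

definition hook_weight :: "nat \<times> nat \<Rightarrow> nat" where
  "hook_weight c = Suc (fst c + snd c)"

lemma hook_weight_ge1: "1 \<le> hook_weight c"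
  by (simp add: hook_weight_def)

text \<open>The cells of hook weight at most n in the first r rows: a finite set even for r =
  \<infinity>, and the one that yields exactly the first n factors of \<open>L_prod\<close>.\<close>

definition cell_triangle :: "enat \<Rightarrow> nat \<Rightarrow> (nat \<times> nat) set" where
  "cell_triangle r n = {c. enat (fst c) < r \<and> fst c + snd c < n}"

text \<open>This is min(k + 1, r), the number of cells of hook weight \<open>Suc k\<close> in the
  first r rows and so the exponent of L((k+1)s, chi^(k+1)).\<close>

definition diag_count :: "enat \<Rightarrow> nat \<Rightarrow> nat" where
  "diag_count r k = card {i. i \<le> k \<and> enat i < r}"

lemma finite_cell_triangle [simp]: "finite (cell_triangle r n)"
  by (rule finite_subset[of _ "{..<n} \<times> {..<n}"]) (auto simp: cell_triangle_def)

lemma diag_count_le: "diag_count r k \<le> Suc k"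
  using card_mono[of "{..k}" "{i. i \<le> k \<and> enat i < r}"] by (auto simp: diag_count_def)

lemma prod_cell_triangle:
  "(\<Prod>c\<in>cell_triangle r n. g (hook_weight c)) = (\<Prod>k<n. g (Suc k) ^ diag_count r k)"
  for g :: "nat \<Rightarrow> 'b :: comm_monoid_mult"
proof -
  have "(\<Prod>c\<in>cell_triangle r n. g (hook_weight c)) =
      (\<Prod>c\<in>Sigma {..<n} (\<lambda>k. {i. i \<le> k \<and> enat i < r}). g (Suc (fst c)))"
    by (rule prod.reindex_bij_witness[of _ "\<lambda>(k, i). (i, k - i)" "\<lambda>(i, j). (i + j, i)"])
       (auto simp: cell_triangle_def hook_weight_def)
  also have "\<dots> = (\<Prod>k<n. \<Prod>i\<in>{i. i \<le> k \<and> enat i < r}. g (Suc k))"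
    by (subst prod.Sigma) (auto simp: case_prod_unfold)
  also have "\<dots> = (\<Prod>k<n. g (Suc k) ^ diag_count r k)"
    by (simp add: diag_count_def)
  finally show ?thesis .
qed

text \<open>A partial sum sees only finitely many cells and is at most the product of their zeta
  values. These products are bounded: with \<open>x = 2 powr (- \<sigma>)\<close>, each
  zeta((k+1)\<sigma>) is at most 1 + x^k Z \<le> exp(x^k Z), and the sum of (k+1) x^k
  converges.\<close>

lemma summable_fill_count:
  assumes \<sigma>: "\<sigma> > 1"
  shows "summable (\<lambda>n. real (fill_count hook_weight (cell_triangle r (Suc n)) (Suc n)) * real (Suc n) powr (- \<sigma>))"
proof -
  define Z where "Z = infsum (\<lambda>n. real n powr (- \<sigma>)) {1..}"
  have Z: "Z \<ge> 0" unfolding Z_def by (rule infsum_nonneg) auto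
  define x where "x = (2::real) powr (- \<sigma>)"
  have "x < 2 powr 0" unfolding x_def using \<sigma> by (intro powr_less_mono) auto
  then have x: "0 < x" "x < 1" by (auto simp: x_def)
  let ?f = "\<lambda>n. real n powr (- \<sigma>)"
  let ?a = "\<lambda>n. fill_count hook_weight (cell_triangle r n) n"
  have pow: "?f n ^ k = real n powr (- (real k * \<sigma>))" if "n \<in> {1..}" for n k
    using that by (simp add: powr_realpow[symmetric] powr_powr mult.commute)
  have kc: "real k * \<sigma> \<ge> \<sigma>" if "k \<ge> 1" for k
    using mult_right_mono[of 1 "real k" \<sigma>] that \<sigma> by simp
  have sm: "(\<lambda>n. norm (?f n ^ k)) summable_on {1..}" if "k \<ge> 1" for k
  proof -
    have "(\<lambda>n. real n powr (- (real k * \<sigma>))) summable_on {1..}"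
      using kc[OF that] \<sigma> by (intro summable_on_powr) linarith
    then show ?thesis by (rule summable_on_cong[THEN iffD1, rotated]) (simp add: pow)
  qed
  have factor: "infsum (\<lambda>n. ?f n ^ Suc k) {1..} \<le> exp (x ^ k * Z)" for k
  proof -
    have split: "{1::nat..} = insert 1 {2..}" by auto
    have s2: "(\<lambda>n. real n powr (- (real (Suc k) * \<sigma>))) summable_on {2..}"
    proof (rule summable_on_subset_banach[OF summable_on_powr])
      show "1 < real (Suc k) * \<sigma>" using kc[of "Suc k"] \<sigma> by linarith
    qed auto
    have "infsum (\<lambda>n. ?f n ^ Suc k) {1..} = infsum (\<lambda>n. real n powr (- (real (Suc k) * \<sigma>))) {1..}"
      by (rule infsum_cong) (rule pow)
    also have "\<dots> = 1 + infsum (\<lambda>n. real n powr (- (real (Suc k) * \<sigma>))) {2..}"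
      unfolding split using s2 by (subst infsum_insert) auto
    also have "\<dots> \<le> 1 + 2 powr (\<sigma> - real (Suc k) * \<sigma>) * Z"
      using infsum_powr_tail_le[OF \<sigma> kc, of "Suc k"] by (simp add: Z_def)
    also have "2 powr (\<sigma> - real (Suc k) * \<sigma>) = x ^ k"
      by (simp add: x_def powr_realpow[symmetric] powr_powr algebra_simps)
    also have "1 + x ^ k * Z \<le> exp (x ^ k * Z)" by (rule exp_ge_add_one_self)
    finally show ?thesis .
  qed
  have fpos: "0 \<le> infsum (\<lambda>n. ?f n ^ Suc k) {1..}" for k by (rule infsum_nonneg) auto
  define B where "B = exp (Z * (\<Sum>k. real (Suc k) * x ^ k))"
  have sumk: "summable (\<lambda>k. real (Suc k) * x ^ k)"
    using x by (intro sums_summable[OF geometric_deriv_sums]) auto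
  have prod_le: "(\<Prod>c\<in>cell_triangle r n. infsum (\<lambda>n. ?f n ^ hook_weight c) {1..}) \<le> B" for n
  proof -
    have "(\<Prod>c\<in>cell_triangle r n. infsum (\<lambda>n. ?f n ^ hook_weight c) {1..}) =
        (\<Prod>k<n. infsum (\<lambda>n. ?f n ^ Suc k) {1..} ^ diag_count r k)"
      by (rule prod_cell_triangle)
    also have "\<dots> \<le> (\<Prod>k<n. exp (Z * (real (Suc k) * x ^ k)))"
    proof (rule prod_mono, intro conjI)
      fix k
      have "infsum (\<lambda>n. ?f n ^ Suc k) {1..} ^ diag_count r k \<le> exp (x ^ k * Z) ^ diag_count r k"
        by (rule power_mono[OF factor fpos])
      also have "\<dots> \<le> exp (x ^ k * Z) ^ Suc k"
        using Z x by (intro power_increasing diag_count_le) auto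
      also have "\<dots> = exp (Z * (real (Suc k) * x ^ k))"
        by (simp only: exp_of_nat_mult[symmetric] mult_ac)
      finally show "infsum (\<lambda>n. ?f n ^ Suc k) {1..} ^ diag_count r k \<le> exp (Z * (real (Suc k) * x ^ k))" .
    qed (use fpos in auto)
    also have "\<dots> = exp (Z * (\<Sum>k<n. real (Suc k) * x ^ k))"
      by (simp only: exp_sum[OF finite_lessThan, symmetric] sum_distrib_left)
    also have "\<dots> \<le> B"
      unfolding B_def using Z x by (intro iffD2[OF exp_le_cancel_iff] mult_left_mono sum_le_suminf sumk) auto
    finally show ?thesis .
  qed
  show ?thesis
  proof (rule bounded_imp_summable)
    fix m
    let ?c = "\<lambda>n. fill_count hook_weight (cell_triangle r (Suc m)) n"
    have "(\<Sum>n\<le>m. real (?a (Suc n)) * ?f (Suc n)) = (\<Sum>n\<in>{1..Suc m}. real (?a n) * ?f n)"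
      by (rule sum.reindex_bij_witness[of _ "\<lambda>n. n - 1" Suc]) auto
    also have "\<dots> = (\<Sum>n\<in>{1..Suc m}. real (?c n) * ?f n)"
    proof (rule sum.cong[OF refl])
      fix n assume "n \<in> {1..Suc m}"
      then have "?c n = ?a n"
        by (intro fill_count_cong[OF finite_cell_triangle]) (auto simp: cell_triangle_def hook_weight_def)
      then show "real (?a n) * ?f n = real (?c n) * ?f n" by simp
    qed
    also have "\<dots> \<le> (\<Prod>c\<in>cell_triangle r (Suc m). infsum (\<lambda>n. ?f n ^ hook_weight c) {1..})"
    proof (rule finite_sum_le_has_sum)
      show "((\<lambda>n. real (?c n) * ?f n) has_sum (\<Prod>c\<in>cell_triangle r (Suc m). infsum (\<lambda>n. ?f n ^ hook_weight c) {1..})) {1..}"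
      proof (rule has_sum_fill_count)
        show "(\<lambda>n. norm (?f n ^ hook_weight c)) summable_on {1..}" for c by (rule sm[OF hook_weight_ge1])
      qed (simp_all add: powr_mult hook_weight_ge1[simplified])
    qed auto
    also have "\<dots> \<le> B" by (rule prod_le)
    finally show "(\<Sum>n\<le>m. real (?a (Suc n)) * ?f (Suc n)) \<le> B" .
  qed auto
qed

context character
begin

text \<open>Tannery's theorem exchanges the limit over truncations N with the sum over n: the
  coefficient of n is constant once N reaches n, and truncated counts never exceed the final one,
  whose series converges by \<open>summable_fill_count\<close>.\<close>

lemma L_prod_tendsto:
  assumes s: "Re s > 1"
  shows "summable (\<lambda>n. norm (of_nat (fill_count hook_weight (cell_triangle r (Suc n)) (Suc n)) * dcoeff s (Suc n)))"
    and "(\<lambda>N. L_prod (diag_count r) N s) \<longlonglongrightarrow>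
      (\<Sum>n. of_nat (fill_count hook_weight (cell_triangle r (Suc n)) (Suc n)) * dcoeff s (Suc n))"
proof -
  let ?a = "\<lambda>n. fill_count hook_weight (cell_triangle r n) n"
  let ?b = "\<lambda>n N. of_nat (fill_count hook_weight (cell_triangle r N) (Suc n)) * dcoeff s (Suc n)"
  let ?M = "\<lambda>n. real (?a (Suc n)) * real (Suc n) powr (- Re s)"
  have norm_dcoeff: "norm (dcoeff s (Suc n)) \<le> real (Suc n) powr (- Re s)" for n
    using norm_dcoeff_power_le[of "Suc n" s 1] by simp
  have mono: "fill_count hook_weight (cell_triangle r N) (Suc n) \<le> ?a (Suc n)" for n N
  proof (cases "N \<le> Suc n")
    case True
    then have "cell_triangle r N \<subseteq> cell_triangle r (Suc n)" by (auto simp: cell_triangle_def)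
    then show ?thesis by (intro fill_count_mono) (auto simp: hook_weight_def)
  next
    case False
    then have "fill_count hook_weight (cell_triangle r N) (Suc n) = ?a (Suc n)"
      by (intro fill_count_cong[OF finite_cell_triangle]) (auto simp: cell_triangle_def hook_weight_def)
    then show ?thesis by simp
  qed
  have bound: "norm (?b n N) \<le> ?M n" for n N
    using mono[of N n] norm_dcoeff[of n] by (simp add: norm_mult mult_mono del: of_nat_Suc)
  have hook: "real (hook_weight c) * Re s > 1" for c
  proof -
    have "1 * Re s \<le> real (hook_weight c) * Re s"
      using s by (intro mult_right_mono) (auto simp: hook_weight_def)
    then show ?thesis using s by linarith
  qed
  have "(\<Sum>n. ?b n N) = L_prod (diag_count r) N s" for N
  proof -
    have "((\<lambda>n. of_nat (fill_count hook_weight (cell_triangle r N) n) * dcoeff s n) has_sum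
        (\<Prod>c\<in>cell_triangle r N. infsum (\<lambda>n. dcoeff s n ^ hook_weight c) {1..})) {1..}"
    proof (rule has_sum_fill_count)
      show "(\<lambda>n. norm (dcoeff s n ^ hook_weight c)) summable_on {1..}" for c
        by (rule abs_summable_dcoeff_power[OF hook])
    qed (simp_all add: dcoeff_1[simplified] dcoeff_mult hook_weight_ge1[simplified])
    moreover have "bij_betw Suc UNIV {1..}"
      by (rule bij_betwI[where g = "\<lambda>n. n - 1"]) auto
    ultimately have "((\<lambda>n. ?b n N) has_sum (\<Prod>c\<in>cell_triangle r N. infsum (\<lambda>n. dcoeff s n ^ hook_weight c) {1..})) UNIV"
      using has_sum_reindex_bij_betw[of Suc UNIV "{1..}"] by fast
    then have "(\<Sum>n. ?b n N) = (\<Prod>c\<in>cell_triangle r N. infsum (\<lambda>n. dcoeff s n ^ hook_weight c) {1..})"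
      by (intro sums_unique[symmetric] has_sum_imp_sums)
    also have "\<dots> = (\<Prod>c\<in>cell_triangle r N. L_cont (hook_weight c) s)"
      by (intro prod.cong refl infsum_dcoeff_power hook)
    also have "\<dots> = L_prod (diag_count r) N s"
      unfolding L_prod_def by (rule prod_cell_triangle)
    finally show ?thesis .
  qed
  moreover have "(\<lambda>N. ?b n N) \<longlonglongrightarrow> of_nat (?a (Suc n)) * dcoeff s (Suc n)" for n
  proof (rule tendsto_eventually, rule eventually_sequentiallyI)
    fix N assume "N \<ge> Suc n"
    then have "fill_count hook_weight (cell_triangle r N) (Suc n) = ?a (Suc n)"
      by (intro fill_count_cong[OF finite_cell_triangle]) (auto simp: cell_triangle_def hook_weight_def)
    then show "?b n N = of_nat (?a (Suc n)) * dcoeff s (Suc n)" by simp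
  qed
  note T = tannerys_theorem[of ?b "\<lambda>n. of_nat (?a (Suc n)) * dcoeff s (Suc n)" sequentially ?M,
      OF this always_eventually summable_fill_count[OF s] sequentially_bot]
  ultimately show "summable (\<lambda>n. norm (of_nat (?a (Suc n)) * dcoeff s (Suc n)))"
    "(\<lambda>N. L_prod (diag_count r) N s) \<longlonglongrightarrow> (\<Sum>n. of_nat (?a (Suc n)) * dcoeff s (Suc n))"
    using T bound by auto
qed

end

section \<open>Infinite arrays with finite support\<close>

definition plane_arrays :: "enat \<Rightarrow> nat \<Rightarrow> (nat \<times> nat \<Rightarrow> nat) set" where
  "plane_arrays r n = {E. (\<forall>c. E c > 0) \<and> finite {c. E c \<noteq> 1} \<and>
     (\<forall>i j. E (Suc i, j) dvd E (i, j)) \<and> (\<forall>i j. E (i, Suc j) dvd E (i, j)) \<and>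
     (\<forall>i j. \<not> enat i < r \<longrightarrow> E (i, j) = 1) \<and> prod E {c. E c \<noteq> 1} = n}"

text \<open>All entries above and to the left of an entry other than 1 are at least 2, so 2^(i+1)
  and 2^(j+1) are at most n.\<close>

lemma plane_arrays_bounded:
  assumes E: "E \<in> plane_arrays r n" and ij: "E (i, j) \<noteq> 1"
  shows "i < n \<and> j < n"
proof -
  have pos: "E c > 0" for c using E unfolding plane_arrays_def by blast
  have fin: "finite {c. E c \<noteq> 1}" and n: "prod E {c. E c \<noteq> 1} = n"
    using E by (simp_all add: plane_arrays_def)
  have d1: "E (Suc i, j) dvd E (i, j)" and d2: "E (i, Suc j) dvd E (i, j)" for i j
    using E by (simp_all add: plane_arrays_def)
  have ne1: "E (i', j) \<noteq> 1" if "i' \<le> i" for i'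
    using that
  proof (induction rule: inc_induct)
    case (step k)
    then show ?case using d1[of k j] by auto
  qed fact
  have ne2: "E (i, j') \<noteq> 1" if "j' \<le> j" for j'
    using that
  proof (induction rule: inc_induct)
    case (step k)
    then show ?case using d2[of i k] by auto
  qed fact
  have pow: "2 ^ card S \<le> n" if "S \<subseteq> {c. E c \<noteq> 1}" for S
  proof -
    have "2 ^ card S = (\<Prod>c\<in>S. 2::nat)" by simp
    also have "\<dots> \<le> prod E S"
    proof (rule prod_mono)
      fix c assume "c \<in> S"
      then have "E c \<noteq> 1" using that by blast
      then show "0 \<le> (2::nat) \<and> 2 \<le> E c" using pos[of c] by linarith
    qed
    also have "\<dots> \<le> prod E {c. E c \<noteq> 1}"
      by (intro dvd_imp_le prod_dvd_prod_subset[OF fin that] prod_pos pos)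
    finally show ?thesis using n by simp
  qed
  have "card ((\<lambda>i'. (i', j)) ` {..i}) = Suc i" by (subst card_image) (auto simp: inj_on_def)
  then have "2 ^ Suc i \<le> n" using pow[of "(\<lambda>i'. (i', j)) ` {..i}"] ne1 by auto
  moreover have "card (Pair i ` {..j}) = Suc j" by (subst card_image) (auto simp: inj_on_def)
  then have "2 ^ Suc j \<le> n" using pow[of "Pair i ` {..j}"] ne2 by auto
  ultimately show ?thesis using less_exp[of "Suc i"] less_exp[of "Suc j"] by linarith
qed

lemma plane_arrays_eq:
  assumes R: "\<And>i. i < R \<longleftrightarrow> enat i < r \<and> i < n"
  shows "plane_arrays r n = {E \<in> divisor_arrays R n. prod E ({..<R} \<times> {..<n}) = n}"
proof (intro Set.set_eqI iffI)
  fix E assume E: "E \<in> plane_arrays r n"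
  have out: "E c = 1" if "c \<notin> {..<R} \<times> {..<n}" for c
  proof (rule ccontr)
    obtain i j where c: "c = (i, j)" by (cases c)
    assume ne: "E c \<noteq> 1"
    then have "i < n \<and> j < n" using plane_arrays_bounded[OF E] c by blast
    moreover have "enat i < r" using E ne c unfolding plane_arrays_def by blast
    ultimately show False using that c R by auto
  qed
  have "prod E ({..<R} \<times> {..<n}) = prod E {c. E c \<noteq> 1}"
    using out by (intro prod.mono_neutral_right) auto
  then show "E \<in> {E \<in> divisor_arrays R n. prod E ({..<R} \<times> {..<n}) = n}"
    using E out unfolding plane_arrays_def divisor_arrays_def by simp
next
  fix E assume E: "E \<in> {E \<in> divisor_arrays R n. prod E ({..<R} \<times> {..<n}) = n}"
  then have out: "\<And>c. c \<notin> {..<R} \<times> {..<n} \<Longrightarrow> E c = 1" unfolding divisor_arrays_def by blast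
  then have sub: "{c. E c \<noteq> 1} \<subseteq> {..<R} \<times> {..<n}" by blast
  then have "finite {c. E c \<noteq> 1}" by (rule finite_subset) simp
  moreover have "prod E {c. E c \<noteq> 1} = prod E ({..<R} \<times> {..<n})"
    using sub by (intro prod.mono_neutral_left) auto
  moreover have "E (i, j) = 1" if "\<not> enat i < r" for i j
    using that R by (intro out) auto
  ultimately show "E \<in> plane_arrays r n"
    using E unfolding plane_arrays_def divisor_arrays_def by simp
qed

lemma ex_row_bound: "\<exists>R. \<forall>i. i < R \<longleftrightarrow> enat i < r \<and> i < n"
  by (cases r) (auto intro: exI[of _ "min _ n"] exI[of _ n])

lemma card_plane_arrays:
  assumes n: "n > 0"
  shows "card (plane_arrays r n) = fill_count hook_weight (cell_triangle r n) n"
proof -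
  obtain R where R: "\<And>i. i < R \<longleftrightarrow> enat i < r \<and> i < n" using ex_row_bound by blast
  have "card (plane_arrays r n) = card {k \<in> fillings ({..<R} \<times> {..<n}). (\<Prod>c\<in>{..<R} \<times> {..<n}. k c ^ (fst c + snd c + 1)) = n}"
    unfolding plane_arrays_eq[OF R] by (rule card_divisor_arrays)
  also have "\<dots> = fill_count hook_weight ({..<R} \<times> {..<n}) n"
    by (simp add: fill_count_def hook_weight_def)
  also have "\<dots> = fill_count hook_weight (cell_triangle r n) n"
  \<comment> \<open>Cells outside the triangle have hook weight above n; dropping them removes the
    auxiliary row bound R.\<close>
  proof (rule fill_count_cong[OF _ _ n])
    show "cell_triangle r n \<subseteq> {..<R} \<times> {..<n}"
    proof
      fix c assume "c \<in> cell_triangle r n"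
      then have "enat (fst c) < r" "fst c < n" "snd c < n" by (auto simp: cell_triangle_def)
      then show "c \<in> {..<R} \<times> {..<n}" using R[of "fst c"] by (cases c) simp
    qed
    fix c assume c: "c \<in> {..<R} \<times> {..<n} - cell_triangle r n"
    then have "enat (fst c) < r" using R[of "fst c"] by auto
    then have "\<not> fst c + snd c < n" using c by (simp add: cell_triangle_def)
    then show "n \<le> hook_weight c" by (simp add: hook_weight_def)
  qed simp
  finally show ?thesis .
qed

lemma finite_plane_arrays:
  assumes n: "n > 0"
  shows "finite (plane_arrays r n)"
proof -
  let ?B = "{..<n} \<times> {..<n}"
  have out: "E c = 1" if "E \<in> plane_arrays r n" "c \<notin> ?B" for E c
    using plane_arrays_bounded[OF that(1), of "fst c" "snd c"] that(2) by (cases c) auto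
  have le: "E c \<in> {..n}" if E: "E \<in> plane_arrays r n" for E c
  proof (cases "E c = 1")
    case False
    have "finite {c. E c \<noteq> 1}" "prod E {c. E c \<noteq> 1} = n" using E by (simp_all add: plane_arrays_def)
    then have "E c dvd n" using dvd_prodI[of "{c. E c \<noteq> 1}" c E] False by simp
    then show ?thesis using n dvd_imp_le by auto
  qed (use n in auto)
  have "inj_on (\<lambda>E. restrict E ?B) (plane_arrays r n)"
  proof (rule inj_onI, rule ext)
    fix E E' c assume E: "E \<in> plane_arrays r n" "E' \<in> plane_arrays r n" "restrict E ?B = restrict E' ?B"
    show "E c = E' c"
    proof (cases "c \<in> ?B")
      case True
      then show ?thesis using fun_cong[OF E(3), of c] by simp
    next
      case False
      then show ?thesis using out[OF E(1) False] out[OF E(2) False] by simp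
    qed
  qed
  moreover have "(\<lambda>E. restrict E ?B) ` plane_arrays r n \<subseteq> PiE ?B (\<lambda>_. {..n})"
    using le by (intro image_subsetI restrict_PiE_iff[THEN iffD2] ballI) blast
  ultimately show ?thesis
    by (rule inj_on_finite) (intro finite_PiE, auto)
qed

section \<open>Invariant factors of finite Abelian groups\<close>

lemma (in group) subgroup_nat_pow_closed:
  assumes "subgroup H G" "x \<in> H"
  shows "x [^] (n::nat) \<in> H"
  using assms by (induction n) (auto simp: subgroup.one_closed subgroup.m_closed)

lemma (in group) subgroup_coprime_pow:
  assumes H: "subgroup H G" and x: "x \<in> carrier G"
    and a: "x [^] (a::nat) \<in> H" and b: "x [^] (b::nat) \<in> H" and cop: "coprime a b" and a0: "a \<noteq> 0"
  shows "x \<in> H"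
proof -
  obtain u v where uv: "a * u = b * v + gcd a b" using bezout_nat[OF a0] by blast
  have "x [^] (a * u) \<in> H" "x [^] (b * v) \<in> H"
    using subgroup_nat_pow_closed[OF H a, of u] subgroup_nat_pow_closed[OF H b, of v] x
    by (simp_all add: nat_pow_pow)
  moreover have "x [^] (a * u) = x [^] (b * v) \<otimes> x"
    using uv cop by simp
  then have "x = inv (x [^] (b * v)) \<otimes> x [^] (a * u)"
    using x by (simp add: m_assoc[symmetric])
  ultimately show ?thesis using H by (metis subgroup.m_closed subgroup.m_inv_closed)
qed

lemma (in comm_group) ord_mult_coprime:
  assumes x: "x \<in> carrier G" and y: "y \<in> carrier G" and cop: "coprime (ord x) (ord y)"
  shows "ord x * ord y dvd ord (x \<otimes> y)"
proof (rule divides_mult)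
  let ?n = "ord (x \<otimes> y)"
  have one: "x [^] ?n \<otimes> y [^] ?n = \<one>"
    using x y by (simp add: pow_mult_distrib[symmetric] m_comm)
  have "(x [^] ?n \<otimes> y [^] ?n) [^] k = x [^] (?n * k) \<otimes> y [^] (?n * k)" for k :: nat
    using x y by (simp add: pow_mult_distrib m_comm nat_pow_pow)
  then have k: "x [^] (?n * k) \<otimes> y [^] (?n * k) = \<one>" for k :: nat
    using one by simp
  have "y [^] (?n * ord y) = \<one>" "x [^] (?n * ord x) = \<one>"
    using x y by (simp_all add: pow_eq_id)
  then have "x [^] (?n * ord y) = \<one>" "y [^] (?n * ord x) = \<one>"
    using k[of "ord y"] k[of "ord x"] x y by simp_all
  then have "ord x dvd ?n * ord y" "ord y dvd ?n * ord x" using x y by (simp_all add: pow_eq_id)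
  then show "ord x dvd ?n" "ord y dvd ?n"
    using cop by (simp_all add: coprime_dvd_mult_left_iff coprime_commute)
qed fact

text \<open>If some prime p occurred more often in \<open>ord x\<close> than in
  \<open>ord g\<close>, the p-part of x times the p-free part of g would have order larger than
  \<open>ord g\<close>.\<close>

lemma (in comm_group) pow_max_ord_eq_1:
  assumes fin: "finite (carrier G)" and g: "g \<in> carrier G"
    and max: "\<And>x. x \<in> carrier G \<Longrightarrow> ord x \<le> ord g" and x: "x \<in> carrier G"
  shows "x [^] ord g = \<one>"
proof (rule ccontr)
  assume "x [^] ord g \<noteq> \<one>"
  then have ndvd: "\<not> ord x dvd ord g" using x by (simp add: pow_eq_id)
  have pos: "ord x > 0" "ord g > 0" using ord_ge_1[OF fin x] ord_ge_1[OF fin g] by auto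
  obtain p where p: "prime p" "multiplicity p (ord x) > multiplicity p (ord g)"
    using multiplicity_le_imp_dvd[of "ord x" "ord g"] ndvd pos by (metis not_le zero_less_iff_neq_zero)
  define a where "a = multiplicity p (ord x)"
  define b where "b = multiplicity p (ord g)"
  define x' where "x' = x [^] (ord x div p ^ a)"
  define y where "y = g [^] (p ^ b)"
  have pa: "p ^ a dvd ord x" "p ^ b dvd ord g" by (simp_all add: a_def b_def multiplicity_dvd)
  have p0: "p ^ a \<noteq> 0" "p ^ b \<noteq> 0" using p prime_gt_0_nat by auto
  have d: "ord x div p ^ a dvd ord x" "ord x div p ^ a \<noteq> 0"
    using pa pos by (auto elim!: dvdE)
  have xy: "x' \<in> carrier G" "y \<in> carrier G" using x g by (auto simp: x'_def y_def)
  have "ord x' = p ^ a"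
    using ord_pow[OF x d] pa pos p0 by (auto simp: x'_def elim!: dvdE)
  moreover have oy: "ord y = ord g div p ^ b"
    using ord_pow[OF g pa(2) p0(2)] by (simp add: y_def)
  moreover have "\<not> p dvd ord g div p ^ b"
    using multiplicity_decompose[of "ord g" p] prime_gt_1_nat[OF p(1)] pos by (auto simp: b_def)
  then have "coprime (p ^ a) (ord g div p ^ b)"
    using p(1) by (simp add: prime_imp_coprime)
  ultimately have "p ^ a * (ord g div p ^ b) dvd ord (x' \<otimes> y)"
    using ord_mult_coprime[OF xy] by simp
  moreover have "ord (x' \<otimes> y) > 0" using ord_ge_1[OF fin, of "x' \<otimes> y"] xy by simp
  ultimately have "p ^ a * (ord g div p ^ b) \<le> ord g"
    using max[of "x' \<otimes> y"] xy dvd_imp_le by (metis le_trans m_closed)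
  moreover have "ord g = p ^ b * (ord g div p ^ b)" using pa by simp
  ultimately have "p ^ a * (ord g div p ^ b) \<le> p ^ b * (ord g div p ^ b)" by simp
  moreover have "ord g div p ^ b > 0" using pa pos by (auto elim!: dvdE)
  ultimately have "p ^ a \<le> p ^ b" by simp
  then have "a \<le> b" using p prime_gt_1_nat by (meson power_le_imp_le_exp)
  then show False using p(2) by (simp add: a_def b_def)
qed

text \<open>Natural exponents suffice in a finite group: the inverse of g^n is a further power of g,
  with exponent \<open>n * ord g - n\<close>.\<close>

definition (in group) powers :: "'a \<Rightarrow> 'a set" where
  "powers g = range (\<lambda>n::nat. g [^] n)"

lemma (in group) subgroup_powers:
  assumes fin: "finite (carrier G)" and g: "g \<in> carrier G"
  shows "subgroup (powers g) G"
proof (rule subgroupI)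
  show "powers g \<subseteq> carrier G" "powers g \<noteq> {}" using g by (auto simp: powers_def)
  fix a assume "a \<in> powers g"
  then obtain n :: nat where n: "a = g [^] n" by (auto simp: powers_def)
  have "n \<le> n * ord g" using ord_ge_1[OF fin g] by simp
  then have "g [^] n \<otimes> g [^] (n * ord g - n) = g [^] (n * ord g)" using g by (simp add: nat_pow_mult)
  also have "\<dots> = \<one>" using g by (simp add: pow_eq_id)
  finally have "inv a = g [^] (n * ord g - n)"
    using g n by (metis inv_equality inv_inv nat_pow_closed r_inv_ex inv_unique' inv_closed)
  then show "inv a \<in> powers g" by (auto simp: powers_def)
next
  fix a b assume "a \<in> powers g" "b \<in> powers g"
  then obtain m n :: nat where "a = g [^] m" "b = g [^] n" by (auto simp: powers_def)
  then have "a \<otimes> b = g [^] (m + n)" using g by (simp add: nat_pow_mult)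
  then show "a \<otimes> b \<in> powers g" by (auto simp: powers_def)
qed

text \<open>A subgroup maximal among those meeting the cyclic group generated by g trivially is a
  complement of it.\<close>

lemma (in comm_group) ex_complement:
  assumes fin: "finite (carrier G)" and g: "g \<in> carrier G"
    and exponent: "\<And>x. x \<in> carrier G \<Longrightarrow> x [^] ord g = \<one>"
  obtains K where "subgroup K G" "powers g \<inter> K = {\<one>}" "powers g <#> K = carrier G"
proof -
  let ?C = "powers g" and ?m = "ord g"
  have C: "subgroup ?C G" by (rule subgroup_powers[OF fin g])
  define \<K> where "\<K> = {K. subgroup K G \<and> ?C \<inter> K = {\<one>}}"
  have "\<K> \<subseteq> Pow (carrier G)" using subgroup.subset by (auto simp: \<K>_def)
  then have fK: "finite \<K>" using fin finite_subset by blast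
  have "{\<one>} \<in> \<K>" using triv_subgroup subgroup.one_closed[OF C] by (auto simp: \<K>_def)
  then obtain K where K: "K \<in> \<K>" and Kmax: "\<And>L. L \<in> \<K> \<Longrightarrow> K \<subseteq> L \<Longrightarrow> L = K"
    using finite_has_maximal[OF fK] by blast
  have KG: "subgroup K G" and CK1: "?C \<inter> K = {\<one>}" using K by (auto simp: \<K>_def)
  let ?S = "?C <#> K"
  have S: "subgroup ?S G" by (rule mult_subgroups[OF C KG])
  have KS: "K \<subseteq> ?S"
    using subgroup.one_closed[OF C] subgroup.mem_carrier[OF KG] by (force simp: set_mult_def)
  have CS: "?C \<subseteq> ?S"
    using subgroup.one_closed[OF KG] subgroup.mem_carrier[OF C] by (force simp: set_mult_def)
  have m: "?m > 0" using ord_ge_1[OF fin g] by simp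
  have "carrier G \<subseteq> ?S"
  proof (rule ccontr)
    assume "\<not> carrier G \<subseteq> ?S"
    then obtain x where x: "x \<in> carrier G" "x \<notin> ?S" by blast
    let ?P = "\<lambda>n. n > 0 \<and> x [^] (n::nat) \<in> ?S"
    have ex: "?P ?m" using m exponent[OF x(1)] subgroup.one_closed[OF S] by simp
    \<comment> \<open>N is the order of x modulo the subgroup \<open>?S\<close>; for a prime p
      dividing N, the power \<open>x [^] (N div p)\<close> has order exactly p modulo
      \<open>?S\<close>.\<close>
    define N where "N = (LEAST n. ?P n)"
    have N: "N > 0" "x [^] N \<in> ?S" using LeastI[of ?P, OF ex] by (auto simp: N_def)
    have Nmin: "n \<ge> N" if "n > 0" "x [^] n \<in> ?S" for n
      unfolding N_def using that by (intro Least_le) auto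
    have "N \<noteq> 1" using N x by auto
    then obtain p where p: "prime p" "p dvd N" using prime_factor_nat by blast
    define x' where "x' = x [^] (N div p)"
    have x': "x' \<in> carrier G" using x by (simp add: x'_def)
    have Np: "N div p > 0" "N div p < N"
      using p(2) N prime_gt_1_nat[OF p(1)] by (auto elim!: dvdE)
    then have x'S: "x' \<notin> ?S" using Nmin[of "N div p"] by (auto simp: x'_def)
    have x'p: "x' [^] p \<in> ?S" using N p x by (simp add: x'_def nat_pow_pow)
    have "p dvd ?m"
    proof (rule ccontr)
      assume "\<not> p dvd ?m"
      then have "coprime p ?m" using p(1) by (simp add: prime_imp_coprime)
      moreover have "x' [^] ?m \<in> ?S" using exponent[OF x'] subgroup.one_closed[OF S] by simp
      ultimately show False
        using subgroup_coprime_pow[OF S x' x'p] x'S p(1) by auto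
    qed
    then obtain m' where m': "?m = p * m'" by blast
    obtain i :: nat and k where ik: "x' [^] p = g [^] i \<otimes> k" "k \<in> K"
      using x'p by (auto simp: set_mult_def powers_def)
    have kG: "k \<in> carrier G" using ik(2) subgroup.mem_carrier[OF KG] by blast
    \<comment> \<open>Raising to \<open>m' = ord g / p\<close> places a power of g in the trivial
      intersection. Hence p divides i, so the part of \<open>x' [^] p\<close> in the cyclic group is
      itself a p-th power.\<close>
    have "(g [^] i \<otimes> k) [^] m' = \<one>"
      using exponent[OF x'] m' x' by (simp add: ik(1)[symmetric] nat_pow_pow)
    then have e: "g [^] (i * m') \<otimes> k [^] m' = \<one>"
      using g kG by (simp add: pow_mult_distrib m_comm nat_pow_pow)
    then have "g [^] (i * m') = inv (k [^] m')"
      using g kG by (metis inv_equality nat_pow_closed)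
    then have "g [^] (i * m') \<in> K"
      using subgroup.m_inv_closed[OF KG subgroup_nat_pow_closed[OF KG ik(2), of m']] by simp
    moreover have "g [^] (i * m') \<in> ?C" by (auto simp: powers_def)
    ultimately have "g [^] (i * m') = \<one>" using CK1 by blast
    then have "p * m' dvd i * m'" using g m' by (simp add: pow_eq_id)
    then obtain q where q: "i = p * q" using m m' by auto
    \<comment> \<open>Cancelling that p-th power corrects x' within its coset of \<open>?S\<close>:
      y is still outside \<open>?S\<close>, but its p-th power lies in K. Adjoining y to K will
      contradict maximality.\<close>
    define y where "y = x' \<otimes> inv (g [^] q)"
    have y: "y \<in> carrier G" using x' g by (simp add: y_def)
    have gq: "g [^] q \<in> ?S" using CS by (auto simp: powers_def)
    have yS: "y \<notin> ?S"
    proof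
      assume "y \<in> ?S"
      then have "y \<otimes> g [^] q \<in> ?S" using gq by (rule subgroup.m_closed[OF S])
      moreover have "y \<otimes> g [^] q = x'" using x' g by (simp add: y_def m_assoc)
      ultimately show False using x'S by simp
    qed
    have "y [^] p = x' [^] p \<otimes> inv (g [^] q) [^] p"
      using x' g by (simp add: y_def pow_mult_distrib m_comm)
    also have "inv (g [^] q) [^] p = inv (g [^] i)"
      using g q by (simp add: nat_pow_inv[symmetric] nat_pow_pow mult.commute)
    also have "x' [^] p \<otimes> inv (g [^] i) = k"
      using ik g kG by (simp add: m_comm[of "g [^] i" k] m_assoc)
    finally have yp: "y [^] p \<in> K" using ik(2) by simp
    let ?L = "powers y <#> K"
    have L: "subgroup ?L G" by (rule mult_subgroups[OF subgroup_powers[OF fin y] KG])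
    have "K \<subseteq> ?L"
      using subgroup.one_closed[OF subgroup_powers[OF fin y]] subgroup.mem_carrier[OF KG] by (force simp: set_mult_def)
    moreover have "y \<in> ?L"
    proof -
      have "y = y [^] (1::nat) \<otimes> \<one>" using y by simp
      then show ?thesis using subgroup.one_closed[OF KG] unfolding set_mult_def powers_def by blast
    qed
    moreover have "?C \<inter> ?L = {\<one>}"
    proof -
      have "z = \<one>" if z: "z \<in> ?C" "z \<in> ?L" for z
      proof -
        obtain t :: nat and l where tl: "z = y [^] t \<otimes> l" "l \<in> K"
          using z(2) by (auto simp: set_mult_def powers_def)
        have lG: "l \<in> carrier G" using tl(2) subgroup.mem_carrier[OF KG] by blast
        \<comment> \<open>Otherwise both \<open>y [^] t\<close> and \<open>y [^] p\<close> lie in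
          \<open>?S\<close> with coprime exponents, which would put y into
          \<open>?S\<close>.\<close>
        have "p dvd t"
        proof (rule ccontr)
          assume "\<not> p dvd t"
          then have cop: "coprime p t" using p(1) by (simp add: prime_imp_coprime)
          have "y [^] t = z \<otimes> inv l" using tl lG y by (simp add: m_assoc)
          moreover have "z \<otimes> inv l \<in> ?S"
            using z(1) CS KS tl(2) S KG by (meson subgroup.m_closed subgroup.m_inv_closed subsetD)
          ultimately have "y [^] t \<in> ?S" by simp
          moreover have "y [^] p \<in> ?S" using yp KS by blast
          ultimately show False using subgroup_coprime_pow[OF S y _ _ cop] yS p(1) by auto
        qed
        then obtain t' where "t = p * t'" by blast
        then have "y [^] t = (y [^] p) [^] t'" using y by (simp add: nat_pow_pow)
        then have "y [^] t \<in> K" using subgroup_nat_pow_closed[OF KG yp] by simp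
        then have "z \<in> K" using tl KG by (simp add: subgroup.m_closed)
        then show ?thesis using z(1) CK1 by blast
      qed
      then show ?thesis using subgroup.one_closed[OF C] subgroup.one_closed[OF L] by blast
    qed
    ultimately have "?L = K" "y \<in> ?L" using Kmax[of ?L] L by (auto simp: \<K>_def)
    then show False using yS KS by blast
  qed
  moreover have "?S \<subseteq> carrier G" by (rule subgroup.subset[OF S])
  ultimately show thesis using that[OF KG CK1] by blast
qed

section \<open>Standard groups and the existence of invariant factors\<close>

definition invariant_group :: "(nat \<Rightarrow> nat) \<Rightarrow> (nat \<Rightarrow> int) monoid" where
  "invariant_group e = \<lparr>carrier = {x. \<forall>i. 0 \<le> x i \<and> x i < int (e i)},
     monoid.mult = (\<lambda>x y i. (x i + y i) mod int (e i)), one = (\<lambda>_. 0)\<rparr>"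

definition divisor_chain :: "(nat \<Rightarrow> nat) \<Rightarrow> bool" where
  "divisor_chain e \<longleftrightarrow> (\<forall>i. e i > 0) \<and> (\<forall>i. e (Suc i) dvd e i) \<and> finite {i. e i \<noteq> 1}"

lemma divisor_chain_dvd:
  assumes "divisor_chain e" "i \<le> k"
  shows "e k dvd e i"
  using assms(2)
proof (induction k rule: dec_induct)
  case (step k)
  have "e (Suc k) dvd e k" using assms(1) by (simp add: divisor_chain_def)
  then show ?case using step by (blast intro: dvd_trans)
qed simp

lemma invariant_group_simps [simp]:
  "x \<in> carrier (invariant_group e) \<longleftrightarrow> (\<forall>i. 0 \<le> x i \<and> x i < int (e i))"
  "x \<otimes>\<^bsub>invariant_group e\<^esub> y = (\<lambda>i. (x i + y i) mod int (e i))"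
  "\<one>\<^bsub>invariant_group e\<^esub> = (\<lambda>_. 0)"
  by (simp_all add: invariant_group_def)

lemma comm_group_invariant_group:
  assumes "\<And>i. e i > 0"
  shows "comm_group (invariant_group e)"
proof (rule comm_groupI)
  fix x assume x: "x \<in> carrier (invariant_group e)"
  show "\<exists>y\<in>carrier (invariant_group e). y \<otimes>\<^bsub>invariant_group e\<^esub> x = \<one>\<^bsub>invariant_group e\<^esub>"
    by (rule bexI[of _ "\<lambda>i. (- x i) mod int (e i)"]) (use assms in \<open>auto simp: mod_add_left_eq\<close>)
qed (use assms in \<open>auto simp: mod_simps add_ac fun_eq_iff\<close>)

lemma group_invariant_group: "(\<And>i. e i > 0) \<Longrightarrow> group (invariant_group e)"
  by (rule comm_group.axioms(2)[OF comm_group_invariant_group])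

lemma pow_invariant_group:
  "x [^]\<^bsub>invariant_group e\<^esub> (n::nat) = (\<lambda>i. (int n * x i) mod int (e i))"
  by (induction n) (auto simp: fun_eq_iff mod_simps algebra_simps)

lemma bij_carrier_invariant_group:
  "bij_betw (\<lambda>x. restrict x {i. e i \<noteq> 1}) (carrier (invariant_group e)) (PiE {i. e i \<noteq> 1} (\<lambda>i. {0..<int (e i)}))"
proof (rule bij_betwI[where g = "\<lambda>x i. if e i = 1 then 0 else x i"])
  show "(\<lambda>i. if e i = 1 then 0 else restrict x {i. e i \<noteq> 1} i) = x" if "x \<in> carrier (invariant_group e)" for x
  proof
    fix i
    have "0 \<le> x i \<and> x i < int (e i)" using that by simp
    then show "(if e i = 1 then 0 else restrict x {i. e i \<noteq> 1} i) = x i" by auto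
  qed
qed (auto simp: fun_eq_iff PiE_iff extensional_def)

lemma finite_carrier_invariant_group:
  "divisor_chain e \<Longrightarrow> finite (carrier (invariant_group e))"
  using bij_betw_finite[OF bij_carrier_invariant_group[of e]] by (auto simp: divisor_chain_def intro!: finite_PiE)

lemma order_invariant_group:
  "divisor_chain e \<Longrightarrow> Coset.order (invariant_group e) = prod e {i. e i \<noteq> 1}"
  using bij_betw_same_card[OF bij_carrier_invariant_group[of e]]
  by (simp add: Coset.order_def divisor_chain_def card_PiE)

lemma trivial_invariant_group:
  assumes "carrier G = {\<one>\<^bsub>G\<^esub>}" "group G"
  shows "invariant_group (\<lambda>_. 1) \<cong> G"
proof (rule is_isoI[OF isoI])
  interpret group G by fact
  show "(\<lambda>_. \<one>\<^bsub>G\<^esub>) \<in> hom (invariant_group (\<lambda>_. 1)) G" by (auto simp: hom_def)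
  have "x = (\<lambda>_. 0)" if "x \<in> carrier (invariant_group (\<lambda>_. 1))" for x
  proof
    fix i
    have "0 \<le> x i \<and> x i < int 1" using that by (simp only: invariant_group_simps)
    then show "x i = 0" by simp
  qed
  then show "bij_betw (\<lambda>_. \<one>\<^bsub>G\<^esub>) (carrier (invariant_group (\<lambda>_. 1))) (carrier G)"
    unfolding assms(1) by (intro bij_betwI[where g = "\<lambda>_ _. 0"]) auto
qed

lemma (in group) pow_mod_ord:
  assumes "x \<in> carrier G"
  shows "x [^] (n mod ord x) = x [^] (n::nat)"
proof -
  have "x [^] n = x [^] (ord x * (n div ord x) + n mod ord x)" by simp
  also have "\<dots> = x [^] (ord x * (n div ord x)) \<otimes> x [^] (n mod ord x)"
    using assms by (simp only: nat_pow_mult)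
  also have "x [^] (ord x * (n div ord x)) = \<one>" using assms by (simp add: pow_eq_id)
  finally show ?thesis using assms by simp
qed

text \<open>G is the internal direct product of K and the cyclic group of g, so the order of g is
  prepended to the chain of K as a new first coordinate.\<close>

lemma (in comm_group) extend_invariant_group:
  assumes fin: "finite (carrier G)" and g: "g \<in> carrier G" and K: "subgroup K G"
    and inter: "powers g \<inter> K = {\<one>}" and union: "powers g <#> K = carrier G"
    and e: "\<And>i. e i > 0" and iso: "invariant_group e \<cong> G\<lparr>carrier := K\<rparr>"
  shows "invariant_group (case_nat (ord g) e) \<cong> G"
proof -
  let ?e = "case_nat (ord g) e" and ?H = "G\<lparr>carrier := K\<rparr>"
  have m: "ord g > 0" using ord_ge_1[OF fin g] by simp
  have e': "?e i > 0" for i using m e by (cases i) auto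
  obtain \<phi> where \<phi>: "\<phi> \<in> hom (invariant_group e) ?H" "bij_betw \<phi> (carrier (invariant_group e)) K"
    using iso by (auto simp: is_iso_def iso_def)
  interpret H: group ?H using K by (rule subgroup_imp_group)
  interpret I: group "invariant_group e" using e by (rule group_invariant_group)
  interpret P: group "invariant_group ?e" using e' by (rule group_invariant_group)
  interpret \<phi>: group_hom "invariant_group e" ?H \<phi> by unfold_locales (rule \<phi>)
  have tl: "x \<circ> Suc \<in> carrier (invariant_group e)" if "x \<in> carrier (invariant_group ?e)" for x
  proof -
    have "0 \<le> x (Suc i) \<and> x (Suc i) < int (?e (Suc i))" for i using that by (simp only: invariant_group_simps)
    then show ?thesis by simp
  qed
  have hd: "0 \<le> x 0 \<and> x 0 < int (ord g)" if "x \<in> carrier (invariant_group ?e)" for x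
  proof -
    have "0 \<le> x 0 \<and> x 0 < int (?e 0)" using that by (simp only: invariant_group_simps)
    then show ?thesis by simp
  qed
  have \<phi>K: "\<phi> x \<in> K" if "x \<in> carrier (invariant_group e)" for x
    using \<phi>.hom_closed[OF that] by simp
  have KG: "k \<in> carrier G" if "k \<in> K" for k using subgroup.mem_carrier[OF K that] .
  define \<psi> where "\<psi> x = g [^] nat (x 0) \<otimes> \<phi> (x \<circ> Suc)" for x
  have pw: "g [^] nat ((a + b) mod int (ord g)) = g [^] nat a \<otimes> g [^] nat b" if "0 \<le> a" "0 \<le> b" for a b :: int
  proof -
    have "nat ((a + b) mod int (ord g)) = (nat a + nat b) mod ord g"
      using that by (simp add: nat_mod_distrib nat_add_distrib)
    then have "g [^] nat ((a + b) mod int (ord g)) = g [^] ((nat a + nat b) mod ord g)" by simp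
    also have "\<dots> = g [^] (nat a + nat b)"
      by (rule pow_mod_ord[OF g])
    also have "\<dots> = g [^] nat a \<otimes> g [^] nat b" using g by (simp add: nat_pow_mult)
    finally show ?thesis .
  qed
  have hom: "\<psi> \<in> hom (invariant_group ?e) G"
  proof (rule homI)
    fix x assume x: "x \<in> carrier (invariant_group ?e)"
    show "\<psi> x \<in> carrier G" using g KG[OF \<phi>K[OF tl[OF x]]] by (simp add: \<psi>_def)
  next
    fix x y assume x: "x \<in> carrier (invariant_group ?e)" and y: "y \<in> carrier (invariant_group ?e)"
    let ?z = "x \<otimes>\<^bsub>invariant_group ?e\<^esub> y"
    have "?z \<circ> Suc = (x \<circ> Suc) \<otimes>\<^bsub>invariant_group e\<^esub> (y \<circ> Suc)" by (simp add: fun_eq_iff)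
    then have "\<phi> (?z \<circ> Suc) = \<phi> (x \<circ> Suc) \<otimes> \<phi> (y \<circ> Suc)"
      using \<phi>.hom_mult[OF tl[OF x] tl[OF y]] by simp
    moreover have "g [^] nat (?z 0) = g [^] nat (x 0) \<otimes> g [^] nat (y 0)"
      using pw[of "x 0" "y 0"] hd[OF x] hd[OF y] by simp
    ultimately show "\<psi> ?z = \<psi> x \<otimes> \<psi> y"
      using g KG[OF \<phi>K[OF tl[OF x]]] KG[OF \<phi>K[OF tl[OF y]]] by (simp add: \<psi>_def m_ac)
  qed
  interpret \<psi>: group_hom "invariant_group ?e" G \<psi> by unfold_locales (rule hom)
  have "\<psi> \<in> iso (invariant_group ?e) G"
    unfolding \<psi>.iso_iff
  proof (intro conjI ballI impI subsetI)
    fix y assume "y \<in> carrier G"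
    then obtain n :: nat and k where y: "y = g [^] n \<otimes> k" "k \<in> K"
      unfolding union[symmetric] by (auto simp: set_mult_def powers_def)
    obtain z where z: "z \<in> carrier (invariant_group e)" "\<phi> z = k" using \<phi>(2) y(2) by (auto simp: bij_betw_def)
    let ?x = "case_nat (int (n mod ord g)) z"
    have "?x \<in> carrier (invariant_group ?e)" using z(1) m by (auto split: nat.split)
    moreover have "?x \<circ> Suc = z" by (simp add: fun_eq_iff)
    then have "\<psi> ?x = y" using y z g pow_mod_ord by (simp add: \<psi>_def)
    ultimately show "y \<in> \<psi> ` carrier (invariant_group ?e)" by blast
  next
    fix x assume x: "x \<in> carrier (invariant_group ?e)" and 1: "\<psi> x = \<one>"
    have k: "\<phi> (x \<circ> Suc) \<in> K" by (rule \<phi>K[OF tl[OF x]])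
    then have "g [^] nat (x 0) = inv (\<phi> (x \<circ> Suc))"
      using 1 g KG by (metis \<psi>_def inv_equality nat_pow_closed)
    then have "g [^] nat (x 0) \<in> K" using subgroup.m_inv_closed[OF K k] by simp
    then have g1: "g [^] nat (x 0) = \<one>" using inter by (auto simp: powers_def)
    then have "ord g dvd nat (x 0)" using g by (simp add: pow_eq_id)
    then have x0: "x 0 = 0" using hd[OF x] by (metis dvd_imp_le nat_0_iff nat_less_iff not_le order_antisym zero_less_iff_neq_zero)
    have "\<phi> (x \<circ> Suc) = \<one>" using 1 g1 KG[OF k] by (simp add: \<psi>_def)
    then have "\<phi> (x \<circ> Suc) = \<phi> (\<lambda>_. 0)" using \<phi>.hom_one by simp
    then have "x \<circ> Suc = (\<lambda>_. 0)"
      using \<phi>(2) tl[OF x] e by (auto simp: bij_betw_def inj_on_def)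
    then have "x i = 0" for i using x0 by (cases i) (auto simp: fun_eq_iff)
    then show "x = \<one>\<^bsub>invariant_group ?e\<^esub>" by (simp add: fun_eq_iff)
  qed
  then show ?thesis by (rule is_isoI)
qed

lemma ex_invariant_group:
  fixes G :: "'a monoid"
  assumes "comm_group G" "finite (carrier G)"
  shows "\<exists>e. divisor_chain e \<and> invariant_group e \<cong> G"
  using assms
proof (induction "card (carrier G)" arbitrary: G rule: less_induct)
  case less
  interpret comm_group G by fact
  have fin: "finite (carrier G)" by fact
  have "Max (ord ` carrier G) \<in> ord ` carrier G" using fin by (intro Max_in) auto
  then obtain g where g: "g \<in> carrier G" "Max (ord ` carrier G) = ord g" by (rule imageE)
  have max: "ord x \<le> ord g" if "x \<in> carrier G" for x
    using fin that unfolding g(2)[symmetric] by (intro Max_ge) auto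
  have exponent: "x [^]\<^bsub>G\<^esub> ord g = \<one>\<^bsub>G\<^esub>" if "x \<in> carrier G" for x
    by (rule pow_max_ord_eq_1[OF fin g(1) max that])
  show ?case
  proof (cases "ord g = 1")
    case True
    then have "carrier G = {\<one>\<^bsub>G\<^esub>}" using exponent by fastforce
    then have "invariant_group (\<lambda>_. 1) \<cong> G" by (intro trivial_invariant_group) unfold_locales
    then show ?thesis by (intro exI[of _ "\<lambda>_. 1"]) (simp add: divisor_chain_def)
  next
    case False
    obtain K where K: "subgroup K G" "powers g \<inter> K = {\<one>\<^bsub>G\<^esub>}" "powers g <#>\<^bsub>G\<^esub> K = carrier G"
      by (rule ex_complement[OF fin g(1) exponent])
    let ?H = "G\<lparr>carrier := K\<rparr>"
    have "g = g [^]\<^bsub>G\<^esub> (1::nat)" using g by simp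
    then have "g \<in> powers g" unfolding powers_def by blast
    moreover have "g \<noteq> \<one>\<^bsub>G\<^esub>" using False g ord_eq_1 by blast
    ultimately have "g \<notin> K" using K(2) by blast
    then have "K \<subset> carrier G" using g subgroup.subset[OF K(1)] by blast
    then have "card (carrier ?H) < card (carrier G)" using fin by (simp add: psubset_card_mono)
    moreover have H: "comm_group ?H"
      using subgroup_imp_group[OF K(1)] subgroup.mem_carrier[OF K(1)]
      by (intro group.group_comm_groupI) (auto simp: m_comm)
    moreover have "finite (carrier ?H)" using finite_subset[OF subgroup.subset[OF K(1)] fin] by simp
    ultimately obtain e where e: "divisor_chain e" "invariant_group e \<cong> ?H" using less(1) by blast
    have epos: "e i > 0" for i using e(1) by (simp add: divisor_chain_def)
    interpret H: comm_group ?H by fact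
    interpret I: comm_group "invariant_group e" by (rule comm_group_invariant_group[OF epos])
    obtain \<phi> where \<phi>: "\<phi> \<in> hom (invariant_group e) ?H" "bij_betw \<phi> (carrier (invariant_group e)) K"
      using e(2) by (auto simp: is_iso_def iso_def)
    interpret \<phi>: group_hom "invariant_group e" ?H \<phi> by unfold_locales (rule \<phi>)
    \<comment> \<open>The order of g is an exponent of G and therefore kills the generator
      \<open>?u\<close> of the first cyclic factor of the complement. The entry
      \<open>1 mod int (e 0)\<close> is 0 in the case \<open>e 0 = 1\<close>.\<close>
    have "e 0 dvd ord g"
    proof -
      let ?u = "(\<lambda>i. if i = 0 then 1 mod int (e 0) else 0) :: nat \<Rightarrow> int"
      have u: "?u \<in> carrier (invariant_group e)" using epos by simp
      have "\<phi> (?u [^]\<^bsub>invariant_group e\<^esub> ord g) = \<phi> ?u [^]\<^bsub>?H\<^esub> ord g" by (rule \<phi>.hom_nat_pow[OF u])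
      also have "\<dots> = \<phi> ?u [^]\<^bsub>G\<^esub> ord g" by (simp add: nat_pow_def)
      also have "\<dots> = \<one>\<^bsub>G\<^esub>" using exponent \<phi>.hom_closed[OF u] subgroup.mem_carrier[OF K(1)] by simp
      also have "\<dots> = \<phi> \<one>\<^bsub>invariant_group e\<^esub>" using \<phi>.hom_one by simp
      finally have "?u [^]\<^bsub>invariant_group e\<^esub> ord g = \<one>\<^bsub>invariant_group e\<^esub>"
        using \<phi>(2) I.nat_pow_closed[OF u] I.one_closed by (auto simp only: bij_betw_def inj_on_def)
      then have "(int (ord g) * (1 mod int (e 0))) mod int (e 0) = 0"
        by (auto simp: pow_invariant_group dest: fun_cong[of _ _ 0])
      then have "int (e 0) dvd int (ord g)" by (simp add: mod_simps dvd_eq_mod_eq_0)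
      then show ?thesis by simp
    qed
    then have "case_nat (ord g) e (Suc i) dvd case_nat (ord g) e i" for i
      using e(1) by (cases i) (auto simp: divisor_chain_def)
    moreover have "case_nat (ord g) e i > 0" for i
      using epos ord_ge_1[OF fin g(1)] by (cases i) auto
    moreover have "finite {i. case_nat (ord g) e i \<noteq> 1}"
    proof (rule finite_subset)
      show "{i. case_nat (ord g) e i \<noteq> 1} \<subseteq> insert 0 (Suc ` {i. e i \<noteq> 1})"
      proof
        fix i assume "i \<in> {i. case_nat (ord g) e i \<noteq> 1}"
        then show "i \<in> insert 0 (Suc ` {i. e i \<noteq> 1})" by (cases i) auto
      qed
      show "finite (insert 0 (Suc ` {i. e i \<noteq> 1}))" using e(1) by (simp add: divisor_chain_def)
    qed
    ultimately have "divisor_chain (case_nat (ord g) e)" unfolding divisor_chain_def by blast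
    moreover have "invariant_group (case_nat (ord g) e) \<cong> G"
      by (rule extend_invariant_group[OF fin g(1) K epos e(2)])
    ultimately show ?thesis by blast
  qed
qed

section \<open>Embeddings and divisibility\<close>

lemma invariant_group_mon:
  assumes "\<And>i. e i > 0" "\<And>i. e' i > 0" "\<And>i. e i dvd e' i"
  shows "(\<lambda>x i. x i * int (e' i div e i)) \<in> mon (invariant_group e) (invariant_group e')"
proof -
  have eq: "int (e' i) = int (e i) * int (e' i div e i)" for i
    using assms(3)[of i] by (simp flip: of_nat_mult)
  have q: "int (e' i div e i) > 0" for i
    using assms(1-3)[of i] by (auto elim!: dvdE)
  show ?thesis
    unfolding mon_def
  proof (intro CollectI conjI homI inj_onI)
    fix x assume x: "x \<in> carrier (invariant_group e)"
    have "0 \<le> x i * int (e' i div e i) \<and> x i * int (e' i div e i) < int (e' i)" for i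
    proof -
      have "0 \<le> x i" "x i < int (e i)" using x by simp_all
      moreover from this have "x i * int (e' i div e i) < int (e i) * int (e' i div e i)"
        using q[of i] by (intro mult_strict_right_mono)
      ultimately show ?thesis using q[of i] eq[of i] by simp
    qed
    then show "(\<lambda>i. x i * int (e' i div e i)) \<in> carrier (invariant_group e')" by simp
  next
    fix x y
    have "((x i + y i) mod int (e i)) * int (e' i div e i) =
        (x i * int (e' i div e i) + y i * int (e' i div e i)) mod int (e' i)" for i
      by (simp only: eq mod_mult_mult2 distrib_right[symmetric])
    then show "(\<lambda>i. (x \<otimes>\<^bsub>invariant_group e\<^esub> y) i * int (e' i div e i)) =
        (\<lambda>i. x i * int (e' i div e i)) \<otimes>\<^bsub>invariant_group e'\<^esub> (\<lambda>i. y i * int (e' i div e i))"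
      by simp
  next
    fix x y :: "nat \<Rightarrow> int" assume "(\<lambda>i. x i * int (e' i div e i)) = (\<lambda>i. y i * int (e' i div e i))"
    then have xy: "x i * int (e' i div e i) = y i * int (e' i div e i)" for i by (rule fun_cong)
    show "x = y"
    proof
      show "x i = y i" for i using xy[of i] q[of i] by (metis mult_cancel_right less_irrefl)
    qed
  qed
qed

text \<open>The elements that are (q div p)-th powers of elements killed by q; for a power q of a prime p
  they form an elementary abelian p-group whose rank counts the invariant factors divisible by q.\<close>

definition socle_part :: "nat \<Rightarrow> nat \<Rightarrow> ('a, 'b) monoid_scheme \<Rightarrow> 'a set" where
  "socle_part p q G = {x [^]\<^bsub>G\<^esub> (q div p) | x. x \<in> carrier G \<and> x [^]\<^bsub>G\<^esub> q = \<one>\<^bsub>G\<^esub>}"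

lemma card_socle_part_mono:
  assumes f: "f \<in> mon G H" and G: "group G" and H: "group H" and fin: "finite (carrier H)"
  shows "card (socle_part p q G) \<le> card (socle_part p q H)"
proof (rule card_inj_on_le)
  have hom: "f \<in> hom G H" and inj: "inj_on f (carrier G)" using f by (auto simp: mon_def)
  interpret G: group G by fact
  interpret H: group H by fact
  interpret f: group_hom G H f by unfold_locales (rule hom)
  have sub: "socle_part p q G \<subseteq> carrier G" "socle_part p q H \<subseteq> carrier H" by (auto simp: socle_part_def)
  show "inj_on f (socle_part p q G)" using inj sub(1) by (rule inj_on_subset)
  show "f ` socle_part p q G \<subseteq> socle_part p q H"
  proof (rule image_subsetI)
    fix y assume "y \<in> socle_part p q G"
    then obtain x where x: "y = x [^]\<^bsub>G\<^esub> (q div p)" "x \<in> carrier G" "x [^]\<^bsub>G\<^esub> q = \<one>\<^bsub>G\<^esub>"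
      by (auto simp: socle_part_def)
    have "f y = f x [^]\<^bsub>H\<^esub> (q div p)" using x by (simp add: f.hom_nat_pow)
    moreover have "f x [^]\<^bsub>H\<^esub> q = \<one>\<^bsub>H\<^esub>" using x by (simp flip: f.hom_nat_pow)
    moreover have "f x \<in> carrier H" using x by simp
    ultimately show "f y \<in> socle_part p q H" unfolding socle_part_def by blast
  qed
  show "finite (socle_part p q H)" using sub(2) fin by (rule finite_subset)
qed

text \<open>In each of the coordinates 0, ..., i the p multiples of \<open>e l div p\<close> occur:
  they are (q div p)-th powers of multiples of \<open>e l div q\<close>, which q kills.\<close>

lemma card_socle_part_ge:
  assumes e: "divisor_chain e" and p: "p > 1" and q: "p dvd q" "q > 0" "q dvd e i"
  shows "p ^ Suc i \<le> card (socle_part p q (invariant_group e))"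
proof -
  let ?G = "invariant_group e"
  define y :: "(nat \<Rightarrow> nat) \<Rightarrow> nat \<Rightarrow> int" where "y t l = (if l \<le> i then int (t l * (e l div p)) else 0)" for t l
  have epos: "e l > 0" for l using e by (simp add: divisor_chain_def)
  have qe: "q dvd e l" if "l \<le> i" for l
    using divisor_chain_dvd[OF e that] q(3) by (rule dvd_trans[rotated])
  have "y ` PiE {..i} (\<lambda>_. {..<p}) \<subseteq> socle_part p q ?G"
  proof (rule image_subsetI)
    fix t assume t: "t \<in> PiE {..i} (\<lambda>_. {..<p})"
    define x :: "nat \<Rightarrow> int" where "x l = (if l \<le> i then int (t l * (e l div q)) else 0)" for l
    have x: "0 \<le> x l \<and> x l < int (e l)" for l
    proof (cases "l \<le> i")
      case True
      have "t l < p" using t True by (auto simp: PiE_iff)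
      also have "p \<le> q" using q by (simp add: dvd_imp_le)
      finally have "t l < q" .
      moreover have "e l div q > 0" using qe[OF True] epos[of l] by (auto elim!: dvdE)
      ultimately have "t l * (e l div q) < q * (e l div q)" by simp
      also have "\<dots> = e l" using qe[OF True] by simp
      finally show ?thesis using True by (simp only: x_def if_True of_nat_less_iff of_nat_0_le_iff)
    qed (use epos in \<open>simp add: x_def\<close>)
    have 1: "(int q * x l) mod int (e l) = 0" for l
    proof (cases "l \<le> i")
      case True
      then have "int q * x l = int (t l) * int (e l)"
        using qe[OF True] by (simp add: x_def mult_ac flip: of_nat_mult)
      then show ?thesis by simp
    qed (simp add: x_def)
    have 2: "(int (q div p) * x l) mod int (e l) = y t l" for l
    proof (cases "l \<le> i")
      case True
      obtain m where m: "e l = q * m" using qe[OF True] by blast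
      obtain q' where q': "q = p * q'" using q(1) by blast
      have "int (q div p) * x l = y t l"
        using True m q' p q(2) by (simp add: x_def y_def mult_ac)
      moreover have "0 \<le> y t l" by (simp add: y_def)
      moreover have "y t l < int (e l)"
      proof -
        have "t l < p" using t True by (auto simp: PiE_iff)
        moreover have "e l div p > 0" using m q' epos[of l] p by auto
        ultimately have "t l * (e l div p) < p * (e l div p)" by simp
        also have "\<dots> = e l" using m q' by simp
        finally show ?thesis using True by (simp only: y_def if_True of_nat_less_iff)
      qed
      ultimately show ?thesis by simp
    qed (simp add: x_def y_def)
    have "y t = x [^]\<^bsub>?G\<^esub> (q div p)" "x [^]\<^bsub>?G\<^esub> q = \<one>\<^bsub>?G\<^esub>"
      using 1 2 by (simp_all add: pow_invariant_group fun_eq_iff)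
    moreover have "x \<in> carrier ?G" using x by simp
    ultimately show "y t \<in> socle_part p q ?G" unfolding socle_part_def by blast
  qed
  moreover have "inj_on y (PiE {..i} (\<lambda>_. {..<p}))"
  proof (rule inj_onI)
    fix t t' assume t: "t \<in> PiE {..i} (\<lambda>_. {..<p})" "t' \<in> PiE {..i} (\<lambda>_. {..<p})" "y t = y t'"
    show "t = t'"
    proof (rule PiE_ext[OF t(1,2)])
      fix l assume "l \<in> {..i}"
      then have l: "l \<le> i" by simp
      have "e l div p > 0" using qe[OF l] q(1) epos[of l] p by (auto elim!: dvdE)
      moreover have "t l * (e l div p) = t' l * (e l div p)"
        using fun_cong[OF t(3), of l] l by (simp only: y_def if_True of_nat_eq_iff)
      ultimately show "t l = t' l" by simp
    qed
  qed
  moreover have "finite (socle_part p q ?G)"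
  proof (rule finite_subset[OF _ finite_carrier_invariant_group[OF e]])
    interpret group ?G by (rule group_invariant_group[OF epos])
    show "socle_part p q ?G \<subseteq> carrier ?G" unfolding socle_part_def by blast
  qed
  ultimately have "card (PiE {..i} (\<lambda>_. {..<p})) \<le> card (socle_part p q ?G)"
    by (intro card_inj_on_le)
  then show ?thesis by (simp add: card_PiE)
qed

text \<open>Coordinates from i on vanish because \<open>p ^ a\<close> does not divide their moduli;
  each of the i earlier ones is killed by p and so has at most p values.\<close>

lemma card_socle_part_le:
  assumes e: "divisor_chain e" and p: "prime p" and a: "a > 0" and nd: "\<not> p ^ a dvd e i"
  shows "card (socle_part p (p ^ a) (invariant_group e)) \<le> p ^ i"
proof -
  let ?G = "invariant_group e"
  have epos: "e l > 0" for l using e by (simp add: divisor_chain_def)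
  have p0: "p > 0" using p prime_gt_0_nat by blast
  define V where "V l = {v \<in> {0..<int (e l)}. int (e l) dvd int p * v}" for l
  have cV: "card (V l) \<le> p" for l
  proof -
    have "card (V l) \<le> card {0..<int p}"
    proof (rule card_inj_on_le)
      show "inj_on (\<lambda>v. int p * v div int (e l)) (V l)"
      proof (rule inj_onI)
        fix v w assume "v \<in> V l" "w \<in> V l" "int p * v div int (e l) = int p * w div int (e l)"
        then have "int p * v = int p * w" unfolding V_def by (metis (no_types, lifting) dvd_mult_div_cancel mem_Collect_eq)
        then show "v = w" using p0 by simp
      qed
      show "(\<lambda>v. int p * v div int (e l)) ` V l \<subseteq> {0..<int p}"
      proof (rule image_subsetI)
        fix v assume "v \<in> V l"
        then have v: "0 \<le> v" "v < int (e l)" "int (e l) dvd int p * v" by (auto simp: V_def)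
        obtain k where k: "int p * v = int (e l) * k" using v(3) by blast
        have "int p * v < int p * int (e l)" using v p0 by simp
        then have "int (e l) * k < int (e l) * int p" unfolding k by (simp only: mult.commute)
        then have "k < int p" using epos[of l] by (simp only: mult_less_cancel_left_pos of_nat_0_less_iff)
        moreover have "0 \<le> int (e l) * k" unfolding k[symmetric] using v(1) by simp
        then have "0 \<le> k" using epos[of l] by (simp add: zero_le_mult_iff)
        ultimately show "int p * v div int (e l) \<in> {0..<int p}" using epos[of l] by (simp add: k)
      qed
    qed simp
    then show ?thesis by simp
  qed
  have finV: "finite (V l)" for l by (rule finite_subset[of _ "{0..<int (e l)}"]) (auto simp: V_def)
  have y: "y \<in> (\<lambda>y. y) ` socle_part p (p ^ a) ?G \<Longrightarrow> y l \<in> V l \<and> (i \<le> l \<longrightarrow> y l = 0)" for y l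
  proof -
    assume "y \<in> (\<lambda>y. y) ` socle_part p (p ^ a) ?G"
    then obtain x where x: "y = x [^]\<^bsub>?G\<^esub> (p ^ a div p)" "x [^]\<^bsub>?G\<^esub> (p ^ a) = \<one>\<^bsub>?G\<^esub>"
      by (auto simp: socle_part_def)
    obtain b where b: "a = Suc b" using a by (cases a) auto
    have yl: "y l = (int (p ^ b) * x l) mod int (e l)"
      using x(1) b p0 by (simp add: pow_invariant_group)
    have "(int (p ^ a) * x l) mod int (e l) = 0"
      using fun_cong[OF x(2), of l] by (simp add: pow_invariant_group)
    then have d: "int (e l) dvd int (p ^ a) * x l" by (simp add: dvd_eq_mod_eq_0)
    have "int (e l) dvd int p * y l"
    proof -
      have "int p * (int (p ^ b) * x l) mod int (e l) = 0" using d b by (simp add: mult_ac dvd_eq_mod_eq_0)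
      then have "(int p * y l) mod int (e l) = 0" unfolding yl by (simp add: mod_mult_right_eq)
      then show ?thesis by (simp add: dvd_eq_mod_eq_0)
    qed
    then have V: "y l \<in> V l" using epos[of l] by (simp add: V_def yl)
    moreover have "y l = 0" if "i \<le> l"
    proof -
      have "\<not> p ^ a dvd e l" using nd divisor_chain_dvd[OF e that] dvd_trans by blast
      moreover have "gcd (p ^ a) (e l) dvd p ^ a" "gcd (p ^ a) (e l) dvd e l" by simp_all
      \<comment> \<open>The gcd is a power p^c with c < a. So if \<open>e l\<close> divides p^a
        times \<open>x l\<close>, it already divides p^c times \<open>x l\<close>, and thus p^b
        times \<open>x l\<close>, since a = b + 1.\<close>
      ultimately obtain c where c: "c \<le> a" "gcd (p ^ a) (e l) = p ^ c"
        using divides_primepow_nat[OF p] by blast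
      have "c \<noteq> a"
        using \<open>\<not> p ^ a dvd e l\<close> \<open>gcd (p ^ a) (e l) dvd e l\<close> c(2) by auto
      then have "p ^ c dvd p ^ b" using c(1) b by (intro le_imp_power_dvd) simp
      have "int (e l) dvd gcd (int (p ^ a) * x l) (int (e l) * x l)" using d by simp
      also have "gcd (int (p ^ a) * x l) (int (e l) * x l) = gcd (int (p ^ a)) (int (e l)) * \<bar>x l\<bar>"
        by (simp only: gcd_mult_right) (simp add: abs_mult gcd.commute)
      also have "\<dots> = int (p ^ c) * \<bar>x l\<bar>" by (simp only: gcd_int_int_eq c(2))
      also have "\<dots> dvd int (p ^ b) * x l"
        using \<open>p ^ c dvd p ^ b\<close> by (intro mult_dvd_mono) (simp_all only: of_nat_dvd_iff abs_dvd_iff dvd_refl)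
      finally show ?thesis unfolding yl by (simp add: dvd_eq_mod_eq_0)
    qed
    ultimately show ?thesis by blast
  qed
  have "card (socle_part p (p ^ a) ?G) \<le> card (PiE {..<i} V)"
  proof (rule card_inj_on_le)
    show "inj_on (\<lambda>y. restrict y {..<i}) (socle_part p (p ^ a) ?G)"
    proof (rule inj_onI, rule ext)
      fix u v l assume u: "u \<in> socle_part p (p ^ a) ?G" "v \<in> socle_part p (p ^ a) ?G"
        "restrict u {..<i} = restrict v {..<i}"
      show "u l = v l"
      proof (cases "l < i")
        case True
        then show ?thesis using fun_cong[OF u(3), of l] by simp
      next
        case False
        then show ?thesis using y[of u l] y[of v l] u(1,2) by simp
      qed
    qed
    show "(\<lambda>y. restrict y {..<i}) ` socle_part p (p ^ a) ?G \<subseteq> PiE {..<i} V"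
      using y by (intro image_subsetI restrict_PiE_iff[THEN iffD2] ballI) simp
    show "finite (PiE {..<i} V)" using finV by (intro finite_PiE) auto
  qed
  also have "\<dots> = (\<Prod>l<i. card (V l))" by (simp add: card_PiE)
  also have "\<dots> \<le> (\<Prod>l<i. p)" using cV by (intro prod_mono) auto
  finally show ?thesis by simp
qed

text \<open>If divisibility failed at i, some prime power would divide \<open>e i\<close> but not
  \<open>e' i\<close>; the corresponding socle parts would have at least p^(i+1) and at most p^i
  elements, although the first embeds in the second.\<close>

lemma mon_invariant_group_dvd:
  assumes e: "divisor_chain e" and e': "divisor_chain e'" and f: "f \<in> mon (invariant_group e) (invariant_group e')"
  shows "e i dvd e' i"
proof (rule ccontr)
  assume nd: "\<not> e i dvd e' i"
  have pos: "e i > 0" "e' i > 0" for i using e e' by (simp_all add: divisor_chain_def)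
  obtain p where p: "prime p" "multiplicity p (e i) > multiplicity p (e' i)"
    using multiplicity_le_imp_dvd[of "e i" "e' i"] nd pos[of i] by (metis not_le zero_less_iff_neq_zero)
  let ?a = "multiplicity p (e i)"
  have a: "?a > 0" using p(2) by simp
  have "\<not> p ^ ?a dvd e' i"
    using p pos[of i] by (subst power_dvd_iff_le_multiplicity) (auto simp: prime_gt_Suc_0_nat not_le)
  then have "card (socle_part p (p ^ ?a) (invariant_group e')) \<le> p ^ i"
    by (rule card_socle_part_le[OF e' p(1) a])
  moreover have "p ^ Suc i \<le> card (socle_part p (p ^ ?a) (invariant_group e))"
    using p(1) a prime_gt_1_nat[OF p(1)] by (intro card_socle_part_ge[OF e]) (auto simp: multiplicity_dvd)
  moreover have "card (socle_part p (p ^ ?a) (invariant_group e)) \<le> card (socle_part p (p ^ ?a) (invariant_group e'))"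
    by (rule card_socle_part_mono[OF f group_invariant_group group_invariant_group finite_carrier_invariant_group[OF e']])
       (use pos in auto)
  ultimately have "p ^ Suc i \<le> p ^ i" by linarith
  then show False using prime_gt_1_nat[OF p(1)] by simp
qed

section \<open>Isomorphism classes and chains of invariant factors\<close>

lemma iso_imp_iso_class_eq:
  assumes "G \<cong> H" "group G"
  shows "iso_class G = iso_class H"
proof -
  have "H \<cong> G" by (rule group.iso_sym[OF assms(2,1)])
  then show ?thesis using assms(1) unfolding iso_class_def by (blast intro: iso_trans)
qed

lemma mem_iso_class: "G \<in> finite_abelian \<Longrightarrow> G \<in> iso_class G"
  using iso_set_refl unfolding iso_class_def is_iso_def by blast

text \<open>Classes consist of groups on \<open>nat\<close>, whereas standard groups and direct sums
  live on function types; their structure is transported along an injection of the carrier.\<close>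

lemma ex_nat_group:
  fixes G :: "'a monoid"
  assumes "comm_group G" "finite (carrier G)"
  obtains H where "H \<in> finite_abelian" "G \<cong> H"
proof -
  interpret comm_group G by fact
  obtain h :: "'a \<Rightarrow> nat" where inj: "inj_on h (carrier G)"
    using finite_imp_inj_to_nat_seg[OF assms(2)] by blast
  define k where "k = inv_into (carrier G) h"
  have kh: "k (h x) = x" if "x \<in> carrier G" for x
    unfolding k_def by (rule inv_into_f_f[OF inj that])
  define H :: "nat monoid" where
    "H = \<lparr>carrier = h ` carrier G, monoid.mult = (\<lambda>a b. h (k a \<otimes>\<^bsub>G\<^esub> k b)), one = h \<one>\<^bsub>G\<^esub>\<rparr>"
  have "h \<in> iso G H"
    using inj by (intro isoI homI) (auto simp: H_def kh bij_betw_def)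
  then have iso: "G \<cong> H" by (rule is_isoI)
  have "monoid H" by (rule monoidI) (auto simp: H_def kh m_assoc)
  then have "comm_group H" using iso by (intro iso_imp_comm_group)
  moreover have "finite (carrier H)" using assms(2) by (simp add: H_def)
  ultimately show thesis using that[of H] iso by (simp add: finite_abelian_def)
qed

definition invariant_class :: "(nat \<Rightarrow> nat) \<Rightarrow> nat monoid set" where
  "invariant_class e = iso_class (invariant_group e)"

lemma divisor_chain_pos: "divisor_chain e \<Longrightarrow> e i > 0"
  by (simp add: divisor_chain_def)

lemma group_chain: "divisor_chain e \<Longrightarrow> group (invariant_group e)"
  by (rule group_invariant_group[OF divisor_chain_pos])

lemma mem_invariant_class:
  assumes "divisor_chain e" "G \<in> invariant_class e"
  shows "G \<in> finite_abelian" "comm_group G" "group G" "G \<cong> invariant_group e" "invariant_group e \<cong> G"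
    "Coset.order G = prod e {i. e i \<noteq> 1}"
proof -
  show "G \<in> finite_abelian" and iso: "G \<cong> invariant_group e"
    using assms(2) by (auto simp: invariant_class_def iso_class_def)
  then show "comm_group G" by (simp add: finite_abelian_def)
  then show "group G" by (rule comm_group.axioms(2))
  then show "invariant_group e \<cong> G" using iso by (rule group.iso_sym)
  show "Coset.order G = prod e {i. e i \<noteq> 1}"
    using iso_same_card[OF iso] order_invariant_group[OF assms(1)] by (simp add: Coset.order_def)
qed

lemma invariant_class_nonempty:
  assumes "divisor_chain e"
  obtains G where "G \<in> invariant_class e"
proof -
  obtain H where H: "H \<in> finite_abelian" "invariant_group e \<cong> H"
    by (rule ex_nat_group[OF comm_group_invariant_group[OF divisor_chain_pos[OF assms]] finite_carrier_invariant_group[OF assms]])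
  have "H \<cong> invariant_group e" by (rule group.iso_sym[OF group_chain[OF assms] H(2)])
  then show thesis using that H(1) by (simp add: invariant_class_def iso_class_def)
qed

lemma invariant_class_eq_iso_class:
  assumes "divisor_chain e" "G \<in> invariant_class e"
  shows "invariant_class e = iso_class G"
  unfolding invariant_class_def by (rule iso_imp_iso_class_eq[OF mem_invariant_class(5)[OF assms] group_chain[OF assms(1)]])

lemma invariant_class_in_abelian_classes:
  assumes "divisor_chain e"
  shows "invariant_class e \<in> abelian_classes"
proof -
  obtain G where "G \<in> invariant_class e" by (rule invariant_class_nonempty[OF assms])
  then show ?thesis
    using invariant_class_eq_iso_class[OF assms] mem_invariant_class(1)[OF assms] by (auto simp: abelian_classes_def)
qed

lemma iso_class_eq_invariant_class:
  assumes "G \<in> finite_abelian"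
  obtains e where "divisor_chain e" "iso_class G = invariant_class e"
proof -
  have "comm_group G" "finite (carrier G)" using assms by (simp_all add: finite_abelian_def)
  then obtain e where e: "divisor_chain e" "invariant_group e \<cong> G" using ex_invariant_group by blast
  have "invariant_class e = iso_class G"
    unfolding invariant_class_def by (rule iso_imp_iso_class_eq[OF e(2) group_chain[OF e(1)]])
  then show thesis using that e(1) by simp
qed

lemma iso_imp_mon: "G \<cong> H \<Longrightarrow> \<exists>f. f \<in> mon G H"
  by (auto simp: is_iso_def iso_iff_mon_epi)

text \<open>Containment amounts to a monomorphism between standard groups: an isomorphism onto a
  subgroup gives one, and conversely its image is the required subgroup.\<close>

lemma class_contains_iff:
  assumes e: "divisor_chain e" and e': "divisor_chain e'"
  shows "class_contains (invariant_class e) (invariant_class e') \<longleftrightarrow> (\<forall>i. e' i dvd e i)"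
proof
  assume "class_contains (invariant_class e) (invariant_class e')"
  then obtain G H K where G: "G \<in> invariant_class e" and H: "H \<in> invariant_class e'" and K: "subgroup K G"
    and iso: "H \<cong> G\<lparr>carrier := K\<rparr>" unfolding class_contains_def by blast
  obtain f where f: "f \<in> mon (invariant_group e') H" using iso_imp_mon mem_invariant_class(5)[OF e' H] by blast
  obtain g where g: "g \<in> mon H (G\<lparr>carrier := K\<rparr>)" using iso_imp_mon[OF iso] by blast
  obtain h where h: "h \<in> mon G (invariant_group e)" using iso_imp_mon mem_invariant_class(4)[OF e G] by blast
  have "g \<in> mon H G"
    using g subgroup.subset[OF K] by (auto simp: mon_def hom_def)
  then have "h \<circ> (g \<circ> f) \<in> mon (invariant_group e') (invariant_group e)"
    by (intro mon_compose[OF mon_compose[OF f] h])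
  then show "\<forall>i. e' i dvd e i" using mon_invariant_group_dvd[OF e' e] by blast
next
  assume dvd: "\<forall>i. e' i dvd e i"
  obtain G where G: "G \<in> invariant_class e" by (rule invariant_class_nonempty[OF e])
  obtain H where H: "H \<in> invariant_class e'" by (rule invariant_class_nonempty[OF e'])
  obtain f where f: "f \<in> mon H (invariant_group e')" using iso_imp_mon mem_invariant_class(4)[OF e' H] by blast
  obtain h where h: "h \<in> mon (invariant_group e) G" using iso_imp_mon mem_invariant_class(5)[OF e G] by blast
  have "(\<lambda>x i. x i * int (e i div e' i)) \<in> mon (invariant_group e') (invariant_group e)"
    by (rule invariant_group_mon) (use dvd divisor_chain_pos[OF e] divisor_chain_pos[OF e'] in auto)
  then obtain k where k: "k \<in> mon H G" using mon_compose[OF mon_compose[OF f] h] by blast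
  then have hom: "k \<in> hom H G" and inj: "inj_on k (carrier H)" by (auto simp: mon_def)
  interpret group_hom H G k
    using mem_invariant_class(3)[OF e G] mem_invariant_class(3)[OF e' H] hom
    by (simp add: group_hom_def group_hom_axioms_def)
  have "k \<in> iso H (G\<lparr>carrier := k ` carrier H\<rparr>)"
    using inj by (auto simp: iso_def hom_def bij_betw_def)
  then have "H \<cong> G\<lparr>carrier := k ` carrier H\<rparr>" by (rule is_isoI)
  then show "class_contains (invariant_class e) (invariant_class e')"
    unfolding class_contains_def using G H img_is_subgroup by blast
qed

text \<open>Uniqueness of invariant factors comes from the embedding criterion: equal classes
  contain each other, and divisibility is antisymmetric.\<close>

lemma invariant_class_inj:
  assumes e: "divisor_chain e" and e': "divisor_chain e'" and eq: "invariant_class e = invariant_class e'"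
  shows "e = e'"
proof -
  have "class_contains (invariant_class e) (invariant_class e)" "class_contains (invariant_class e') (invariant_class e')"
    using class_contains_iff[OF e e] class_contains_iff[OF e' e'] by simp_all
  then have "\<forall>i. e' i dvd e i" "\<forall>i. e i dvd e' i"
    using class_contains_iff[OF e e'] class_contains_iff[OF e' e] eq by simp_all
  then show ?thesis by (auto intro: dvd_antisym)
qed

lemma chain_eq_1: "divisor_chain e \<Longrightarrow> e 0 = 1 \<Longrightarrow> e i = 1"
  using divisor_chain_dvd[of e 0 i] by simp

lemma nontrivial_class_iff:
  assumes e: "divisor_chain e"
  shows "nontrivial_class (invariant_class e) \<longleftrightarrow> e 0 \<noteq> 1"
proof -
  have triv: "trivial_group G \<longleftrightarrow> e 0 = 1" if G: "G \<in> invariant_class e" for G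
  proof -
    interpret group G by (rule mem_invariant_class(3)[OF e G])
    have "trivial_group G \<longleftrightarrow> card (carrier G) = 1"
    proof
      assume "card (carrier G) = 1"
      then obtain x where "carrier G = {x}" by (rule card_1_singletonE)
      then show "trivial_group G" using one_closed by (simp add: trivial_group_def is_group)
    qed (simp add: trivial_group_def)
    also have "\<dots> \<longleftrightarrow> prod e {i. e i \<noteq> 1} = 1"
      using mem_invariant_class(6)[OF e G] by (simp add: Coset.order_def)
    also have "\<dots> \<longleftrightarrow> e 0 = 1"
    proof
      assume 1: "prod e {i. e i \<noteq> 1} = 1"
      show "e 0 = 1"
      proof (rule ccontr)
        assume "e 0 \<noteq> 1"
        then have "e 0 dvd prod e {i. e i \<noteq> 1}"
          using e by (intro dvd_prodI) (auto simp: divisor_chain_def)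
        then show False using 1 \<open>e 0 \<noteq> 1\<close> by simp
      qed
    next
      assume "e 0 = 1"
      then have "{i. e i \<noteq> 1} = {}" using chain_eq_1[OF e] by blast
      then show "prod e {i. e i \<noteq> 1} = 1" by simp
    qed
    finally show ?thesis .
  qed
  obtain G where "G \<in> invariant_class e" by (rule invariant_class_nonempty[OF e])
  then show ?thesis using triv unfolding nontrivial_class_def by blast
qed

lemma comm_group_sum_group:
  assumes "\<And>i. i \<in> I \<Longrightarrow> comm_group (G i)"
  shows "comm_group (sum_group I G)"
proof (rule group.group_comm_groupI)
  have gr: "group (G i)" if "i \<in> I" for i using comm_group.axioms(2)[OF assms[OF that]] .
  then show "group (sum_group I G)" by simp
  fix x y assume "x \<in> carrier (sum_group I G)" "y \<in> carrier (sum_group I G)"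
  then have "x i \<in> carrier (G i)" "y i \<in> carrier (G i)" if "i \<in> I" for i
    using that by (auto simp: carrier_sum_group[OF gr] PiE_iff)
  then show "x \<otimes>\<^bsub>sum_group I G\<^esub> y = y \<otimes>\<^bsub>sum_group I G\<^esub> x"
    using comm_monoid.m_comm[OF comm_group.axioms(1)[OF assms]] by (auto intro!: restrict_ext)
qed

text \<open>Only finitely many summands matter, which reduces finiteness and order of the infinite
  direct sum to a finite product.\<close>

lemma bij_carrier_sum_group:
  assumes gr: "\<And>i. group (G i)" and N: "finite N" and triv: "\<And>i. i \<notin> N \<Longrightarrow> carrier (G i) = {\<one>\<^bsub>G i\<^esub>}"
  shows "bij_betw (\<lambda>x. restrict x N) (carrier (sum_group UNIV G)) (PiE N (\<lambda>i. carrier (G i)))"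
proof (rule bij_betwI[where g = "\<lambda>x i. if i \<in> N then x i else \<one>\<^bsub>G i\<^esub>"])
  note carrier = carrier_sum_group[of UNIV G, OF gr]
  show "(\<lambda>x. restrict x N) \<in> carrier (sum_group UNIV G) \<rightarrow> PiE N (\<lambda>i. carrier (G i))"
    by (auto simp: carrier PiE_iff)
  show "(\<lambda>x i. if i \<in> N then x i else \<one>\<^bsub>G i\<^esub>) \<in> PiE N (\<lambda>i. carrier (G i)) \<rightarrow> carrier (sum_group UNIV G)"
  proof (rule funcsetI)
    fix x assume x: "x \<in> PiE N (\<lambda>i. carrier (G i))"
    have "finite {i. (if i \<in> N then x i else \<one>\<^bsub>G i\<^esub>) \<noteq> \<one>\<^bsub>G i\<^esub>}"
      by (rule finite_subset[OF _ N]) auto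
    moreover have "(if i \<in> N then x i else \<one>\<^bsub>G i\<^esub>) \<in> carrier (G i)" for i
      using x monoid.one_closed[OF group.is_monoid[OF gr]] by (auto simp: PiE_iff)
    ultimately show "(\<lambda>i. if i \<in> N then x i else \<one>\<^bsub>G i\<^esub>) \<in> carrier (sum_group UNIV G)"
      unfolding carrier PiE_iff extensional_def by simp
  qed
  show "(\<lambda>i. if i \<in> N then restrict x N i else \<one>\<^bsub>G i\<^esub>) = x" if x: "x \<in> carrier (sum_group UNIV G)" for x
  proof
    fix i
    have "x i \<in> carrier (G i)" using x by (simp add: carrier PiE_iff)
    then show "(if i \<in> N then restrict x N i else \<one>\<^bsub>G i\<^esub>) = x i" using triv[of i] by auto
  qed
  show "restrict (\<lambda>i. if i \<in> N then x i else \<one>\<^bsub>G i\<^esub>) N = x" if "x \<in> PiE N (\<lambda>i. carrier (G i))" for x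
    using that by (auto simp: fun_eq_iff PiE_iff extensional_def)
qed

section \<open>Group-partitions as arrays\<close>

definition array_row :: "(nat \<times> nat \<Rightarrow> nat) \<Rightarrow> nat \<Rightarrow> nat \<Rightarrow> nat" where
  "array_row E i = (\<lambda>j. E (i, j))"

definition class_array :: "(nat \<times> nat \<Rightarrow> nat) \<Rightarrow> nat \<Rightarrow> nat monoid set" where
  "class_array E i = invariant_class (array_row E i)"

text \<open>Any choice of representatives gives the same class; see \<open>sum_group_props\<close> below.\<close>

definition array_sum :: "(nat \<times> nat \<Rightarrow> nat) \<Rightarrow> nat monoid set" where
  "array_sum E = iso_class (sum_group UNIV (\<lambda>i. SOME G. G \<in> class_array E i))"

text \<open>Divisibility down the columns is kept out of the locale: it is the counterpart of the
  containment of successive groups and is matched with it in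
  \<open>group_partition_iff\<close>.\<close>

locale finite_array =
  fixes E :: "nat \<times> nat \<Rightarrow> nat"
  assumes chain: "\<And>i. divisor_chain (array_row E i)" and finite_rows: "finite {i. E (i, 0) \<noteq> 1}"
begin

lemma sum_group_props:
  assumes G: "\<And>i. G i \<in> class_array E i"
  shows "comm_group (sum_group UNIV G)" "finite (carrier (sum_group UNIV G))"
    "Coset.order (sum_group UNIV G) = prod E {c. E c \<noteq> 1}" "iso_class (sum_group UNIV G) = array_sum E"
proof -
  let ?N = "{i. E (i, 0) \<noteq> 1}"
  have G': "G i \<in> invariant_class (array_row E i)" for i using G by (simp add: class_array_def)
  note mem = mem_invariant_class[OF chain G']
  show "comm_group (sum_group UNIV G)" by (rule comm_group_sum_group[OF mem(2)])
  have triv: "carrier (G i) = {\<one>\<^bsub>G i\<^esub>}" if "i \<notin> ?N" for i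
  proof -
    have "\<not> nontrivial_class (invariant_class (array_row E i))"
      using that nontrivial_class_iff[OF chain] by (simp add: array_row_def)
    then show ?thesis using G' unfolding nontrivial_class_def trivial_group_def by blast
  qed
  note bij = bij_carrier_sum_group[OF mem(3) finite_rows triv]
  have finG: "finite (carrier (G i))" for i using mem(1)[of i] by (simp add: finite_abelian_def)
  show "finite (carrier (sum_group UNIV G))"
    using bij_betw_finite[OF bij] finite_rows finG by (simp add: finite_PiE)
  have fin: "finite {j. E (i, j) \<noteq> 1}" for i
    using chain[of i] by (simp add: divisor_chain_def array_row_def)
  have supp: "{c. E c \<noteq> 1} = Sigma ?N (\<lambda>i. {j. E (i, j) \<noteq> 1})"
    using chain_eq_1[OF chain] by (auto simp: array_row_def)
  have "Coset.order (sum_group UNIV G) = (\<Prod>i\<in>?N. card (carrier (G i)))"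
    using bij_betw_same_card[OF bij] finite_rows by (simp add: Coset.order_def card_PiE)
  also have "\<dots> = (\<Prod>i\<in>?N. \<Prod>j\<in>{j. E (i, j) \<noteq> 1}. E (i, j))"
    using mem(6) by (simp add: Coset.order_def array_row_def)
  also have "\<dots> = prod E {c. E c \<noteq> 1}"
    unfolding supp using finite_rows fin by (subst prod.Sigma) (auto simp: case_prod_unfold)
  finally show "Coset.order (sum_group UNIV G) = prod E {c. E c \<noteq> 1}" .
  have S: "(SOME G. G \<in> class_array E i) \<in> invariant_class (array_row E i)" for i
    unfolding class_array_def by (rule someI[of "\<lambda>G. G \<in> invariant_class (array_row E i)", OF G'])
  have "G i \<cong> (SOME G. G \<in> class_array E i)" for i
    by (rule iso_trans[OF mem(4) mem_invariant_class(5)[OF chain S]])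
  then have "sum_group UNIV G \<cong> sum_group UNIV (\<lambda>i. SOME G. G \<in> class_array E i)"
    by (intro iso_sum_groupI mem(3) mem_invariant_class(3)[OF chain S])
  then show "iso_class (sum_group UNIV G) = array_sum E"
    unfolding array_sum_def by (rule iso_imp_iso_class_eq) (simp add: mem(3))
qed

lemma ex_representatives: obtains G where "\<And>i. G i \<in> class_array E i"
proof -
  have "\<exists>G. G \<in> class_array E i" for i
    unfolding class_array_def by (rule invariant_class_nonempty[OF chain]) blast
  then show thesis using that by metis
qed

lemma is_direct_sum_iff: "is_direct_sum C (class_array E) \<longleftrightarrow> C = array_sum E"
proof -
  obtain G where G: "\<And>i. G i \<in> class_array E i" using ex_representatives by blast
  then show ?thesis using sum_group_props(4) unfolding is_direct_sum_def by metis
qed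

lemma array_sum_of_order: "array_sum E \<in> abelian_classes_of_order n \<longleftrightarrow> prod E {c. E c \<noteq> 1} = n"
proof -
  obtain G where G: "\<And>i. G i \<in> class_array E i" using ex_representatives by blast
  note props = sum_group_props[OF G]
  obtain H where H: "H \<in> finite_abelian" "sum_group UNIV G \<cong> H" by (rule ex_nat_group[OF props(1,2)])
  have eq: "iso_class H = array_sum E"
    using iso_imp_iso_class_eq[OF H(2) comm_group.axioms(2)[OF props(1)]] props(4) by simp
  have oH: "Coset.order H = prod E {c. E c \<noteq> 1}"
    using iso_same_card[OF H(2)] props(3) by (simp add: Coset.order_def)
  show ?thesis
  proof
    assume "prod E {c. E c \<noteq> 1} = n"
    then show "array_sum E \<in> abelian_classes_of_order n"
      using H(1) eq oH unfolding abelian_classes_of_order_def by blast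
  next
    assume "array_sum E \<in> abelian_classes_of_order n"
    then obtain K where K: "K \<in> finite_abelian" "Coset.order K = n" "iso_class K = array_sum E"
      unfolding abelian_classes_of_order_def by blast
    have "K \<in> iso_class H" using mem_iso_class[OF K(1)] K(3) eq by simp
    then have "K \<cong> H" by (simp add: iso_class_def)
    then show "prod E {c. E c \<noteq> 1} = n"
      using iso_same_card[of K H] K(2) oH by (simp add: Coset.order_def)
  qed
qed

lemma group_partition_iff:
  "group_partition C (class_array E) \<longleftrightarrow> C = array_sum E \<and> (\<forall>i j. E (Suc i, j) dvd E (i, j))"
proof -
  have "class_contains (class_array E i) (class_array E (Suc i)) \<longleftrightarrow> (\<forall>j. E (Suc i, j) dvd E (i, j))" for i
    unfolding class_array_def by (simp add: class_contains_iff[OF chain chain]) (simp add: array_row_def)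
  moreover have "{i. nontrivial_class (class_array E i)} = {i. E (i, 0) \<noteq> 1}"
    unfolding class_array_def by (simp add: nontrivial_class_iff[OF chain]) (simp add: array_row_def)
  moreover have "class_array E i \<in> abelian_classes" for i
    unfolding class_array_def by (rule invariant_class_in_abelian_classes[OF chain])
  ultimately show ?thesis unfolding group_partition_def using is_direct_sum_iff finite_rows by auto
qed

text \<open>Divisibility down the first column makes the nontrivial rows an initial segment, so a
  bound on their number is a bound on their indices.\<close>

lemma card_nontrivial_le_iff:
  assumes "\<And>i j. E (Suc i, j) dvd E (i, j)"
  shows "enat (card {i. nontrivial_class (class_array E i)}) \<le> r \<longleftrightarrow> (\<forall>i j. \<not> enat i < r \<longrightarrow> E (i, j) = 1)"
proof -
  let ?N = "{i. E (i, 0) \<noteq> 1}"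
  have eq: "{i. nontrivial_class (class_array E i)} = ?N"
    unfolding class_array_def by (simp add: nontrivial_class_iff[OF chain]) (simp add: array_row_def)
  have row1: "(\<forall>j. E (i, j) = 1) \<longleftrightarrow> i \<notin> ?N" for i
    using chain_eq_1[OF chain, of i] by (auto simp: array_row_def)
  show ?thesis
    unfolding eq
  proof
    assume le: "enat (card ?N) \<le> r"
    have column_dvd: "E (i, 0) dvd E (k, 0)" if "k \<le> i" for i k
      using that
    proof (induction i rule: dec_induct)
      case (step n)
      then show ?case using assms[of n 0] dvd_trans by blast
    qed simp
    have "enat i < r" if "i \<in> ?N" for i
    proof -
      have "{..i} \<subseteq> ?N"
      proof
        fix k assume "k \<in> {..i}"
        then have "E (i, 0) dvd E (k, 0)" by (intro column_dvd) simp
        then show "k \<in> ?N" using that by auto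
      qed
      then have "Suc i \<le> card ?N" using card_mono[OF finite_rows, of "{..i}"] by simp
      then have "enat (Suc i) \<le> r" using le order_trans enat_ord_simps(1) by blast
      then show ?thesis by (simp add: Suc_ile_eq)
    qed
    then show "\<forall>i j. \<not> enat i < r \<longrightarrow> E (i, j) = 1" using row1 by blast
  next
    assume "\<forall>i j. \<not> enat i < r \<longrightarrow> E (i, j) = 1"
    then have sub: "?N \<subseteq> {i. enat i < r}" by blast
    show "enat (card ?N) \<le> r"
    proof (cases r)
      case (enat q)
      then have "?N \<subseteq> {..<q}" using sub by auto
      then show ?thesis using card_mono[of "{..<q}" ?N] enat by simp
    qed simp
  qed
qed

end

lemma plane_array_finite_array:
  assumes "E \<in> plane_arrays r n"
  shows "finite_array E"
proof
  have fin: "finite {c. E c \<noteq> 1}" using assms by (simp add: plane_arrays_def)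
  show "finite {i. E (i, 0) \<noteq> 1}"
    by (rule finite_subset[OF _ finite_imageI[OF fin, of fst]]) force
  fix i
  have "finite {j. E (i, j) \<noteq> 1}"
    by (rule finite_subset[OF _ finite_imageI[OF fin, of snd]]) force
  moreover have "E c > 0" for c using assms unfolding plane_arrays_def by blast
  moreover have "E (i, Suc j) dvd E (i, j)" for i j using assms unfolding plane_arrays_def by blast
  ultimately show "divisor_chain (array_row E i)" by (simp add: divisor_chain_def array_row_def)
qed

lemma (in finite_array) plane_arrays_iff:
  "E \<in> plane_arrays r n \<longleftrightarrow> (\<forall>i j. E (Suc i, j) dvd E (i, j)) \<and>
     (\<forall>i j. \<not> enat i < r \<longrightarrow> E (i, j) = 1) \<and> prod E {c. E c \<noteq> 1} = n"
proof -
  have "E c > 0" for c using divisor_chain_pos[OF chain, of "fst c" "snd c"] by (simp add: array_row_def)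
  moreover have "E (i, Suc j) dvd E (i, j)" for i j using chain[of i] by (simp add: divisor_chain_def array_row_def)
  moreover have "{c. E c \<noteq> 1} = Sigma {i. E (i, 0) \<noteq> 1} (\<lambda>i. {j. E (i, j) \<noteq> 1})"
    using chain_eq_1[OF chain] by (auto simp: array_row_def)
  then have "finite {c. E c \<noteq> 1}"
    using finite_rows chain by (simp add: divisor_chain_def array_row_def)
  ultimately show ?thesis unfolding plane_arrays_def by blast
qed

lemma group_partition_class_array:
  assumes "group_partition C P"
  obtains E where "finite_array E" "P = class_array E"
proof -
  have "\<exists>e. divisor_chain e \<and> P i = invariant_class e" for i
  proof -
    have "P i \<in> abelian_classes" using assms by (simp add: group_partition_def)
    then obtain G where G: "G \<in> finite_abelian" "P i = iso_class G" by (auto simp: abelian_classes_def)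
    then show ?thesis using iso_class_eq_invariant_class[OF G(1)] by metis
  qed
  then obtain e where e: "\<And>i. divisor_chain (e i)" "\<And>i. P i = invariant_class (e i)" by metis
  define E where "E = (\<lambda>(i, j). e i j)"
  have array_row: "array_row E i = e i" for i by (simp add: E_def array_row_def)
  have P: "P = class_array E" using e(2) by (simp add: fun_eq_iff class_array_def array_row)
  have "{i. E (i, 0) \<noteq> 1} = {i. nontrivial_class (P i)}"
    using e by (simp add: nontrivial_class_iff E_def)
  then have "finite {i. E (i, 0) \<noteq> 1}" using assms by (simp add: group_partition_def)
  then have "finite_array E" using e(1) array_row by unfold_locales simp_all
  then show thesis using that P by blast
qed

lemma class_array_inj:
  assumes "finite_array E" "finite_array E'" "class_array E = class_array E'"
  shows "E = E'"
proof
  interpret E: finite_array E by fact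
  interpret E': finite_array E' by fact
  fix c :: "nat \<times> nat"
  have "array_row E (fst c) = array_row E' (fst c)"
    using fun_cong[OF assms(3), of "fst c"] unfolding class_array_def
    by (intro invariant_class_inj E.chain E'.chain)
  then show "E c = E' c" using fun_cong[of _ _ "snd c"] by (fastforce simp: array_row_def)
qed

definition bounded_partitions :: "enat \<Rightarrow> nat monoid set \<Rightarrow> (nat \<Rightarrow> nat monoid set) set" where
  "bounded_partitions r C = {P. group_partition C P \<and> enat (card {i. nontrivial_class (P i)}) \<le> r}"

text \<open>The class of the direct sum is determined by the sequence; it is recorded all the same
  so that the target is a disjoint union whose cardinality is the double count in
  \<open>group_partition_sum\<close>.\<close>

lemma bij_plane_arrays:
  "bij_betw (\<lambda>E. (array_sum E, class_array E)) (plane_arrays r n)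
     (Sigma (abelian_classes_of_order n) (bounded_partitions r))"
  unfolding bij_betw_def
proof (intro conjI Set.set_eqI iffI)
  show "inj_on (\<lambda>E. (array_sum E, class_array E)) (plane_arrays r n)"
    by (rule inj_onI) (use class_array_inj plane_array_finite_array in blast)
  fix x
  show "x \<in> Sigma (abelian_classes_of_order n) (bounded_partitions r)"
    if x: "x \<in> (\<lambda>E. (array_sum E, class_array E)) ` plane_arrays r n"
  proof -
    obtain E where E: "E \<in> plane_arrays r n" "x = (array_sum E, class_array E)" using x by blast
    interpret finite_array E by (rule plane_array_finite_array[OF E(1)])
    show ?thesis
      using E plane_arrays_iff group_partition_iff card_nontrivial_le_iff array_sum_of_order
      by (simp add: bounded_partitions_def)
  qed
  show "x \<in> (\<lambda>E. (array_sum E, class_array E)) ` plane_arrays r n"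
    if x: "x \<in> Sigma (abelian_classes_of_order n) (bounded_partitions r)"
  proof -
    obtain C P where CP: "x = (C, P)" "C \<in> abelian_classes_of_order n" "group_partition C P"
      "enat (card {i. nontrivial_class (P i)}) \<le> r"
      using x by (auto simp: bounded_partitions_def)
    obtain E where E: "finite_array E" "P = class_array E" by (rule group_partition_class_array[OF CP(3)])
    interpret finite_array E by fact
    have C: "C = array_sum E" and dvd: "\<And>i j. E (Suc i, j) dvd E (i, j)"
      using group_partition_iff CP(3) E(2) by auto
    have "E \<in> plane_arrays r n"
      unfolding plane_arrays_iff using dvd card_nontrivial_le_iff[OF dvd] CP(2,4) E(2) C array_sum_of_order by blast
    then show ?thesis using CP(1) C E(2) by blast
  qed
qed

text \<open>Each class is the first row of an array with a single row. Finiteness matters because a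
  sum over an infinite index set would be 0 by default.\<close>

lemma finite_abelian_classes_of_order:
  assumes "n > 0"
  shows "finite (abelian_classes_of_order n)"
proof (rule finite_subset)
  show "abelian_classes_of_order n \<subseteq> (\<lambda>E. class_array E 0) ` plane_arrays 1 n"
  proof
    fix C assume "C \<in> abelian_classes_of_order n"
    then obtain G where G: "G \<in> finite_abelian" "Coset.order G = n" "C = iso_class G"
      by (auto simp: abelian_classes_of_order_def)
    obtain e where e: "divisor_chain e" "iso_class G = invariant_class e" by (rule iso_class_eq_invariant_class[OF G(1)])
    have "G \<in> iso_class G" by (rule mem_iso_class[OF G(1)])
    then have order: "prod e {i. e i \<noteq> 1} = n" using mem_invariant_class(6)[OF e(1)] e(2) G(2) by simp
    define E :: "nat \<times> nat \<Rightarrow> nat" where "E = (\<lambda>(i, j). if i = 0 then e j else 1)"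
    have r0: "array_row E i = (if i = 0 then e else (\<lambda>_. 1))" for i by (auto simp: E_def array_row_def)
    have "divisor_chain (\<lambda>_. 1)" by (simp add: divisor_chain_def)
    then have "divisor_chain (array_row E i)" for i using e(1) by (simp add: r0)
    moreover have "{i. E (i, 0) \<noteq> 1} \<subseteq> {0}" by (auto simp: E_def)
    then have "finite {i. E (i, 0) \<noteq> 1}" using finite_subset by blast
    ultimately interpret finite_array E by unfold_locales
    have "prod E {c. E c \<noteq> 1} = prod e {j. e j \<noteq> 1}"
      by (rule prod.reindex_bij_witness[of _ "\<lambda>j. (0, j)" snd]) (auto simp: E_def split: if_splits)
    moreover have "E (i, j) = 1" if "\<not> enat i < 1" for i j
      using that by (cases i) (auto simp: E_def one_enat_def zero_enat_def)
    moreover have "E (Suc i, j) dvd E (i, j)" for i j by (simp add: E_def)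
    ultimately have "E \<in> plane_arrays 1 n" unfolding plane_arrays_iff using order by blast
    moreover have "C = class_array E 0" using G(3) e(2) by (simp add: class_array_def r0)
    ultimately show "C \<in> (\<lambda>E. class_array E 0) ` plane_arrays 1 n" by blast
  qed
  show "finite ((\<lambda>E. class_array E 0) ` plane_arrays 1 n)" using finite_plane_arrays[OF assms] by (rule finite_imageI)
qed

lemma group_partition_sum_eq:
  assumes n: "n > 0"
  shows "group_partition_sum r n = fill_count hook_weight (cell_triangle r n) n"
proof -
  let ?S = "Sigma (abelian_classes_of_order n) (bounded_partitions r)"
  have finS: "finite ?S"
    using bij_betw_finite[OF bij_plane_arrays] finite_plane_arrays[OF n] by blast
  have fin: "finite (bounded_partitions r C)" if "C \<in> abelian_classes_of_order n" for C
  proof -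
    have "Pair C ` bounded_partitions r C \<subseteq> ?S" using that by blast
    then have "finite (Pair C ` bounded_partitions r C)" using finS finite_subset by blast
    then show ?thesis by (rule finite_imageD) (simp add: inj_on_def)
  qed
  have "group_partition_sum r n = (\<Sum>C\<in>abelian_classes_of_order n. card (bounded_partitions r C))"
    by (simp add: group_partition_sum_def num_group_partitions_def bounded_partitions_def)
  also have "\<dots> = card ?S"
    using finite_abelian_classes_of_order[OF n] fin by (subst card_SigmaI) auto
  also have "\<dots> = card (plane_arrays r n)" using bij_betw_same_card[OF bij_plane_arrays] by simp
  also have "\<dots> = fill_count hook_weight (cell_triangle r n) n" by (rule card_plane_arrays[OF n])
  finally show ?thesis .
qed

theorem corollary3p2:
  fixes chi :: "int \<Rightarrow> complex" and j :: nat and r :: enat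
  assumes "j > 0" and "dirichlet_character j chi" and "r > 0"
  shows "(\<forall>s. Re s > 1 \<longrightarrow> summable (\<lambda>n. norm (J_term r chi s (Suc n)))) \<and>
         (\<exists>F. F meromorphic_on {s. Re s > 0} \<and> (\<forall>s. Re s > 1 \<longrightarrow> F s = J r chi s))"
proof -
  interpret character chi j using assms by unfold_locales
  have J_term: "J_term r chi s (Suc n) =
      of_nat (fill_count hook_weight (cell_triangle r (Suc n)) (Suc n)) * dcoeff s (Suc n)" for s n
    by (simp add: J_term_def dcoeff_def group_partition_sum_eq del: of_nat_Suc)
  show ?thesis
  proof (intro conjI allI impI exI)
    show "summable (\<lambda>n. norm (J_term r chi s (Suc n)))" if "Re s > 1" for s
      unfolding J_term by (rule L_prod_tendsto(1)[OF that])
    \<comment> \<open>The limit of the partial products is the witness. By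
      \<open>L_prod_tail\<close> it exists at every point of the half plane, so the unspecified
      value of \<open>lim\<close> never enters there.\<close>
    show "(\<lambda>s. lim (\<lambda>n. L_prod (diag_count r) n s)) meromorphic_on {s. Re s > 0}"
      by (rule meromorphic_lim_L_prod[OF diag_count_le])
    show "lim (\<lambda>n. L_prod (diag_count r) n s) = J r chi s" if "Re s > 1" for s
      unfolding J_def J_term by (rule limI[OF L_prod_tendsto(2)[OF that]])
  qed
qed

end
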